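(* Let $G=G_1+G_2$ with $G_1\in C^0([0,\infty))$ independent of $x$ and $G_2\in C^1([0,\infty);\mathrm{Lip}(\mathbb{R}^2))$, and assume that $G_1=0$ or $G_2=0$. Let $\varphi$ be a smooth and elliptic anisotropy on $\mathbb{R}^2$. Let $E_0\subset\mathbb{R}^2$ be a set with compact boundary satisfying the $RW_\varphi$-condition for some $R>0$. Then the regular flow starting from $E_0$ is unique. More precisely, let $E_0\subseteq E'_0$ be two sets with compact boundary, each satisfying the $RW_\varphi$-condition for some $R>0$, and let $E(t)$, $t\in[0,T]$, and $E'(t)$, $t\in[0,T']$, be regular flows starting from $E_0$ and $E_0'$ respectively. Then $E(t)\subseteq E'(t)$ for all $t\in[0,\min\{T,T'\}]$.
   Context: Anisotropies. An anisotropy is an even, convex, one-homogeneous, coercive function $\varphi$ on $\mathbb{R}^2$ (i.e. a norm), with $c_0|x|\le\varphi(x)\le c_0^{-1}|x|$ for some $c_0>0$. The polar is $\varphi^\circ(\nu)=\sup\{\nu\cdot x:\varphi(x)\le1\}$, and $W_\varphi=\{\varphi\le1\}$. $\varphi$ is smooth if $\varphi\in C^2(\mathbb{R}^2\setminus\{0\})$, and elliptic if $\nabla^2(\varphi^2)\ge c\,\mathrm{Id}$ in the distributional sense for some $c>0$. Signed distance. For $E\subset\mathbb{R}^2$, $d^E_\varphi(x)=\min_{y\in E}\varphi(x-y)-\min_{y\notin E}\varphi(y-x)$ (minima read as infima if not attained). $E^c=\mathbb{R}^2\setminus E$. $RW_\varphi$-condition. $E$ satisfies the inner $RW_\varphi$-condition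 ($R>0$) if $\overline E=\bigcup_{x:\,d^E_\varphi(x)\le -R}(x+RW_\varphi)$ and, for every $r<R$ and $x\in\mathbb{R}^2$, the set $(x+rW_\varphi)\cap E^c$ is connected. $E$ satisfies the outer $RW_\varphi$-condition if $E^c$ satisfies the inner one, and the $RW_\varphi$-condition if it satisfies both. Regular flow. Here a regular flow starting from $E_0$ is a family $E(t)\subset\mathbb{R}^2$, $t\in[0,T]$ ($T>0$), with $E(0)=E_0$, for which there exist $R'>0$, $\lambda>0$ and an open neighborhood $U$ of $\bigcup_{0\le t\le T}\partial E(t)$ such that $E(t)$ satisfies the $R'W_\varphi$-condition for all $t\in[0,T]$; $d^E_\varphi(t,x):=d_\varphi^{E(t)}(x)$ belongs to $C^0([0,T];\mathrm{Lip}(U))\cap L^\infty([0,T];C^{1,1}(U))$; $d^E_\varphi-G\in\mathrm{Lip}([0,T]\times U)$; and $$\left|\frac{\partial (d^E_\varphi-G)}{\partial t}(t,x)-\mathrm{div}\,\nabla\varphi^\circ(\nabla d^E_\varphi)(t,x)\right|\le\lambda\,|d^E_\varphi(t,x)|\qquad\text{for a.e. }(t,x)\in[0,T]\times U.$$ (This expresses motion with velocity $V=\kappa_\varphi+\partial G/\partial t$.) Since these conditions depend on the sets only through their signed distance functions, all sets are taken to be closed (that is, identified with their closures). *)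

theory Defs
  imports "HOL-Analysis.Analysis"
begin

type_synonym plane = "real^2"

subsection \<open>Derivatives\<close>

definition dderiv :: "plane \<Rightarrow> (plane \<Rightarrow> real) \<Rightarrow> plane \<Rightarrow> real" where
  "dderiv v f x = frechet_derivative f (at x) v"

definition grad :: "(plane \<Rightarrow> real) \<Rightarrow> plane \<Rightarrow> plane" where
  "grad f x = (THE g. GDERIV f x :> g)"

definition diverg :: "(plane \<Rightarrow> plane) \<Rightarrow> plane \<Rightarrow> real" where
  "diverg X x = (\<Sum>b\<in>Basis. frechet_derivative X (at x) b \<bullet> b)"

text \<open>\<open>Ck k S f\<close>: \<open>f\<close> is of class \<open>C\<^sup>k\<close> on \<open>S\<close>. Only meant for open \<open>S\<close>.\<close>

primrec Ck :: "nat \<Rightarrow> plane set \<Rightarrow> (plane \<Rightarrow> real) \<Rightarrow> bool" where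
  "Ck 0 S f \<longleftrightarrow> continuous_on S f"
| "Ck (Suc k) S f \<longleftrightarrow> (\<forall>x\<in>S. f differentiable (at x)) \<and> (\<forall>b\<in>Basis. Ck k S (dderiv b f))"

definition test_function :: "(plane \<Rightarrow> real) \<Rightarrow> bool" where
  "test_function \<eta> \<longleftrightarrow> (\<forall>k. Ck k UNIV \<eta>) \<and> compact (closure {x. \<eta> x \<noteq> 0})"


subsection \<open>Anisotropies\<close>

definition anisotropy :: "(plane \<Rightarrow> real) \<Rightarrow> bool" where
  "anisotropy \<phi> \<longleftrightarrow>
     (\<forall>x. \<phi> (- x) = \<phi> x) \<and>
     convex_on UNIV \<phi> \<and>
     (\<forall>s x. s \<ge> 0 \<longrightarrow> \<phi> (s *\<^sub>R x) = s * \<phi> x) \<and>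
     (\<exists>c0>0. \<forall>x. c0 * norm x \<le> \<phi> x \<and> \<phi> x \<le> norm x / c0)"

definition wulff :: "(plane \<Rightarrow> real) \<Rightarrow> plane set" where
  "wulff \<phi> = {x. \<phi> x \<le> 1}"

definition polar :: "(plane \<Rightarrow> real) \<Rightarrow> plane \<Rightarrow> real" where
  "polar \<phi> \<nu> = (SUP x\<in>wulff \<phi>. \<nu> \<bullet> x)"

definition smooth_anisotropy :: "(plane \<Rightarrow> real) \<Rightarrow> bool" where
  "smooth_anisotropy \<phi> \<longleftrightarrow> anisotropy \<phi> \<and> Ck 2 (UNIV - {0}) \<phi>"

text \<open>
  \<open>\<nabla>\<^sup>2(\<phi>\<^sup>2) \<ge> c Id\<close> in the sense of distributions: for every direction \<open>\<xi>\<close>, the distribution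
  \<open>\<xi> \<bullet> \<nabla>\<^sup>2(\<phi>\<^sup>2) \<xi> - c |\<xi>|\<^sup>2\<close> is nonnegative on nonnegative test functions.
\<close>

definition elliptic_anisotropy :: "(plane \<Rightarrow> real) \<Rightarrow> bool" where
  "elliptic_anisotropy \<phi> \<longleftrightarrow> anisotropy \<phi> \<and>
     (\<exists>c>0. \<forall>\<eta>. test_function \<eta> \<and> (\<forall>x. \<eta> x \<ge> 0) \<longrightarrow>
        (\<forall>\<xi>. c * (norm \<xi>)\<^sup>2 * (\<integral>x. \<eta> x \<partial>lborel)
              \<le> (\<integral>x. (\<phi> x)\<^sup>2 * dderiv \<xi> (dderiv \<xi> \<eta>) x \<partial>lborel)))"


subsection \<open>Signed distance and the \<open>RW\<^sub>\<phi>\<close>-condition\<close>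

text \<open>
  Extended-real valued, so that the distance to the empty set is \<open>\<infinity>\<close>: the signed distance is
  \<open>\<infinity>\<close> everywhere if \<open>E = {}\<close>, \<open>-\<infinity>\<close> everywhere if \<open>E = UNIV\<close>, and finite everywhere otherwise.
\<close>

definition sdist :: "(plane \<Rightarrow> real) \<Rightarrow> plane set \<Rightarrow> plane \<Rightarrow> ereal" where
  "sdist \<phi> E x = (INF y\<in>E. ereal (\<phi> (x - y))) - (INF y\<in>- E. ereal (\<phi> (y - x)))"

definition wulff_ball :: "(plane \<Rightarrow> real) \<Rightarrow> plane \<Rightarrow> real \<Rightarrow> plane set" where
  "wulff_ball \<phi> x r = (\<lambda>w. x + r *\<^sub>R w) ` wulff \<phi>"

definition inner_RW :: "(plane \<Rightarrow> real) \<Rightarrow> real \<Rightarrow> plane set \<Rightarrow> bool" where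
  "inner_RW \<phi> R E \<longleftrightarrow>
     closure E = (\<Union>x\<in>{x. sdist \<phi> E x \<le> ereal (- R)}. wulff_ball \<phi> x R) \<and>
     (\<forall>r x. 0 < r \<and> r < R \<longrightarrow> connected (wulff_ball \<phi> x r \<inter> - E))"

definition outer_RW :: "(plane \<Rightarrow> real) \<Rightarrow> real \<Rightarrow> plane set \<Rightarrow> bool" where
  "outer_RW \<phi> R E \<longleftrightarrow> inner_RW \<phi> R (- E)"

definition RW_condition :: "(plane \<Rightarrow> real) \<Rightarrow> real \<Rightarrow> plane set \<Rightarrow> bool" where
  "RW_condition \<phi> R E \<longleftrightarrow> inner_RW \<phi> R E \<and> outer_RW \<phi> R E"


subsection \<open>Time-dependent Lipschitz functions\<close>

text \<open>
  \<open>Lip(U)\<close> consists of the Lipschitz functions on \<open>U\<close>, possibly unbounded (when \<open>U\<close> is), normed by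
  \<open>|f(x\<^sub>0)|\<close> plus the Lipschitz constant of \<open>f\<close>, for any base point \<open>x\<^sub>0 \<in> U\<close>. The choice of
  \<open>x\<^sub>0\<close> does not matter: convergence in this norm is pointwise convergence together with
  convergence in the Lipschitz seminorm, and on bounded \<open>U\<close> the norm is equivalent to the one
  using the supremum of \<open>|f|\<close>.
\<close>

definition is_Lip :: "'a::metric_space set \<Rightarrow> ('a \<Rightarrow> real) \<Rightarrow> bool" where
  "is_Lip U f \<longleftrightarrow> (\<exists>L. L-lipschitz_on U f)"

definition tendsto_Lip ::
    "plane set \<Rightarrow> (real \<Rightarrow> plane \<Rightarrow> real) \<Rightarrow> (plane \<Rightarrow> real) \<Rightarrow> real filter \<Rightarrow> bool" where
  "tendsto_Lip U f l F \<longleftrightarrow>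
     (\<forall>x\<in>U. ((\<lambda>s. f s x) \<longlongrightarrow> l x) F) \<and>
     (\<forall>\<epsilon>>0. \<forall>\<^sub>F s in F. \<epsilon>-lipschitz_on U (\<lambda>x. f s x - l x))"

definition C0_Lip :: "real set \<Rightarrow> plane set \<Rightarrow> (real \<Rightarrow> plane \<Rightarrow> real) \<Rightarrow> bool" where
  "C0_Lip I U f \<longleftrightarrow>
     (\<forall>t\<in>I. is_Lip U (f t) \<and> tendsto_Lip U f (f t) (at t within I))"

definition C1_Lip :: "real set \<Rightarrow> plane set \<Rightarrow> (real \<Rightarrow> plane \<Rightarrow> real) \<Rightarrow> bool" where
  "C1_Lip I U f \<longleftrightarrow>
     (\<forall>t\<in>I. is_Lip U (f t)) \<and>
     (\<exists>f'. C0_Lip I U f' \<and>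
       (\<forall>t\<in>I. tendsto_Lip U (\<lambda>s x. (f s x - f t x) / (s - t)) (f' t) (at t within I)))"

text \<open>
  \<open>L\<^sup>\<infinity>(I; C\<^sup>1\<^sup>,\<^sup>1(U))\<close> for open \<open>U\<close>, where the norm of \<open>C\<^sup>1\<^sup>,\<^sup>1(U)\<close> again uses the value at a base point.
\<close>

definition Linf_C11 :: "real set \<Rightarrow> plane set \<Rightarrow> (real \<Rightarrow> plane \<Rightarrow> real) \<Rightarrow> bool" where
  "Linf_C11 I U f \<longleftrightarrow>
     (\<forall>x0\<in>U. \<exists>C. AE t in lebesgue_on I.
        (\<forall>x\<in>U. f t differentiable (at x)) \<and>
        \<bar>f t x0\<bar> \<le> C \<and>
        (\<forall>x\<in>U. norm (grad (f t) x) \<le> C) \<and>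
        C-lipschitz_on U (grad (f t)))"


subsection \<open>Regular flows\<close>

text \<open>
  The time derivative and the divergence in the differential inequality are classical
  derivatives. They exist almost everywhere (and agree there with the weak derivatives)
  because \<open>d - G\<close> is Lipschitz on \<open>[0,T] \<times> U\<close> and \<open>\<nabla>\<phi>\<degree>(\<nabla>d(t,\<cdot>))\<close> is locally Lipschitz on \<open>U\<close>.

  Requiring \<open>U\<close> to be nonempty and the signed distance to be real valued on \<open>U\<close> excludes
  \<open>E t = {}\<close> and \<open>E t = UNIV\<close>; with \<open>U = {}\<close> all other conditions would hold trivially for
  any family of sets with empty boundary.
\<close>

definition regular_flow ::
    "(plane \<Rightarrow> real) \<Rightarrow> (real \<Rightarrow> plane \<Rightarrow> real) \<Rightarrow> plane set \<Rightarrow> real \<Rightarrow> (real \<Rightarrow> plane set) \<Rightarrow> bool"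
where
  "regular_flow \<phi> G E0 T E \<longleftrightarrow>
     T > 0 \<and> E 0 = E0 \<and> (\<forall>t\<in>{0..T}. closed (E t)) \<and>
     (\<exists>R' \<Lambda> U. R' > 0 \<and> \<Lambda> > 0 \<and>
        open U \<and> U \<noteq> {} \<and> (\<Union>t\<in>{0..T}. frontier (E t)) \<subseteq> U \<and>
        (\<forall>t\<in>{0..T}. RW_condition \<phi> R' (E t)) \<and>
        (\<forall>t\<in>{0..T}. \<forall>x\<in>U. \<bar>sdist \<phi> (E t) x\<bar> \<noteq> \<infinity>) \<and>
        (let d = (\<lambda>t x. real_of_ereal (sdist \<phi> (E t) x)) in
           C0_Lip {0..T} U d \<and>
           Linf_C11 {0..T} U d \<and>
           is_Lip ({0..T} \<times> U) (\<lambda>(t, x). d t x - G t x) \<and>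
           (AE (t, x) in lebesgue_on ({0..T} \<times> U).
              let X = (\<lambda>y. grad (polar \<phi>) (grad (d t) y)) in
                X differentiable (at x) \<and>
                (\<exists>D. ((\<lambda>s. d s x - G s x) has_real_derivative D) (at t within {0..T}) \<and>
                     \<bar>D - diverg X x\<bar> \<le> \<Lambda> * \<bar>d t x\<bar>))))"

end

theory Submission
  imports Defs
begin

text \<open>
  Write \<open>d\<close>, \<open>d'\<close> for the signed distances of the two flows. On \<open>U \<inter> U'\<close> the functions
  \<open>d - G\<close> and \<open>d' - G\<close> satisfy the evolution equation up to \<open>\<Lambda> \<bar>d\<bar>\<close> and \<open>\<Lambda>' \<bar>d'\<bar>\<close>, and \<open>G\<close> cancels in
  \<open>d' - d\<close>. It suffices to show \<open>d' \<le> d + a(t)\<close> with \<open>a(t) = \<epsilon> exp (K t)\<close> for a large \<open>K\<close> and every small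
  \<open>\<epsilon>\<close>. By the outer Wulff shape condition this inequality holds everywhere as soon as \<open>d' \<le> a\<close> holds
  where \<open>d \<le> 0\<close>. If it holds at time \<open>t0\<close>, subtract from \<open>d' - d - a\<close> a small penalty, a function of
  \<open>d - G1(t) + G1(t0)\<close> that localises the positive part \<open>W\<close> of the difference in a strip around the
  boundary of \<open>E t0\<close>. There \<open>a' = K a\<close> absorbs all error terms. Since \<open>\<nabla>\<phi>\<degree>\<close> is monotone and homogeneous
  of degree 0 (so that it does not see the penalty), integrating \<open>div (\<nabla>\<phi>\<degree>(\<nabla>d') - \<nabla>\<phi>\<degree>(\<nabla>d))\<close>
  against \<open>W\<^sup>2\<close> shows that \<open>\<integral> W\<^sup>3\<close> does not increase, so \<open>W = 0\<close> and the inequality persists.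
\<close>

section \<open>Smooth bump functions and ellipticity\<close>

text \<open>The gradients of \<open>d\<close> and \<open>d'\<close> are merely Lipschitz in space,
  so second derivatives exist only almost everywhere and may fail exactly at a maximum point; hence
  a comparison under the integral, where monotonicity of the flux suffices. The equations carry
  information only near the boundaries, so a localisation is unavoidable. An ordinary cutoff would
  create an uncontrolled flux term, whereas a function of \<open>d\<close> merely multiplies
  \<nabla>d by a positive factor. As \<open>G1\<close> is only continuous, \<open>d\<close> need not
  have a time derivative, but \<open>d - G1\<close> is Lipschitz in time; adding
  \<open>G1 t0\<close> makes the argument of the penalty agree with \<open>d\<close> at the starting
  time of each step. The penalty costs nothing in the end: where \<open>d\<close> is nonpositive it
  is at most d^2, hence at most -d, and \<open>d' \<le> d + a + penalty\<close> still gives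
  \<open>d' \<le> a\<close>. This only controls \<open>d'\<close> inside the first set; the next
  step in time needs \<open>d' \<le> d + a\<close> on both sides of the boundary, which is why the
  geometric passage back to the whole plane is part of the induction.\<close>

lemma anisotropy_continuous: assumes "anisotropy \<phi>" shows "continuous_on UNIV \<phi>"
  using assms unfolding anisotropy_def by (intro convex_on_continuous) auto

lemma continuous_compact_support_integrable:
  fixes f :: "'a::euclidean_space \<Rightarrow> real"
  assumes "continuous_on UNIV f" "compact S" "\<And>x. x \<notin> S \<Longrightarrow> f x = 0"
  shows "integrable lborel f"
proof -
  have "integrable lborel (\<lambda>x. indicator S x *\<^sub>R f x)"
    using assms(1,2) by (intro borel_integrable_compact) (auto intro: continuous_on_subset)
  moreover have "(\<lambda>x. indicator S x *\<^sub>R f x) = f"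
    using assms(3) by (auto simp: indicator_def fun_eq_iff)
  ultimately show ?thesis by simp
qed

lemma integral_continuous_pos:
  fixes f :: "'a::euclidean_space \<Rightarrow> real"
  assumes cont: "continuous_on UNIV f" and int: "integrable lborel f"
    and nonneg: "\<And>x. f x \<ge> 0" and pos: "f y > 0"
  shows "(\<integral>x. f x \<partial>lborel) > 0"
proof (rule ccontr)
  assume "\<not> ?thesis"
  moreover have "(\<integral>x. f x \<partial>lborel) \<ge> 0" using nonneg by simp
  ultimately have "(\<integral>x. f x \<partial>lborel) = 0" by linarith
  then have "AE x in lborel. f x = 0"
    using integral_nonneg_eq_0_iff_AE[OF int] nonneg by simp
  then have "AE x in lebesgue. f x = 0" by (simp add: AE_completion_iff)
  then obtain N where "N \<in> null_sets lebesgue" "{x. f x \<noteq> 0} \<subseteq> N"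
    by (elim AE_E3) auto
  then have "negligible {x. f x \<noteq> 0}"
    using negligible_iff_null_sets negligible_subset by blast
  moreover have "open {x. f x \<noteq> 0}"
  proof -
    have "{x. f x \<noteq> 0} = f -` (- {0})" by auto
    then show ?thesis using open_vimage[OF open_Compl[OF closed_singleton] cont] by metis
  qed
  ultimately show False using open_not_negligible pos by fastforce
qed

section \<open>Explicit smooth functions with compact support\<close>

definition exp_recip :: "nat \<Rightarrow> real \<Rightarrow> real" where
  "exp_recip n x = (if x \<le> 0 then 0 else exp (- 1 / x) / x ^ n)"

lemma exp_recip_tendsto_0: "(exp_recip n \<longlongrightarrow> 0) (at 0)"
proof -
  have "((\<lambda>x::real. inverse x ^ n / exp (inverse x)) \<longlongrightarrow> 0) (at_right 0)"
    by (rule filterlim_compose[OF tendsto_power_div_exp_0 filterlim_inverse_at_top_right])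
  then have r: "(exp_recip n \<longlongrightarrow> 0) (at_right 0)"
    by (rule Lim_transform_eventually)
      (auto simp: eventually_at_filter exp_recip_def exp_minus divide_simps inverse_eq_divide power_one_over)
  have "(exp_recip n \<longlongrightarrow> 0) (at_left 0)"
    by (rule Lim_transform_eventually[OF tendsto_const]) (auto simp: eventually_at_filter exp_recip_def)
  with r show ?thesis by (simp add: filterlim_split_at)
qed

text \<open>The powers of \<open>1 / x\<close> are carried along so that the family is closed under
  differentiation up to linear combinations. At 0 the difference quotient is itself
  \<open>exp_recip (n + 1)\<close>, which tends to 0.\<close>

lemma DERIV_exp_recip:
  "(exp_recip n has_real_derivative exp_recip (n + 2) x - n * exp_recip (n + 1) x) (at x)"
proof -
  consider "x < 0" | "x = 0" | "x > 0" by linarith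
  then show ?thesis
  proof cases
    case 1
    have "((\<lambda>x. 0) has_real_derivative exp_recip (n + 2) x - n * exp_recip (n + 1) x) (at x)"
      using 1 by (simp add: exp_recip_def)
    then show ?thesis
      by (rule has_field_derivative_transform_within_open[where S="{..<0}"]) (use 1 in \<open>auto simp: exp_recip_def\<close>)
  next
    case 2
    have "((\<lambda>h. (exp_recip n (0 + h) - exp_recip n 0) / h) \<longlongrightarrow> 0) (at 0)"
      by (rule Lim_transform_eventually[OF exp_recip_tendsto_0[of "n + 1"]])
        (auto simp: eventually_at_filter exp_recip_def)
    then show ?thesis using 2 by (simp add: DERIV_def exp_recip_def)
  next
    case 3
    have e: "((\<lambda>x. exp (- 1 / x)) has_real_derivative exp (- 1 / x) / x\<^sup>2) (at x)"
      using 3 by (auto intro!: derivative_eq_intros simp: power2_eq_square)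
    have p: "((\<lambda>x. x ^ n) has_real_derivative n * x ^ n / x) (at x)"
      by (rule DERIV_cong[OF DERIV_pow]) (use 3 in \<open>cases n; simp\<close>)
    have "((\<lambda>x. exp (- 1 / x) / x ^ n) has_real_derivative exp_recip (n + 2) x - n * exp_recip (n + 1) x) (at x)"
      by (rule DERIV_cong[OF DERIV_divide[OF e p]])
        (use 3 in \<open>simp_all add: exp_recip_def field_simps power2_eq_square\<close>)
    then show ?thesis
      by (rule has_field_derivative_transform_within_open[where S="{0<..}"]) (use 3 in \<open>auto simp: exp_recip_def\<close>)
  qed
qed

text \<open>The point of this class is its closure under directional derivatives: it yields
  \<open>Ck k\<close> for every \<open>k\<close> by a single induction, while products of base
  functions already provide bumps.\<close>

inductive smooth_alg :: "(plane \<Rightarrow> real) \<Rightarrow> bool" where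
  base: "smooth_alg (\<lambda>x. exp_recip n (l \<bullet> x + c))"
| add: "smooth_alg f \<Longrightarrow> smooth_alg g \<Longrightarrow> smooth_alg (\<lambda>x. f x + g x)"
| mult: "smooth_alg f \<Longrightarrow> smooth_alg g \<Longrightarrow> smooth_alg (\<lambda>x. f x * g x)"
| scale: "smooth_alg f \<Longrightarrow> smooth_alg (\<lambda>x. a * f x)"

lemma smooth_alg_has_derivative:
  assumes "smooth_alg f"
  shows "\<exists>F. (\<forall>v. smooth_alg (F v)) \<and> (\<forall>x. (f has_derivative (\<lambda>v. F v x)) (at x))"
  using assms
proof induction
  case (base n l c)
  let ?F = "\<lambda>v x. (l \<bullet> v) * (exp_recip (n + 2) (l \<bullet> x + c) + (- real n) * exp_recip (n + 1) (l \<bullet> x + c))"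
  have "((\<lambda>x. exp_recip n (l \<bullet> x + c)) has_derivative (\<lambda>v. ?F v x)) (at x)" for x
  proof -
    have "((\<lambda>x. l \<bullet> x + c) has_derivative (\<lambda>v. l \<bullet> v)) (at x)"
      by (auto intro!: derivative_eq_intros)
    from DERIV_compose_FDERIV[OF DERIV_exp_recip this]
    show ?thesis by (simp add: algebra_simps)
  qed
  moreover have "smooth_alg (?F v)" for v
    by (intro smooth_alg.intros)
  ultimately show ?case by (intro exI[of _ ?F]) auto
next
  case (add f g)
  then obtain F G where "\<forall>v. smooth_alg (F v)" "\<forall>x. (f has_derivative (\<lambda>v. F v x)) (at x)"
    "\<forall>v. smooth_alg (G v)" "\<forall>x. (g has_derivative (\<lambda>v. G v x)) (at x)" by blast
  then show ?case
    by (intro exI[of _ "\<lambda>v x. F v x + G v x"]) (auto intro!: smooth_alg.intros has_derivative_add)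
next
  case (mult f g)
  then obtain F G where "\<forall>v. smooth_alg (F v)" "\<forall>x. (f has_derivative (\<lambda>v. F v x)) (at x)"
    "\<forall>v. smooth_alg (G v)" "\<forall>x. (g has_derivative (\<lambda>v. G v x)) (at x)" by blast
  with mult.hyps show ?case
    by (intro exI[of _ "\<lambda>v x. f x * G v x + F v x * g x"]) (auto intro!: smooth_alg.intros has_derivative_mult)
next
  case (scale f a)
  then obtain F where "\<forall>v. smooth_alg (F v)" "\<forall>x. (f has_derivative (\<lambda>v. F v x)) (at x)" by blast
  then show ?case
    by (intro exI[of _ "\<lambda>v x. a * F v x"]) (auto intro!: smooth_alg.intros has_derivative_mult_right)
qed

lemma
  assumes "smooth_alg f"
  shows smooth_alg_differentiable: "(f has_derivative (\<lambda>v. dderiv v f x)) (at x)"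
    and smooth_alg_dderiv: "smooth_alg (dderiv v f)"
proof -
  obtain F where F: "\<forall>v. smooth_alg (F v)" "\<And>x. (f has_derivative (\<lambda>v. F v x)) (at x)"
    using smooth_alg_has_derivative[OF assms] by blast
  then have "dderiv v f x = F v x" for v x
    unfolding dderiv_def by (metis frechet_derivative_at)
  then have "dderiv v f = F v" for v by auto
  with F show "(f has_derivative (\<lambda>v. dderiv v f x)) (at x)" "smooth_alg (dderiv v f)" by auto
qed

lemma smooth_alg_continuous: "smooth_alg f \<Longrightarrow> continuous_on UNIV f"
  by (meson continuous_at_imp_continuous_on has_derivative_continuous smooth_alg_differentiable)

lemma smooth_alg_Ck: "smooth_alg f \<Longrightarrow> Ck k UNIV f"
proof (induction k arbitrary: f)
  case 0
  then show ?case by (simp add: smooth_alg_continuous)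
next
  case (Suc k)
  then show ?case
    using smooth_alg_differentiable smooth_alg_dderiv by (auto simp: differentiable_def)
qed

text \<open>A product of four flat functions is positive exactly on an open square around
  \<open>y\<close>. Its half-width is \<open>r / 2\<close> because the sum of the two coordinate
  distances bounds the Euclidean distance.\<close>

lemma smooth_alg_bump:
  assumes "r > 0"
  obtains \<eta> where "smooth_alg \<eta>" "\<And>x. \<eta> x \<ge> 0" "\<eta> y > 0"
    "\<And>x. x \<notin> cball y r \<Longrightarrow> \<eta> x = 0"
proof -
  define \<delta> where "\<delta> = r / 2"
  have \<delta>: "\<delta> > 0" using assms by (simp add: \<delta>_def)
  define l where "l = (\<lambda>i::2. axis i (1::real))"
  define \<eta> where "\<eta> = (\<lambda>x::plane. (exp_recip 0 (l 1 \<bullet> x + (\<delta> - l 1 \<bullet> y)) * exp_recip 0 ((- l 1) \<bullet> x + (\<delta> + l 1 \<bullet> y)))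
    * (exp_recip 0 (l 2 \<bullet> x + (\<delta> - l 2 \<bullet> y)) * exp_recip 0 ((- l 2) \<bullet> x + (\<delta> + l 2 \<bullet> y))))"
  have l: "l i \<bullet> x = x $ i" for i x by (simp add: l_def inner_axis')
  have s: "smooth_alg \<eta>" unfolding \<eta>_def by (intro smooth_alg.intros)
  have nn: "\<eta> x \<ge> 0" for x by (simp add: \<eta>_def exp_recip_def)
  have pos: "\<eta> y > 0" using \<delta> by (simp add: \<eta>_def exp_recip_def)
  have z: "\<eta> x = 0" if "x \<notin> cball y r" for x
  proof (rule ccontr)
    assume "\<eta> x \<noteq> 0"
    then have "\<bar>(x - y) $ 1\<bar> < \<delta>" "\<bar>(x - y) $ 2\<bar> < \<delta>"
      by (auto simp: \<eta>_def exp_recip_def l split: if_splits)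
    moreover have "norm (x - y) \<le> (\<Sum>i\<in>UNIV. \<bar>(x - y) $ i\<bar>)" by (rule norm_le_l1_cart)
    ultimately have "norm (x - y) < 2 * \<delta>" by (simp add: sum_2)
    then show False using that by (simp add: \<delta>_def dist_norm norm_minus_commute)
  qed
  with s nn pos z that show ?thesis by blast
qed

section \<open>From distributional to pointwise ellipticity\<close>

lemma integral_translate_derivative:
  fixes \<Phi> u u' :: "plane \<Rightarrow> real"
  assumes \<Phi>: "continuous_on UNIV \<Phi>" and u: "continuous_on UNIV u" and u': "continuous_on UNIV u'"
    and D: "\<And>x s. ((\<lambda>s. u (x + s *\<^sub>R \<xi>)) has_real_derivative u' (x + s *\<^sub>R \<xi>)) (at s)"
    and S: "bounded S" "\<And>x. x \<notin> S \<Longrightarrow> u x = 0" "\<And>x. x \<notin> S \<Longrightarrow> u' x = 0"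
    and s: "\<bar>s\<bar> < 2"
  shows "((\<lambda>s. \<integral>x. \<Phi> x * u (x + s *\<^sub>R \<xi>) \<partial>lborel) has_real_derivative
     (\<integral>x. \<Phi> x * u' (x + s *\<^sub>R \<xi>) \<partial>lborel)) (at s)"
proof -
  obtain B where B: "\<And>x. x \<in> S \<Longrightarrow> norm x \<le> B" using S(1) by (auto simp: bounded_iff)
  \<comment> \<open>For \<open>\<bar>s\<bar> < 2\<close> all translated supports lie in this one
    box, so differentiation under the integral takes place over a fixed domain. The shifts used
    later are -1, 0 and 1.\<close>
  obtain a b :: plane where ab: "cball 0 (B + 2 * norm \<xi>) \<subseteq> cbox a b"
    by (meson bounded_cball bounded_subset_cbox_symmetric)
  have cont: "continuous_on UNIV (\<lambda>x. \<Phi> x * w (x + s *\<^sub>R \<xi>))"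
    if "continuous_on UNIV w" for w :: "plane \<Rightarrow> real" and s
    using that \<Phi> by (auto intro!: continuous_intros continuous_on_compose2[of UNIV w])
  have out: "x + s *\<^sub>R \<xi> \<notin> S" if "\<bar>s\<bar> < 2" "x \<notin> cbox a b" for s x
  proof
    assume "x + s *\<^sub>R \<xi> \<in> S"
    from B[OF this] have "norm x \<le> B + norm (s *\<^sub>R \<xi>)"
      using norm_triangle_ineq4[of "x + s *\<^sub>R \<xi>" "s *\<^sub>R \<xi>"] by simp
    also have "\<dots> \<le> B + 2 * norm \<xi>" using that by (simp add: mult_right_mono)
    finally show False using that ab by auto
  qed
  have eq: "(\<integral>x. \<Phi> x * w (x + s *\<^sub>R \<xi>) \<partial>lborel) = integral (cbox a b) (\<lambda>x. \<Phi> x * w (x + s *\<^sub>R \<xi>))"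
    if w: "continuous_on UNIV w" "\<And>x. x \<notin> S \<Longrightarrow> w x = 0" and s: "\<bar>s\<bar> < 2" for w :: "plane \<Rightarrow> real" and s
  proof -
    let ?f = "\<lambda>x. \<Phi> x * w (x + s *\<^sub>R \<xi>)"
    have z: "?f x = 0" if "x \<notin> cbox a b" for x using out[OF s that] w by simp
    then have "integrable lborel ?f"
      by (intro continuous_compact_support_integrable[OF cont[OF w(1)], of "cbox a b"]) auto
    then have "(\<integral>x. ?f x \<partial>lborel) = integral UNIV ?f" by (simp add: integral_lborel)
    also have "\<dots> = integral UNIV (\<lambda>x. if x \<in> cbox a b then ?f x else 0)"
      by (rule arg_cong[where f="integral UNIV"]) (use z in auto)
    finally show ?thesis by (simp only: integral_restrict_UNIV)
  qed
  have c2: "continuous_on ({-2<..<2} \<times> cbox a b) (\<lambda>(s, x). \<Phi> x * u' (x + s *\<^sub>R \<xi>))"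
  proof -
    have "continuous_on ({-2<..<2} \<times> cbox a b) (\<lambda>p::real \<times> plane. \<Phi> (snd p))"
      by (rule continuous_on_compose2[OF \<Phi> continuous_on_snd[OF continuous_on_id]]) simp
    moreover have "continuous_on ({-2<..<2} \<times> cbox a b) (\<lambda>p::real \<times> plane. snd p + fst p *\<^sub>R \<xi>)"
      by (intro continuous_intros)
    from continuous_on_compose2[OF u' this]
    have "continuous_on ({-2<..<2} \<times> cbox a b) (\<lambda>p::real \<times> plane. u' (snd p + fst p *\<^sub>R \<xi>))" by simp
    ultimately show ?thesis unfolding case_prod_unfold by (rule continuous_on_mult)
  qed
  have "((\<lambda>s. integral (cbox a b) (\<lambda>x. \<Phi> x * u (x + s *\<^sub>R \<xi>))) has_real_derivative
     integral (cbox a b) (\<lambda>x. \<Phi> x * u' (x + s *\<^sub>R \<xi>))) (at s within {-2<..<2})"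
  proof (rule leibniz_rule_field_derivative[OF _ _ c2])
    show "((\<lambda>s. \<Phi> x * u (x + s *\<^sub>R \<xi>)) has_real_derivative \<Phi> x * u' (x + s *\<^sub>R \<xi>)) (at s within {-2<..<2})" for s x
      by (rule DERIV_subset[OF DERIV_cmult[OF D] subset_UNIV])
    show "(\<lambda>x. \<Phi> x * u (x + s *\<^sub>R \<xi>)) integrable_on cbox a b" for s
      by (rule integrable_continuous) (rule continuous_on_subset[OF cont[OF u]], auto)
  qed (use s in auto)
  moreover have "at s within {-2<..<2} = at s" using s by (intro at_within_open) auto
  ultimately have "((\<lambda>s. integral (cbox a b) (\<lambda>x. \<Phi> x * u (x + s *\<^sub>R \<xi>))) has_real_derivative
     (\<integral>x. \<Phi> x * u' (x + s *\<^sub>R \<xi>) \<partial>lborel)) (at s)" using eq[OF u' S(3) s] by simp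
  moreover have "\<forall>\<^sub>F s in nhds s. (\<integral>x. \<Phi> x * u (x + s *\<^sub>R \<xi>) \<partial>lborel) = integral (cbox a b) (\<lambda>x. \<Phi> x * u (x + s *\<^sub>R \<xi>))"
  proof -
    have "\<forall>\<^sub>F s in nhds s. s \<in> {-2<..<2}" by (rule eventually_nhds_in_open) (use s in auto)
    then show ?thesis by eventually_elim (rule eq[OF u S(2)], auto)
  qed
  ultimately show ?thesis by (subst DERIV_cong_ev[OF refl _ refl])
qed

lemma integral_translate_lborel:
  fixes f :: "'a::euclidean_space \<Rightarrow> real"
  assumes "f \<in> borel_measurable borel"
  shows "(\<integral>x. f (x + a) \<partial>lborel) = (\<integral>x. f x \<partial>lborel)"
proof -
  have "(\<integral>x. f x \<partial>lborel) = (\<integral>x. f x \<partial>(distr lborel borel ((+) a)))" by (simp add: lborel_distr_plus)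
  also have "\<dots> = (\<integral>x. f (a + x) \<partial>lborel)" by (rule integral_distr) (use assms in auto)
  finally show ?thesis by (simp add: add.commute)
qed

lemma smooth_alg_translate: "smooth_alg f \<Longrightarrow> smooth_alg (\<lambda>x. f (x + a))"
proof (induction rule: smooth_alg.induct)
  case (base n l c)
  show ?case using smooth_alg.base[of n l "l \<bullet> a + c"] by (simp add: inner_add_right add.assoc)
qed (auto intro: smooth_alg.intros)

lemma dderiv_translate:
  assumes "smooth_alg f" shows "dderiv v (\<lambda>x. f (x + a)) = (\<lambda>x. dderiv v f (x + a))"
proof
  fix x
  have "((\<lambda>x. x + a) has_derivative (\<lambda>h. h)) (at x)" by (auto intro!: derivative_eq_intros)
  from has_derivative_compose[OF this smooth_alg_differentiable[OF assms]]
  have "((\<lambda>x. f (x + a)) has_derivative (\<lambda>v. dderiv v f (x + a))) (at x)" .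
  then show "dderiv v (\<lambda>x. f (x + a)) x = dderiv v f (x + a)"
    unfolding dderiv_def[of v "\<lambda>x. f (x + a)"] by (simp add: frechet_derivative_at[symmetric])
qed

lemma smooth_alg_line_derivative:
  assumes "smooth_alg u"
  shows "((\<lambda>s. u (x + s *\<^sub>R \<xi>)) has_real_derivative dderiv \<xi> u (x + s *\<^sub>R \<xi>)) (at s)"
proof -
  have D: "(u has_derivative (\<lambda>v. dderiv v u z)) (at z)" for z by (rule smooth_alg_differentiable[OF assms])
  have "((\<lambda>s. x + s *\<^sub>R \<xi>) has_derivative (\<lambda>h. h *\<^sub>R \<xi>)) (at s)" by (auto intro!: derivative_eq_intros)
  from has_derivative_compose[OF this D]
  have "((\<lambda>s. u (x + s *\<^sub>R \<xi>)) has_derivative (\<lambda>h. dderiv (h *\<^sub>R \<xi>) u (x + s *\<^sub>R \<xi>))) (at s)" .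
  moreover have "dderiv (h *\<^sub>R \<xi>) u z = dderiv \<xi> u z * h" for h z
    using linear_scale[OF has_derivative_linear[OF D[of z]], of h \<xi>] by simp
  ultimately show ?thesis by (simp add: has_field_derivative_def)
qed

lemma smooth_alg_test_function:
  assumes "smooth_alg \<eta>" "\<And>x. x \<notin> cball y r \<Longrightarrow> \<eta> x = 0"
  shows "test_function \<eta>"
proof -
  have "closure {x. \<eta> x \<noteq> 0} \<subseteq> cball y r"
    by (rule closure_minimal) (use assms(2) in blast, rule closed_cball)
  then have "compact (closure {x. \<eta> x \<noteq> 0})"
    by (meson bounded_cball bounded_subset closed_closure compact_eq_bounded_closed)
  then show "test_function \<eta>" unfolding test_function_def using assms smooth_alg_Ck by auto
qed

lemma smooth_alg_dderiv_zero:
  assumes "smooth_alg \<eta>" "\<And>x. x \<notin> cball y r \<Longrightarrow> \<eta> x = 0" "x \<notin> cball y r"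
  shows "dderiv v \<eta> x = 0"
proof -
  have "(\<eta> has_derivative (\<lambda>_. 0)) (at x)"
    by (rule has_derivative_transform_within_open[of "\<lambda>_. 0" _ _ _ "- cball y r"])
      (use assms(2,3) in auto)
  from has_derivative_unique[OF this smooth_alg_differentiable[OF assms(1)]] show ?thesis by metis
qed

text \<open>Translates of a test function are test functions, so ellipticity bounds the second
  derivative in \<open>s\<close> of the integral of \<phi>^2 against the translates along \<xi> from
  below by a constant \<open>C\<close>. Subtracting the parabola \<open>C * s\<^sup>2 / 2\<close>
  leaves a convex function, whose midpoint inequality is the claim integrated against \<eta>. A
  pointwise failure would persist on a ball by continuity, and a bump supported there contradicts
  the integrated form.\<close>

lemma elliptic_strongly_convex:
  assumes "elliptic_anisotropy \<phi>"
  obtains c where "c > 0"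
    "\<And>y \<xi>. c * (norm \<xi>)\<^sup>2 \<le> (\<phi> (y + \<xi>))\<^sup>2 + (\<phi> (y - \<xi>))\<^sup>2 - 2 * (\<phi> y)\<^sup>2"
proof -
  have an: "anisotropy \<phi>" using assms by (simp add: elliptic_anisotropy_def)
  obtain c where c: "c > 0" and ell: "\<And>\<eta> \<xi>. test_function \<eta> \<Longrightarrow> (\<And>x. \<eta> x \<ge> 0) \<Longrightarrow>
      c * (norm \<xi>)\<^sup>2 * (\<integral>x. \<eta> x \<partial>lborel) \<le> (\<integral>x. (\<phi> x)\<^sup>2 * dderiv \<xi> (dderiv \<xi> \<eta>) x \<partial>lborel)"
    using assms by (auto simp: elliptic_anisotropy_def)
  have \<phi>: "continuous_on UNIV \<phi>" by (rule anisotropy_continuous[OF an])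
  have \<Phi>: "continuous_on UNIV (\<lambda>x. (\<phi> x)\<^sup>2)" by (intro continuous_intros \<phi>)
  have main: "c * (norm \<xi>)\<^sup>2 * (\<integral>x. \<eta> x \<partial>lborel) \<le>
      (\<integral>x. ((\<phi> (x + \<xi>))\<^sup>2 + (\<phi> (x - \<xi>))\<^sup>2 - 2 * (\<phi> x)\<^sup>2) * \<eta> x \<partial>lborel)"
    if \<eta>: "smooth_alg \<eta>" "\<And>x. \<eta> x \<ge> 0" "\<And>x. x \<notin> cball y r \<Longrightarrow> \<eta> x = 0"
    for \<eta> \<xi> y r
  proof -
    let ?\<Phi> = "\<lambda>x. (\<phi> x)\<^sup>2"
    define k where "k = (\<lambda>w s. \<integral>x. ?\<Phi> x * w (x + s *\<^sub>R \<xi>) \<partial>lborel)"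
    define C where "C = c * (norm \<xi>)\<^sup>2 * (\<integral>x. \<eta> x \<partial>lborel)"
    let ?\<eta>1 = "dderiv \<xi> \<eta>" let ?\<eta>2 = "dderiv \<xi> ?\<eta>1"
    have \<eta>1: "smooth_alg ?\<eta>1" by (rule smooth_alg_dderiv[OF \<eta>(1)])
    have \<eta>2: "smooth_alg ?\<eta>2" by (rule smooth_alg_dderiv[OF \<eta>1])
    have z1: "?\<eta>1 x = 0" if "x \<notin> cball y r" for x
      using smooth_alg_dderiv_zero[OF \<eta>(1,3) that] by simp
    have z2: "?\<eta>2 x = 0" if "x \<notin> cball y r" for x
      using smooth_alg_dderiv_zero[OF \<eta>1 z1 that] by simp
    note cont = smooth_alg_continuous[OF \<eta>(1)] smooth_alg_continuous[OF \<eta>1] smooth_alg_continuous[OF \<eta>2]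
    have d1: "(k \<eta> has_real_derivative k ?\<eta>1 s) (at s)" if "\<bar>s\<bar> < 2" for s
      unfolding k_def
      by (rule integral_translate_derivative[OF \<Phi> cont(1,2) smooth_alg_line_derivative[OF \<eta>(1)] bounded_cball \<eta>(3) z1 that])
    have d2: "(k ?\<eta>1 has_real_derivative k ?\<eta>2 s) (at s)" if "\<bar>s\<bar> < 2" for s
      unfolding k_def
      by (rule integral_translate_derivative[OF \<Phi> cont(2,3) smooth_alg_line_derivative[OF \<eta>1] bounded_cball z1 z2 that])
    have ge: "C \<le> k ?\<eta>2 s" for s
    proof -
      let ?\<eta>s = "\<lambda>x. \<eta> (x + s *\<^sub>R \<xi>)"
      have "test_function ?\<eta>s"
        by (rule smooth_alg_test_function[OF smooth_alg_translate[OF \<eta>(1)], of "y - s *\<^sub>R \<xi>" r])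
          (rule \<eta>(3), simp add: dist_norm algebra_simps)
      from ell[OF this \<eta>(2), of \<xi>]
      have "c * (norm \<xi>)\<^sup>2 * (\<integral>x. ?\<eta>s x \<partial>lborel) \<le> k ?\<eta>2 s"
        by (simp add: dderiv_translate \<eta>(1) \<eta>1 k_def)
      moreover have "(\<integral>x. ?\<eta>s x \<partial>lborel) = (\<integral>x. \<eta> x \<partial>lborel)"
        by (rule integral_translate_lborel) (rule borel_measurable_continuous_onI[OF cont(1)])
      ultimately show ?thesis by (simp add: C_def)
    qed
    let ?h = "\<lambda>s. k \<eta> s - C * s\<^sup>2 / 2"
    have "convex_on {-2<..<2} ?h"
    proof (rule f''_ge0_imp_convex)
      show "DERIV ?h s :> k ?\<eta>1 s - C * s" if "s \<in> {-2<..<2}" for s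
        using that by (auto intro!: derivative_eq_intros d1)
      show "DERIV (\<lambda>s. k ?\<eta>1 s - C * s) s :> k ?\<eta>2 s - C" if "s \<in> {-2<..<2}" for s
        using that by (auto intro!: derivative_eq_intros d2)
      show "0 \<le> k ?\<eta>2 s - C" for s using ge[of s] by simp
    qed simp
    from convex_onD[OF this, of "1/2" "-1" 1]
    have "C \<le> k \<eta> 1 + k \<eta> (-1) - 2 * k \<eta> 0" by (simp add: field_simps)
    also have "\<dots> = (\<integral>x. ((\<phi> (x + \<xi>))\<^sup>2 + (\<phi> (x - \<xi>))\<^sup>2 - 2 * (\<phi> x)\<^sup>2) * \<eta> x \<partial>lborel)"
    proof -
      \<comment> \<open>Moving the shift from \<eta> to \<phi> lets the three values of
        \<open>k \<eta>\<close> combine into a second difference of \<phi>^2.\<close>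
      have k: "k \<eta> s = (\<integral>x. ?\<Phi> (x - s *\<^sub>R \<xi>) * \<eta> x \<partial>lborel)" for s
      proof -
        have "(\<lambda>x. ?\<Phi> (x - s *\<^sub>R \<xi>) * \<eta> x) \<in> borel_measurable borel"
          by (intro borel_measurable_continuous_onI continuous_intros cont(1) continuous_on_compose2[OF \<phi>]) auto
        from integral_translate_lborel[OF this, of "s *\<^sub>R \<xi>"] show ?thesis by (simp add: k_def)
      qed
      have i: "integrable lborel (\<lambda>x. ?\<Phi> (x - s *\<^sub>R \<xi>) * \<eta> x)" for s
        by (rule continuous_compact_support_integrable[OF _ compact_cball])
          (use \<eta>(3) in \<open>auto intro!: continuous_intros cont(1) continuous_on_compose2[OF \<phi>]\<close>)
      show ?thesis using i[of 1] i[of "-1"] i[of 0] unfolding k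
        by (simp add: left_diff_distrib distrib_right mult.assoc)
    qed
    finally show ?thesis unfolding C_def .
  qed
  show ?thesis
  proof (rule that[OF c], rule ccontr)
    fix y \<xi>
    let ?q = "\<lambda>x. c * (norm \<xi>)\<^sup>2 - ((\<phi> (x + \<xi>))\<^sup>2 + (\<phi> (x - \<xi>))\<^sup>2 - 2 * (\<phi> x)\<^sup>2)"
    assume "\<not> c * (norm \<xi>)\<^sup>2 \<le> (\<phi> (y + \<xi>))\<^sup>2 + (\<phi> (y - \<xi>))\<^sup>2 - 2 * (\<phi> y)\<^sup>2"
    then have qy: "?q y > 0" by simp
    have qc: "continuous_on UNIV ?q"
      by (intro continuous_intros continuous_on_compose2[OF \<phi>]) auto
    have "open (?q -` {0<..})" using qc by (intro open_vimage) auto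
    moreover have "y \<in> ?q -` {0<..}" using qy by simp
    ultimately obtain r where r: "r > 0" "cball y r \<subseteq> ?q -` {0<..}"
      unfolding open_contains_cball by blast
    obtain \<eta> where \<eta>: "smooth_alg \<eta>" "\<And>x. \<eta> x \<ge> 0" "\<eta> y > 0"
      "\<And>x. x \<notin> cball y r \<Longrightarrow> \<eta> x = 0" using smooth_alg_bump[OF r(1)] by metis
    have \<eta>c: "continuous_on UNIV \<eta>" by (rule smooth_alg_continuous[OF \<eta>(1)])
    have i: "integrable lborel (\<lambda>x. w x * \<eta> x)" if "continuous_on UNIV w" for w
      by (rule continuous_compact_support_integrable[of _ "cball y r"])
        (use that \<eta>c \<eta>(4) in \<open>auto intro!: continuous_intros\<close>)
    have "(\<integral>x. ?q x * \<eta> x \<partial>lborel) > 0"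
    proof (rule integral_continuous_pos[OF _ i[OF qc]])
      show "continuous_on UNIV (\<lambda>x. ?q x * \<eta> x)" by (intro continuous_on_mult qc \<eta>c)
      show "?q x * \<eta> x \<ge> 0" for x
      proof (cases "x \<in> cball y r")
        case True
        then have "?q x \<ge> 0" using r(2) by fastforce
        then show ?thesis using \<eta>(2) by (rule mult_nonneg_nonneg)
      qed (use \<eta>(4) in simp)
      show "?q y * \<eta> y > 0" using qy \<eta>(3) by simp
    qed
    moreover have "(\<integral>x. ?q x * \<eta> x \<partial>lborel) = c * (norm \<xi>)\<^sup>2 * (\<integral>x. \<eta> x \<partial>lborel) -
      (\<integral>x. ((\<phi> (x + \<xi>))\<^sup>2 + (\<phi> (x - \<xi>))\<^sup>2 - 2 * (\<phi> x)\<^sup>2) * \<eta> x \<partial>lborel)"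
    proof -
      have "integrable lborel (\<lambda>x. c * (norm \<xi>)\<^sup>2 * \<eta> x)" by (intro i continuous_intros)
      moreover have "integrable lborel (\<lambda>x. ((\<phi> (x + \<xi>))\<^sup>2 + (\<phi> (x - \<xi>))\<^sup>2 - 2 * (\<phi> x)\<^sup>2) * \<eta> x)"
        by (intro i continuous_intros continuous_on_compose2[OF \<phi>]) auto
      ultimately show ?thesis
        by (subst left_diff_distrib) (subst Bochner_Integration.integral_diff, auto)
    qed
    ultimately show False using main[OF \<eta>(1,2,4), where \<xi> = \<xi>] by simp
  qed
qed

section \<open>The polar of an elliptic anisotropy\<close>

text \<open>From here on, ellipticity is used only through the second-difference inequality
  \<open>strong\<close>.\<close>

locale elliptic_norm =
  fixes \<phi> :: "plane \<Rightarrow> real" and c0 c1 :: real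
  assumes even: "\<phi> (- x) = \<phi> x"
    and cvx: "convex_on UNIV \<phi>"
    and homog: "s \<ge> 0 \<Longrightarrow> \<phi> (s *\<^sub>R x) = s * \<phi> x"
    and c0: "c0 > 0" and lower: "c0 * norm x \<le> \<phi> x" and upper: "\<phi> x \<le> norm x / c0"
    and c1: "c1 > 0"
    and strong: "c1 * (norm \<xi>)\<^sup>2 \<le> (\<phi> (y + \<xi>))\<^sup>2 + (\<phi> (y - \<xi>))\<^sup>2 - 2 * (\<phi> y)\<^sup>2"
begin

lemma continuous: "continuous_on UNIV \<phi>"
  using cvx by (intro convex_on_continuous) auto

lemma nonneg [simp]: "\<phi> x \<ge> 0"
  using lower[of x] c0 by (smt (verit) mult_nonneg_nonneg norm_ge_zero)

lemma zero [simp]: "\<phi> 0 = 0"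
  using homog[of 0 0] by simp

lemma zero_iff: "\<phi> x = 0 \<longleftrightarrow> x = 0"
  using lower[of x] c0 by (auto simp: mult_le_0_iff)

lemma pos: "x \<noteq> 0 \<Longrightarrow> \<phi> x > 0"
  using nonneg[of x] zero_iff[of x] by linarith

lemma scale: "\<phi> (s *\<^sub>R x) = \<bar>s\<bar> * \<phi> x"
  using homog[of "\<bar>s\<bar>" x] even[of "s *\<^sub>R x"] by (cases "s \<ge> 0") auto

lemma minus_commute: "\<phi> (x - y) = \<phi> (y - x)"
  using even[of "x - y"] by simp

lemma triangle: "\<phi> (x + y) \<le> \<phi> x + \<phi> y"
proof -
  have "\<phi> ((1/2) *\<^sub>R (2 *\<^sub>R x) + (1/2) *\<^sub>R (2 *\<^sub>R y)) \<le> 1/2 * \<phi> (2 *\<^sub>R x) + 1/2 * \<phi> (2 *\<^sub>R y)"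
    using convex_onD[OF cvx, of "1/2" "2 *\<^sub>R x" "2 *\<^sub>R y"] by simp
  then show ?thesis by (simp add: homog)
qed

lemma triangle_diff: "\<phi> (x - z) \<le> \<phi> (x - y) + \<phi> (y - z)"
  using triangle[of "x - y" "y - z"] by simp

lemma norm_le: "norm x \<le> \<phi> x / c0"
  using lower[of x] c0 by (simp add: field_simps)

lemma norm_le_inv: "\<phi> x \<le> 1 \<Longrightarrow> norm x \<le> 1 / c0"
  using norm_le[of x] c0 by (meson divide_right_mono less_imp_le order_trans)

text \<open>Uniform convexity of the Wulff shape. Applying \<open>strong\<close> at the midpoint
  with half the difference costs a factor 4, dividing by 2 another one, and passing from \<phi>^2 to
  \<phi> by 2u \<le> 1 + u^2 the last factor 2: together 16.\<close>

lemma midpoint_le: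
  assumes "\<phi> x \<le> 1" "\<phi> y \<le> 1"
  shows "\<phi> ((1/2) *\<^sub>R (x + y)) \<le> 1 - c1 / 16 * (norm (x - y))\<^sup>2"
proof -
  let ?m = "(1/2) *\<^sub>R (x + y)" and ?\<xi> = "(1/2) *\<^sub>R (x - y)"
  have "?m + ?\<xi> = x" "?m - ?\<xi> = y" by (auto simp: algebra_simps simp flip: scaleR_add_left)
  with strong[of ?\<xi> ?m] have "c1 * (norm ?\<xi>)\<^sup>2 \<le> (\<phi> x)\<^sup>2 + (\<phi> y)\<^sup>2 - 2 * (\<phi> ?m)\<^sup>2" by metis
  moreover have "(\<phi> x)\<^sup>2 \<le> 1" "(\<phi> y)\<^sup>2 \<le> 1" using assms by (auto intro!: power_le_one)
  moreover have "(norm ?\<xi>)\<^sup>2 = (norm (x - y))\<^sup>2 / 4" by (simp add: power_divide)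
  ultimately have "2 * (\<phi> ?m)\<^sup>2 \<le> 2 - c1 * (norm (x - y))\<^sup>2 / 4" by (simp only: times_divide_eq_right)
  moreover have "2 * \<phi> ?m \<le> 1 + (\<phi> ?m)\<^sup>2" using zero_le_power2[of "\<phi> ?m - 1"] by (simp add: power2_eq_square algebra_simps)
  ultimately show ?thesis by simp
qed

lemma wulff_compact: "compact (wulff \<phi>)"
proof -
  have "wulff \<phi> = \<phi> -` {..1}" by (auto simp: wulff_def)
  then have "closed (wulff \<phi>)" using continuous by (auto intro: closed_vimage)
  moreover have "bounded (wulff \<phi>)"
    unfolding bounded_iff wulff_def using norm_le_inv by auto
  ultimately show ?thesis by (simp add: compact_eq_bounded_closed)
qed

lemma wulff_nonempty: "wulff \<phi> \<noteq> {}"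
proof -
  have "0 \<in> wulff \<phi>" by (simp add: wulff_def)
  then show ?thesis by blast
qed

lemma polar_attained:
  obtains x where "\<phi> x \<le> 1" "p \<bullet> x = polar \<phi> p" "\<And>y. \<phi> y \<le> 1 \<Longrightarrow> p \<bullet> y \<le> polar \<phi> p"
proof -
  have "continuous_on (wulff \<phi>) (\<lambda>x. p \<bullet> x)" by (intro continuous_intros)
  from continuous_attains_sup[OF wulff_compact wulff_nonempty this]
  obtain x where x: "x \<in> wulff \<phi>" "\<And>y. y \<in> wulff \<phi> \<Longrightarrow> p \<bullet> y \<le> p \<bullet> x" by blast
  then have "polar \<phi> p = p \<bullet> x" unfolding polar_def by (intro cSup_eq_maximum) auto
  with x that show ?thesis by (auto simp: wulff_def)
qed

text \<open>\<open>dual p\<close> is \<open>\<nabla>\<phi>\<degree>(p)\<close> for \<open>p \<noteq> 0\<close>: the point of the Wulff shape with outer normal \<open>p\<close>.\<close>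

definition dual :: "plane \<Rightarrow> plane" where
  "dual p = (SOME x. \<phi> x \<le> 1 \<and> p \<bullet> x = polar \<phi> p)"

lemma dual: "\<phi> (dual p) \<le> 1" "p \<bullet> dual p = polar \<phi> p"
  using polar_attained[of p] someI_ex[of "\<lambda>x. \<phi> x \<le> 1 \<and> p \<bullet> x = polar \<phi> p"] unfolding dual_def by metis+

lemma polar_ge: "\<phi> y \<le> 1 \<Longrightarrow> p \<bullet> y \<le> polar \<phi> p"
  using polar_attained[of p] by metis

lemma inner_le_polar: "p \<bullet> x \<le> polar \<phi> p * \<phi> x"
proof (cases "x = 0")
  case False
  then have "\<phi> ((1 / \<phi> x) *\<^sub>R x) \<le> 1" using pos by (simp add: scale)
  from polar_ge[OF this, of p] show ?thesis using pos[OF False] by (simp add: field_simps)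
qed simp

lemma polar_nonneg: "polar \<phi> p \<ge> 0"
  using polar_ge[of 0 p] zero_iff[of 0] by (metis inner_zero_right zero_le_one)

lemma polar_ge_norm: "c0 * norm p \<le> polar \<phi> p"
proof (cases "p = 0")
  case False
  have "norm p * norm p = p \<bullet> p" by (simp add: dot_square_norm power2_eq_square)
  also have "\<dots> \<le> polar \<phi> p * \<phi> p" by (rule inner_le_polar)
  also have "\<dots> \<le> polar \<phi> p * (norm p / c0)" by (intro mult_left_mono upper polar_nonneg)
  finally have "c0 * norm p * norm p \<le> polar \<phi> p * norm p" using c0 by (simp add: field_simps)
  then show ?thesis using False by simp
qed (simp add: polar_nonneg)

lemma polar_le_norm: "polar \<phi> p \<le> norm p / c0"
proof -
  have "p \<bullet> dual p \<le> norm p * norm (dual p)" by (rule norm_cauchy_schwarz)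
  also have "\<dots> \<le> norm p * (1 / c0)"
    by (intro mult_left_mono norm_le_inv dual) simp
  finally show ?thesis using dual(2) by simp
qed

lemma polar_pos: "p \<noteq> 0 \<Longrightarrow> polar \<phi> p > 0"
  using polar_ge_norm[of p] c0 by (smt (verit) mult_pos_pos zero_less_norm_iff)

text \<open>A quantitative form of uniqueness of the maximiser: the midpoint of
  \<open>dual p\<close> and \<open>y\<close> lies well inside the Wulff shape, so \<open>p\<close>
  takes there a value clearly below its maximum.\<close>

lemma polar_gap:
  assumes "\<phi> y \<le> 1"
  shows "polar \<phi> p * (c1 / 8) * (norm (dual p - y))\<^sup>2 \<le> p \<bullet> (dual p - y)"
proof -
  have "(p \<bullet> dual p + p \<bullet> y) / 2 = p \<bullet> ((1/2) *\<^sub>R (dual p + y))" by (simp add: inner_add_right)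
  also have "\<dots> \<le> polar \<phi> p * (1 - c1 / 16 * (norm (dual p - y))\<^sup>2)"
    by (rule order_trans[OF inner_le_polar mult_left_mono[OF midpoint_le[OF dual(1) assms] polar_nonneg]])
  finally have "(polar \<phi> p + p \<bullet> y) / 2 \<le> polar \<phi> p * (1 - c1 / 16 * (norm (dual p - y))\<^sup>2)"
    by (simp add: dual)
  then show ?thesis by (simp add: inner_diff_right dual field_simps)
qed

text \<open>The sum of the gaps of \<open>p\<close> at \<open>dual q\<close> and of \<open>q\<close>
  at \<open>dual p\<close>. Monotonicity of \<open>dual\<close> and its Lipschitz continuity away
  from 0 both come from this inequality.\<close>

lemma dual_monotone_strong:
  "(polar \<phi> p + polar \<phi> q) * (c1 / 8) * (norm (dual p - dual q))\<^sup>2 \<le> (p - q) \<bullet> (dual p - dual q)"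
  using polar_gap[of "dual q" p] polar_gap[of "dual p" q] dual(1)
  by (simp add: inner_diff_left inner_diff_right norm_minus_commute[of "dual q" "dual p"] field_simps)

lemma dual_monotone: "(p - q) \<bullet> (dual p - dual q) \<ge> 0"
proof -
  have "(polar \<phi> p + polar \<phi> q) * (c1 / 8) * (norm (dual p - dual q))\<^sup>2 \<ge> 0"
    using c1 polar_nonneg by (intro mult_nonneg_nonneg add_nonneg_nonneg) auto
  then show ?thesis using dual_monotone_strong order_trans by blast
qed

text \<open>Strong monotonicity, the Cauchy-Schwarz inequality and division by one factor of the
  norm. The bound \<open>m\<close> keeps \<open>p\<close> away from 0: \<open>dual\<close> is
  constant along rays, so its Lipschitz constant must blow up there.\<close>

lemma dual_lipschitz:
  assumes "m > 0" "polar \<phi> p \<ge> m"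
  shows "norm (dual p - dual q) \<le> 8 / (c1 * m) * norm (p - q)"
proof (cases "dual p = dual q")
  case False
  let ?n = "norm (dual p - dual q)"
  have "m * (c1 / 8) * ?n\<^sup>2 \<le> (polar \<phi> p + polar \<phi> q) * (c1 / 8) * ?n\<^sup>2"
    using assms c1 polar_nonneg[of q] by (intro mult_right_mono) auto
  also have "\<dots> \<le> norm (p - q) * ?n"
    using dual_monotone_strong[of p q] norm_cauchy_schwarz[of "p - q"] order_trans by blast
  finally have "m * (c1 / 8) * ?n * ?n \<le> norm (p - q) * ?n" by (simp add: power2_eq_square mult.assoc)
  then have "m * (c1 / 8) * ?n \<le> norm (p - q)" using False by simp
  then show ?thesis using assms c1 by (simp add: field_simps)
qed (use assms c1 in simp)

lemma dual_unique:
  assumes "p \<noteq> 0" "\<phi> x \<le> 1" "p \<bullet> x = polar \<phi> p"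
  shows "x = dual p"
proof (rule ccontr)
  assume "x \<noteq> dual p"
  then have "polar \<phi> p * (c1 / 8) * (norm (dual p - x))\<^sup>2 > 0"
    using polar_pos[OF assms(1)] c1 by simp
  moreover have "p \<bullet> (dual p - x) = 0" using assms(3) dual by (simp add: inner_diff_right)
  ultimately show False using polar_gap[OF assms(2), of p] by simp
qed

lemma polar_scale: "s \<ge> 0 \<Longrightarrow> polar \<phi> (s *\<^sub>R p) = s * polar \<phi> p"
proof (rule antisym)
  assume s: "s \<ge> 0"
  show "polar \<phi> (s *\<^sub>R p) \<le> s * polar \<phi> p"
    using dual(2)[of "s *\<^sub>R p"] mult_left_mono[OF polar_ge[OF dual(1)[of "s *\<^sub>R p"], of p] s] by simp
  show "s * polar \<phi> p \<le> polar \<phi> (s *\<^sub>R p)"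
    using polar_ge[OF dual(1)[of p], of "s *\<^sub>R p"] dual(2)[of p] by simp
qed

lemma dual_scale:
  assumes "s > 0" "p \<noteq> 0" shows "dual (s *\<^sub>R p) = dual p"
proof (rule dual_unique[OF assms(2) dual(1)])
  show "p \<bullet> dual (s *\<^sub>R p) = polar \<phi> p"
    using dual(2)[of "s *\<^sub>R p"] assms by (simp add: polar_scale)
qed

lemma polar_lipschitz: "\<bar>polar \<phi> p - polar \<phi> q\<bar> \<le> norm (p - q) / c0"
proof -
  have "polar \<phi> p - polar \<phi> q \<le> norm (p - q) / c0" for p q
  proof -
    have "polar \<phi> p - polar \<phi> q \<le> (p - q) \<bullet> dual p"
      using polar_ge[OF dual(1)[of p], of q] by (simp add: inner_diff_left dual)
    also have "\<dots> \<le> polar \<phi> (p - q)" by (rule polar_ge[OF dual(1)])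
    also have "\<dots> \<le> norm (p - q) / c0" by (rule polar_le_norm)
    finally show ?thesis .
  qed
  from this[of p q] this[of q p] show ?thesis by (simp add: norm_minus_commute abs_le_iff)
qed

text \<open>Both \<open>dual p\<close> and \<open>dual q\<close> are subgradients, which traps the
  linearisation error between 0 and \<open>(q - p) \<bullet> (dual q - dual p)\<close>; by the
  Lipschitz bound on \<open>dual\<close> this is quadratic in \<open>q - p\<close>.\<close>

lemma GDERIV_polar:
  assumes "p \<noteq> 0" shows "GDERIV (polar \<phi>) p :> dual p"
proof -
  let ?m = "polar \<phi> p"
  let ?C = "8 / (c1 * ?m)"
  have m: "?m > 0" by (rule polar_pos[OF assms])
  have est: "norm (polar \<phi> q - ?m - (q - p) \<bullet> dual p) \<le> ?C * norm (q - p) * norm (q - p)" for q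
  proof -
    have "polar \<phi> q - ?m - (q - p) \<bullet> dual p \<ge> 0"
      using polar_ge[OF dual(1)[of p], of q] by (simp add: inner_diff_left dual)
    moreover have "polar \<phi> q - ?m - (q - p) \<bullet> dual p \<le> (q - p) \<bullet> (dual q - dual p)"
      using polar_ge[OF dual(1)[of q], of p] by (simp add: inner_diff_left inner_diff_right dual)
    moreover have "(q - p) \<bullet> (dual q - dual p) \<le> norm (q - p) * norm (dual q - dual p)"
      by (rule norm_cauchy_schwarz)
    moreover have "norm (dual q - dual p) \<le> ?C * norm (q - p)"
      using dual_lipschitz[OF m order_refl, of q] by (simp add: norm_minus_commute)
    ultimately show ?thesis
      by (smt (verit) mult.commute mult_left_mono norm_ge_zero real_norm_def)
  qed
  have "((\<lambda>q. polar \<phi> q) has_derivative (\<lambda>h. h \<bullet> dual p)) (at p)"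
  proof (rule has_derivativeI_sandwich[where e=1 and H="\<lambda>y. ?C * norm (y - p)"])
    show "bounded_linear (\<lambda>h. h \<bullet> dual p)" by (rule bounded_linear_inner_left)
    show "norm (polar \<phi> y - polar \<phi> p - (y - p) \<bullet> dual p) / norm (y - p) \<le> ?C * norm (y - p)"
      if "y \<noteq> p" for y using est[of y] that by (simp add: divide_le_eq)
    have "((\<lambda>y. ?C * norm (y - p)) \<longlongrightarrow> ?C * norm (p - p)) (at p)" by (intro tendsto_intros)
    then show "((\<lambda>y. ?C * norm (y - p)) \<longlongrightarrow> 0) (at p)" by simp
  qed simp
  then show ?thesis unfolding gderiv_def .
qed

lemma grad_polar: "p \<noteq> 0 \<Longrightarrow> grad (polar \<phi>) p = dual p"
  unfolding grad_def
proof (rule the_equality, erule GDERIV_polar)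
  fix g assume "p \<noteq> 0" "GDERIV (polar \<phi>) p :> g"
  then have "(\<lambda>h. h \<bullet> g) = (\<lambda>h. h \<bullet> dual p)"
    using GDERIV_polar[of p] unfolding gderiv_def by (intro has_derivative_unique) auto
  then show "g = dual p" by (metis inner_commute vector_eq_ldot)
qed

end

lemma elliptic_normI:
  assumes "elliptic_anisotropy \<phi>"
  obtains c0 c1 where "elliptic_norm \<phi> c0 c1"
proof -
  obtain c1 where c1: "c1 > 0"
    "\<And>y \<xi>. c1 * (norm \<xi>)\<^sup>2 \<le> (\<phi> (y + \<xi>))\<^sup>2 + (\<phi> (y - \<xi>))\<^sup>2 - 2 * (\<phi> y)\<^sup>2"
    using elliptic_strongly_convex[OF assms] by metis
  have an: "anisotropy \<phi>" using assms by (simp add: elliptic_anisotropy_def)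
  then obtain c0 where "c0 > 0" "\<And>x. c0 * norm x \<le> \<phi> x \<and> \<phi> x \<le> norm x / c0"
    unfolding anisotropy_def by blast
  with c1 an that[of c0 c1] show ?thesis
    unfolding anisotropy_def elliptic_norm_def by auto
qed

section \<open>Signed distance functions\<close>

lemma differentiable_GDERIV:
  fixes f :: "plane \<Rightarrow> real"
  assumes "f differentiable (at x)" shows "GDERIV f x :> grad f x"
proof -
  obtain F where F: "(f has_derivative F) (at x)" using assms by (auto simp: differentiable_def)
  then have lin: "linear F" using has_derivative_linear by blast
  have "F = (\<lambda>h. h \<bullet> adjoint F 1)"
    using adjoint_works[OF lin, of _ 1] by (auto simp: fun_eq_iff)
  with F have ex: "GDERIV f x :> adjoint F 1" unfolding gderiv_def by simp
  show ?thesis unfolding grad_def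
  proof (rule theI[of "\<lambda>g. GDERIV f x :> g", OF ex])
    fix g assume "GDERIV f x :> g"
    with ex have "(\<lambda>h. h \<bullet> g) = (\<lambda>h. h \<bullet> adjoint F 1)"
      unfolding gderiv_def by (intro has_derivative_unique)
    then show "g = adjoint F 1" by (metis inner_commute vector_eq_ldot)
  qed
qed

lemma GDERIV_line:
  fixes f :: "plane \<Rightarrow> real"
  assumes "GDERIV f x :> g"
  shows "((\<lambda>s. (f (x + s *\<^sub>R w) - f x) / s) \<longlongrightarrow> g \<bullet> w) (at 0)"
proof -
  have "((\<lambda>s. x + s *\<^sub>R w) has_derivative (\<lambda>s. s *\<^sub>R w)) (at (0::real))"
    by (auto intro!: derivative_eq_intros)
  moreover have "(f has_derivative (\<lambda>h. h \<bullet> g)) (at (x + 0 *\<^sub>R w))" using assms by (simp add: gderiv_def)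
  ultimately have "((\<lambda>s. f (x + s *\<^sub>R w)) has_derivative (\<lambda>s. (s *\<^sub>R w) \<bullet> g)) (at 0)"
    by (rule has_derivative_compose)
  then have "((\<lambda>s. f (x + s *\<^sub>R w)) has_real_derivative g \<bullet> w) (at 0)"
    by (simp add: has_field_derivative_def inner_commute mult.commute[of _ "g \<bullet> w"])
  then show ?thesis by (simp add: DERIV_def)
qed

lemma GDERIV_line_le:
  fixes f :: "plane \<Rightarrow> real"
  assumes "GDERIV f x :> g" "\<And>s. 0 < s \<Longrightarrow> s \<le> 1 \<Longrightarrow> f (x + s *\<^sub>R w) - f x \<le> s * c"
  shows "g \<bullet> w \<le> c"
proof (rule tendsto_upperbound)
  show "((\<lambda>s. (f (x + s *\<^sub>R w) - f x) / s) \<longlongrightarrow> g \<bullet> w) (at_right 0)"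
    by (rule tendsto_mono[OF _ GDERIV_line[OF assms(1)]]) (simp add: at_within_le_at)
  have "\<forall>\<^sub>F s in at_right 0. s \<in> {0<..<1::real}" by (rule eventually_at_right_real) simp
  then show "\<forall>\<^sub>F s in at_right 0. (f (x + s *\<^sub>R w) - f x) / s \<le> c"
    by eventually_elim (use assms(2) in \<open>auto simp: field_simps\<close>)
qed simp

lemma GDERIV_line_eq:
  fixes f :: "plane \<Rightarrow> real"
  assumes "GDERIV f x :> g" "\<And>s. 0 < s \<Longrightarrow> s \<le> 1 \<Longrightarrow> f (x + s *\<^sub>R w) - f x = s * c"
  shows "g \<bullet> w = c"
proof (rule antisym)
  show "g \<bullet> w \<le> c" by (rule GDERIV_line_le[OF assms(1)]) (use assms(2) in simp)
  have "(- g) \<bullet> w \<le> - c"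
    by (rule GDERIV_line_le[OF GDERIV_minus[OF assms(1)]]) (use assms(2) in \<open>simp add: field_simps\<close>)
  then show "c \<le> g \<bullet> w" by simp
qed

context elliptic_norm
begin

definition dst :: "plane set \<Rightarrow> plane \<Rightarrow> real" where "dst S x = (INF y\<in>S. \<phi> (x - y))"

lemma bdd_below_dst: "bdd_below ((\<lambda>y. \<phi> (x - y)) ` S)"
  by (rule bdd_belowI2[of _ 0]) simp

lemma INF_ereal_dst: "S \<noteq> {} \<Longrightarrow> (INF y\<in>S. ereal (\<phi> (x - y))) = ereal (dst S x)"
  unfolding dst_def using ereal_Inf'[OF bdd_below_dst[of x S]] by (simp add: image_image)

lemma dst_nonneg: "S \<noteq> {} \<Longrightarrow> dst S x \<ge> 0"
  unfolding dst_def by (rule cINF_greatest) auto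

lemma dst_lip: assumes "S \<noteq> {}" shows "dst S x \<le> dst S y + \<phi> (x - y)"
proof -
  have "dst S x - \<phi> (x - y) \<le> dst S y"
    unfolding dst_def[of S y]
  proof (rule cINF_greatest[OF assms])
    fix z assume "z \<in> S"
    then have "dst S x \<le> \<phi> (x - z)" unfolding dst_def by (intro cINF_lower bdd_below_dst)
    also have "\<dots> \<le> \<phi> (x - y) + \<phi> (y - z)" by (rule triangle_diff)
    finally show "dst S x - \<phi> (x - y) \<le> \<phi> (y - z)" by simp
  qed
  then show ?thesis by simp
qed

lemma dst_le_closure: assumes "z \<in> closure S" shows "dst S x \<le> \<phi> (x - z)"
proof -
  obtain z' where z': "\<And>n. z' n \<in> S" "z' \<longlonglongrightarrow> z" using assms by (auto simp: closure_sequential)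
  have "isCont \<phi> (x - z)" using continuous by (simp add: continuous_on_eq_continuous_at)
  then have "(\<lambda>n. \<phi> (x - z' n)) \<longlonglongrightarrow> \<phi> (x - z)"
    by (rule isCont_tendsto_compose) (intro tendsto_intros z')
  then show ?thesis
    by (rule LIMSEQ_le_const) (use z' in \<open>auto simp: dst_def intro!: cINF_lower bdd_below_dst\<close>)
qed

text \<open>Coercivity reduces the infimum to a compact set. The minimiser is also a limit of points
  outside \<open>S\<close>, because points of the open segment towards \<open>x\<close> are strictly
  closer to \<open>x\<close> than \<open>S\<close> is. Since \<open>S\<close> need not be closed,
  this serves both a closed set and its complement.\<close>

lemma nearest_point:
  assumes "S \<noteq> {}" "x \<notin> S"
  obtains z where "z \<in> closure S" "z \<in> closure (- S)" "\<phi> (x - z) = dst S x"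
proof -
  obtain y0 where y0: "y0 \<in> S" using assms by blast
  define K where "K = closure S \<inter> cball x (\<phi> (x - y0) / c0)"
  have K: "compact K" unfolding K_def by (intro closed_Int_compact) auto
  have "y0 \<in> K" using y0 norm_le[of "x - y0"] closure_subset by (auto simp: K_def dist_norm)
  moreover have "continuous_on K (\<lambda>z. \<phi> (x - z))"
    by (rule continuous_on_compose2[OF continuous]) (auto intro!: continuous_intros)
  ultimately obtain z where z: "z \<in> K" "\<And>y. y \<in> K \<Longrightarrow> \<phi> (x - z) \<le> \<phi> (x - y)"
    using continuous_attains_inf[OF K, of "\<lambda>z. \<phi> (x - z)"] by blast
  have min: "\<phi> (x - z) \<le> \<phi> (x - y)" if "y \<in> S" for y
  proof (cases "y \<in> K")
    case False
    then have "norm (x - y) > \<phi> (x - y0) / c0" using that closure_subset by (auto simp: K_def dist_norm)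
    then have "\<phi> (x - y0) < \<phi> (x - y)" using lower[of "x - y"] c0 by (simp add: field_simps)
    then show ?thesis using z(2)[OF \<open>y0 \<in> K\<close>] by simp
  qed (rule z)
  have eq: "\<phi> (x - z) = dst S x"
    using z(1) min by (intro antisym dst_le_closure) (auto simp: dst_def K_def assms intro!: cINF_greatest)
  have "z \<in> closure (- S)"
  proof (cases "x = z")
    case True then show ?thesis using assms(2) by (auto intro: subsetD[OF closure_subset])
  next
    case False
    have "(\<lambda>n. z + (1 / real (Suc n)) *\<^sub>R (x - z)) \<longlonglongrightarrow> z + 0 *\<^sub>R (x - z)"
      by (intro tendsto_intros LIMSEQ_Suc[OF lim_1_over_n])
    moreover have "z + (1 / real (Suc n)) *\<^sub>R (x - z) \<in> - S" for n
    proof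
      let ?s = "1 / real (Suc n)"
      assume "z + ?s *\<^sub>R (x - z) \<in> S"
      from min[OF this] have "\<phi> (x - z) \<le> \<phi> ((1 - ?s) *\<^sub>R (x - z))" by (simp add: algebra_simps)
      also have "\<dots> = (1 - ?s) * \<phi> (x - z)" by (simp add: scale)
      also have "\<dots> < \<phi> (x - z)" using pos[of "x - z"] False by simp
      finally show False by simp
    qed
    ultimately show ?thesis unfolding closure_sequential
      by (intro exI[of _ "\<lambda>n. z + (1 / real (Suc n)) *\<^sub>R (x - z)"]) simp
  qed
  with z eq that show ?thesis by (auto simp: K_def)
qed

text \<open>
  The properties of the signed distance to a closed set that the proof uses. They are invariant
  under \<open>f \<mapsto> - f\<close>.
\<close>

definition sd :: "(plane \<Rightarrow> real) \<Rightarrow> bool" where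
  "sd f \<longleftrightarrow> (\<forall>x y. f x - f y \<le> \<phi> (x - y)) \<and> (\<forall>x. \<exists>z. f z = 0 \<and> \<phi> (x - z) = \<bar>f x\<bar>) \<and>
     (\<forall>x e. e > 0 \<longrightarrow> (\<exists>y\<in>ball x e. f y \<noteq> 0))"

lemma sd_lip: "sd f \<Longrightarrow> f x - f y \<le> \<phi> (x - y)"
  by (simp add: sd_def)

lemma sd_lip_abs: "sd f \<Longrightarrow> \<bar>f x - f y\<bar> \<le> \<phi> (x - y)"
  using sd_lip[of f x y] sd_lip[of f y x] minus_commute[of x y] by (simp add: abs_le_iff)

lemma sd_nearest: "sd f \<Longrightarrow> \<exists>z. f z = 0 \<and> \<phi> (x - z) = \<bar>f x\<bar>"
  by (simp add: sd_def)

lemma sd_minus: "sd f \<Longrightarrow> sd (\<lambda>x. - f x)"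
  using minus_commute unfolding sd_def by (auto; metis)

lemma sd_continuous: assumes "sd f" shows "continuous_on S f"
proof (rule continuous_on_subset[OF _ subset_UNIV], rule lipschitz_on_continuous_on[of "1 / c0"], rule lipschitz_onI)
  show "dist (f x) (f y) \<le> 1 / c0 * dist x y" for x y
    using sd_lip_abs[OF assms, of x y] upper[of "x - y"] by (simp add: dist_norm)
qed (use c0 in simp)

lemma sdist_finite_imp:
  assumes "\<bar>sdist \<phi> E x\<bar> \<noteq> \<infinity>" shows "E \<noteq> {}" "E \<noteq> UNIV"
proof -
  have "(INF y\<in>UNIV. ereal (\<phi> (x - y))) = 0" if "E = UNIV"
  proof -
    have "dst UNIV x = 0" using dst_le_closure[of x UNIV x] dst_nonneg[of UNIV x] by simp
    then show ?thesis using INF_ereal_dst[of UNIV x] by simp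
  qed
  moreover have "(INF y\<in>UNIV. ereal (\<phi> (y - x))) = (INF y\<in>UNIV. ereal (\<phi> (x - y)))"
    by (simp add: minus_commute)
  ultimately show "E \<noteq> {}" "E \<noteq> UNIV" using assms
    by (auto simp: sdist_def top_ereal_def)
qed

lemma
  assumes "closed E" "E \<noteq> {}" "E \<noteq> UNIV"
  defines "f \<equiv> \<lambda>x. real_of_ereal (sdist \<phi> E x)"
  shows sdist_sd: "sd f" and sdist_le_0: "f x \<le> 0 \<longleftrightarrow> x \<in> E" and sdist_eq_0: "f x = 0 \<longleftrightarrow> x \<in> frontier E"
    and sdist_ereal: "sdist \<phi> E x = ereal (f x)" and sdist_compl: "sdist \<phi> (- E) x = ereal (- f x)"
proof -
  have ne: "E \<noteq> {}" "- E \<noteq> {}" using assms by auto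
  have swap: "(INF y\<in>S. ereal (\<phi> (y - x))) = (INF y\<in>S. ereal (\<phi> (x - y)))" for S x
    by (simp add: minus_commute)
  have s: "sdist \<phi> E x = ereal (dst E x - dst (- E) x)" "sdist \<phi> (- E) x = ereal (dst (- E) x - dst E x)" for x
    unfolding sdist_def by (simp_all add: INF_ereal_dst[OF ne(1)] INF_ereal_dst[OF ne(2)] swap)
  then have f: "f x = dst E x - dst (- E) x" for x by (simp add: f_def)
  show "sdist \<phi> E x = ereal (f x)" "sdist \<phi> (- E) x = ereal (- f x)" using s f by auto
  have in0: "dst S x = 0" if "x \<in> closure S" for S x
    using dst_le_closure[OF that, of x] dst_nonneg[of S x] that by (cases "S = {}") auto
  have out: "x \<in> closure S" if d: "dst S x = 0" and S: "S \<noteq> {}" for S x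
  proof (rule ccontr)
    assume n: "x \<notin> closure S"
    then have "x \<notin> S" using closure_subset by blast
    then obtain z where "z \<in> closure S" "\<phi> (x - z) = 0" using nearest_point[OF S, of x] d by metis
    then show False using n zero_iff[of "x - z"] by simp
  qed
  have fE: "f x = - dst (- E) x" if "x \<in> E" for x
    using f[of x] in0[OF subsetD[OF closure_subset that]] by simp
  have fnE: "f x = dst E x" "f x > 0" if "x \<notin> E" for x
  proof -
    show "f x = dst E x" using f[of x] in0[OF subsetD[OF closure_subset[of "- E"]], of x] that by simp
    moreover have "dst E x \<noteq> 0" using out[of E x] ne that assms(1) by auto
    ultimately show "f x > 0" using dst_nonneg[OF ne(1), of x] by simp
  qed
  show le0: "f x \<le> 0 \<longleftrightarrow> x \<in> E" for x
    using fnE(2)[of x] fE[of x] dst_nonneg[OF ne(2), of x] by fastforce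
  have eq0: "f x = 0 \<longleftrightarrow> x \<in> frontier E" for x
  proof -
    have "frontier E = E \<inter> closure (- E)" using assms(1) by (simp add: frontier_closures)
    moreover have "f x = 0 \<longleftrightarrow> x \<in> E \<and> dst (- E) x = 0"
      using fnE(2)[of x] fE[of x] by fastforce
    ultimately show ?thesis using in0[of x "- E"] out[of "- E" x] ne by auto
  qed
  then show "f x = 0 \<longleftrightarrow> x \<in> frontier E" .
  \<comment> \<open>The Lipschitz constant stays 1 across the boundary: the segment from
    \<open>y\<close> to \<open>x\<close> meets the frontier, and the lengths of its two pieces add
    up exactly.\<close>
  have mixed: "dst E x + dst (- E) y \<le> \<phi> (x - y)" if "x \<notin> E" "y \<in> E" for x y
  proof -
    have "closed_segment y x \<inter> frontier E \<noteq> {}"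
      using that by (intro connected_Int_frontier) auto
    then obtain z where z: "z \<in> closed_segment y x" "z \<in> frontier E" by blast
    then obtain u where u: "0 \<le> u" "u \<le> 1" "z = (1 - u) *\<^sub>R y + u *\<^sub>R x" by (auto simp: in_segment)
    have e: "x - z = (1 - u) *\<^sub>R (x - y)" "y - z = u *\<^sub>R (y - x)"
      using u(3) by (auto simp: algebra_simps)
    have "\<phi> (x - z) = (1 - u) * \<phi> (x - y)" "\<phi> (y - z) = u * \<phi> (x - y)"
      unfolding e scale using u minus_commute[of y x] by simp_all
    then have "\<phi> (x - z) + \<phi> (y - z) = \<phi> (x - y)" by (simp add: algebra_simps)
    moreover have "dst E x \<le> \<phi> (x - z)" "dst (- E) y \<le> \<phi> (y - z)"
      using z(2) by (auto simp: frontier_closures intro: dst_le_closure)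
    ultimately show ?thesis by simp
  qed
  have "f x - f y \<le> \<phi> (x - y)" for x y
  proof (cases "x \<in> E"; cases "y \<in> E")
    assume "x \<in> E" "y \<in> E"
    then show ?thesis using fE dst_lip[OF ne(2), of y x] by (simp add: minus_commute)
  next
    assume "x \<in> E" "y \<notin> E"
    then have "f x \<le> 0" "f y > 0" using le0 fnE by auto
    then show ?thesis using nonneg[of "x - y"] by linarith
  next
    assume "x \<notin> E" "y \<in> E" then show ?thesis using fE fnE(1) mixed by simp
  next
    assume "x \<notin> E" "y \<notin> E" then show ?thesis using fnE(1) dst_lip[OF ne(1), of x y] by simp
  qed
  moreover have "\<exists>z. f z = 0 \<and> \<phi> (x - z) = \<bar>f x\<bar>" for x
  proof (cases "x \<in> E")
    case True
    then obtain z where "z \<in> closure (- E)" "z \<in> closure (- (- E))" "\<phi> (x - z) = dst (- E) x"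
      using nearest_point[OF ne(2), of x] by blast
    then show ?thesis using eq0 fE[OF True] dst_nonneg[OF ne(2), of x]
      by (intro exI[of _ z]) (auto simp: frontier_closures)
  next
    case False
    then obtain z where "z \<in> closure E" "z \<in> closure (- E)" "\<phi> (x - z) = dst E x"
      using nearest_point[OF ne(1), of x] by blast
    then show ?thesis using eq0 fnE(1)[OF False] dst_nonneg[OF ne(1), of x]
      by (intro exI[of _ z]) (auto simp: frontier_closures)
  qed
  \<comment> \<open>The zero set has empty interior: as \<open>E\<close> is closed, frontier points
    are limits of points outside \<open>E\<close>, where \<open>f\<close> is strictly
    positive.\<close>
  moreover have "\<exists>y\<in>ball x e. f y \<noteq> 0" if e: "e > 0" for x e
  proof (cases "f x = 0")
    case True
    then have "x \<in> closure (- E)" using eq0 by (simp add: frontier_closures)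
    then obtain y where "y \<in> - E" "dist y x < e" using e by (auto simp: closure_approachable)
    then show ?thesis using fnE(2)[of y] by (intro bexI[of _ y]) (auto simp: dist_commute)
  qed (use e in auto)
  ultimately show "sd f" unfolding sd_def by blast
qed

section \<open>The eikonal equation for signed distances\<close>

lemma sd_grad_inner_le: assumes "sd f" "GDERIV f x :> g" shows "g \<bullet> w \<le> \<phi> w"
  using assms(2)
proof (rule GDERIV_line_le)
  show "f (x + s *\<^sub>R w) - f x \<le> s * \<phi> w" if "0 < s" for s
    using sd_lip[OF assms(1), of "x + s *\<^sub>R w" x] that by (simp add: scale)
qed

lemma sd_grad_polar_le: assumes "sd f" "GDERIV f x :> g" shows "polar \<phi> g \<le> 1"
  using sd_grad_inner_le[OF assms, of "dual g"] dual[of g] by simp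

text \<open>The Lipschitz bounds from the two endpoints add up to exactly
  \<open>\<bar>f x\<bar>\<close>, so both are equalities along the segment.\<close>

lemma sd_line:
  assumes "sd f" "f y = 0" "\<phi> (x - y) \<le> \<bar>f x\<bar>" "0 \<le> s" "s \<le> 1"
  shows "f (y + s *\<^sub>R (x - y)) = s * f x"
proof -
  let ?z = "y + s *\<^sub>R (x - y)"
  have "?z - y = s *\<^sub>R (x - y)" "x - ?z = (1 - s) *\<^sub>R (x - y)" by (auto simp: algebra_simps)
  then have "\<bar>f ?z\<bar> \<le> s * \<phi> (x - y)" "\<bar>f x - f ?z\<bar> \<le> (1 - s) * \<phi> (x - y)"
    using sd_lip_abs[OF assms(1), of ?z y] sd_lip_abs[OF assms(1), of x ?z] assms by (auto simp: scale)
  moreover have "s * \<phi> (x - y) \<le> s * \<bar>f x\<bar>" "(1 - s) * \<phi> (x - y) \<le> (1 - s) * \<bar>f x\<bar>"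
    using assms by (auto intro!: mult_left_mono)
  ultimately have "\<bar>f ?z\<bar> \<le> s * \<bar>f x\<bar>" "\<bar>f x - f ?z\<bar> \<le> \<bar>f x\<bar> - s * \<bar>f x\<bar>" by (auto simp: left_diff_distrib)
  then show ?thesis by (cases "f x \<ge> 0") (auto simp: abs_le_iff)
qed

text \<open>Since \<open>f\<close> is linear on the segment to a nearest zero \<open>y\<close>, the
  gradient pairs with \<open>x - y\<close> to \<open>f x\<close>, whose absolute value is
  \<open>\<phi> (x - y)\<close>; duality of the norms then forces the polar norm up to 1.\<close>

lemma sd_grad_polar_ge:
  assumes "sd f" "GDERIV f x :> g" "f x \<noteq> 0" shows "polar \<phi> g \<ge> 1"
proof -
  obtain y where y: "f y = 0" "\<phi> (x - y) = \<bar>f x\<bar>" using sd_nearest[OF assms(1)] by blast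
  have "g \<bullet> (y - x) = - f x"
    using assms(2)
  proof (rule GDERIV_line_eq)
    fix s :: real assume s: "0 < s" "s \<le> 1"
    have "x + s *\<^sub>R (y - x) = y + (1 - s) *\<^sub>R (x - y)" by (simp add: algebra_simps)
    then show "f (x + s *\<^sub>R (y - x)) - f x = s * - f x"
      using sd_line[OF assms(1) y(1), of x "1 - s"] y s by (simp add: algebra_simps)
  qed
  then have e: "g \<bullet> (x - y) = f x" by (simp add: inner_diff_right)
  have "\<bar>f x\<bar> = \<bar>g \<bullet> (x - y)\<bar>" by (simp add: e)
  also have "\<dots> \<le> polar \<phi> g * \<phi> (x - y)"
    using inner_le_polar[of g "x - y"] inner_le_polar[of g "y - x"]
    by (simp add: abs_le_iff inner_diff_right minus_commute)
  finally have "\<bar>f x\<bar> * 1 \<le> \<bar>f x\<bar> * polar \<phi> g" using y by (simp add: mult.commute)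
  then show ?thesis using assms(3) by simp
qed

text \<open>The bound off the zero set extends to it by continuity of the gradient, as zeros have
  empty interior.\<close>

lemma sd_grad_polar_ge_open:
  assumes "sd f" "open U" "\<And>x. x \<in> U \<Longrightarrow> f differentiable (at x)" "continuous_on U (grad f)" "x \<in> U"
  shows "polar \<phi> (grad f x) \<ge> 1"
proof (rule ccontr)
  assume neg: "\<not> 1 \<le> polar \<phi> (grad f x)"
  have "continuous_on U (\<lambda>x. polar \<phi> (grad f x))"
  proof (rule continuous_on_compose2[OF _ assms(4)])
    show "continuous_on UNIV (polar \<phi>)"
      by (rule lipschitz_on_continuous_on[of "1 / c0"], rule lipschitz_onI)
        (use polar_lipschitz c0 in \<open>auto simp: dist_norm\<close>)
  qed simp
  from continuous_openin_preimage_gen[OF this, of "{..<1}"]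
  have "open (U \<inter> (\<lambda>x. polar \<phi> (grad f x)) -` {..<1})" using assms(2) by (simp add: openin_open_eq)
  moreover have "x \<in> U \<inter> (\<lambda>x. polar \<phi> (grad f x)) -` {..<1}" using assms(5) neg by simp
  ultimately obtain e where e: "e > 0" "ball x e \<subseteq> U \<inter> (\<lambda>x. polar \<phi> (grad f x)) -` {..<1}"
    by (meson openE)
  then obtain y where "y \<in> ball x e" "f y \<noteq> 0" using assms(1) unfolding sd_def by blast
  with e sd_grad_polar_ge[OF assms(1) differentiable_GDERIV[OF assms(3)]] show False by fastforce
qed

text \<open>
  A nearest boundary point \<open>y\<close> of \<open>x\<close> is touched by a Wulff shape of radius \<open>R\<close> from outside. By
  strict convexity the distance has only one direction of maximal increase at \<open>y\<close>, so \<open>x\<close>, \<open>y\<close>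
  and the centre of that Wulff shape are aligned.
\<close>

lemma sd_outer_ball:
  assumes f: "sd f" and R: "R > 0"
    and diff: "\<And>y. f y = 0 \<Longrightarrow> f differentiable (at y)"
    and ball: "\<And>y. f y = 0 \<Longrightarrow> \<exists>z. f z \<ge> R \<and> \<phi> (z - y) \<le> R"
    and x: "f x \<le> R"
  shows "\<exists>z. f z \<ge> R \<and> \<phi> (z - x) \<le> R - f x"
proof -
  obtain y where y: "f y = 0" "\<phi> (x - y) = \<bar>f x\<bar>" using sd_nearest[OF f] by blast
  obtain z where z: "f z \<ge> R" "\<phi> (z - y) \<le> R" using ball[OF y(1)] by blast
  have fz: "f z = R" "\<phi> (z - y) = R" using sd_lip[OF f, of z y] y z by auto
  obtain g where g: "GDERIV f y :> g" using differentiable_GDERIV[OF diff[OF y(1)]] by blast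
  have gz: "g \<bullet> (z - y) = R"
    using g by (rule GDERIV_line_eq) (use sd_line[OF f y(1), of z] fz y R in simp)
  have gx: "g \<bullet> (x - y) = f x"
    using g by (rule GDERIV_line_eq) (use sd_line[OF f y(1), of x] y in simp)
  let ?u = "(1 / R) *\<^sub>R (z - y)"
  have u: "\<phi> ?u = 1" "g \<bullet> ?u = 1" using R fz gz by (auto simp: scale)
  have g0: "g \<noteq> 0" using u by auto
  have pg: "polar \<phi> g = 1" using polar_ge[of ?u g] u sd_grad_polar_le[OF f g] by simp
  have ud: "?u = dual g" by (rule dual_unique[OF g0]) (use u pg in auto)
  have "x - y = f x *\<^sub>R dual g"
  proof (cases "f x = 0")
    case True then show ?thesis using y zero_iff[of "x - y"] by simp
  next
    case False
    have e: "(1 / f x) *\<^sub>R (x - y) = dual g"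
      by (rule dual_unique[OF g0]) (use False y gx pg in \<open>auto simp: scale\<close>)
    then show ?thesis using False by (simp flip: e)
  qed
  moreover have "z - y = R *\<^sub>R dual g" using R by (simp flip: ud)
  ultimately have "z - x = (R - f x) *\<^sub>R dual g" by (simp add: algebra_simps)
  then have "\<phi> (z - x) = (R - f x) * \<phi> (dual g)" using x by (simp add: scale)
  also have "\<dots> \<le> (R - f x) * 1" by (rule mult_left_mono) (use x dual in auto)
  finally show ?thesis using fz by (intro exI[of _ z]) simp
qed

end

section \<open>Continuity in time\<close>

text \<open>Convergence is measured by a value at a base point and a Lipschitz seminorm. On a
  possibly unbounded \<open>U\<close> this controls the difference only up to linear growth, hence
  the weight.\<close>

lemma C0_Lip_near:
  assumes f: "C0_Lip I U f" and t: "t \<in> I" and x0: "x0 \<in> U" and e: "e > 0"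
  shows "\<exists>\<delta>>0. \<forall>s\<in>I. \<bar>s - t\<bar> < \<delta> \<longrightarrow> (\<forall>x\<in>U. \<bar>f s x - f t x\<bar> \<le> e * (1 + norm (x - x0)))"
proof -
  have T: "tendsto_Lip U f (f t) (at t within I)" using f t by (simp add: C0_Lip_def)
  have "\<forall>\<^sub>F s in at t within I. dist (f s x0) (f t x0) < e"
    using T x0 e by (auto simp: tendsto_Lip_def dest: tendstoD)
  moreover have "\<forall>\<^sub>F s in at t within I. e-lipschitz_on U (\<lambda>x. f s x - f t x)"
    using T e by (auto simp: tendsto_Lip_def)
  ultimately have "\<forall>\<^sub>F s in at t within I. \<forall>x\<in>U. \<bar>f s x - f t x\<bar> \<le> e * (1 + norm (x - x0))"
  proof eventually_elim
    case (elim s)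
    show ?case
    proof
      fix x assume "x \<in> U"
      from lipschitz_onD[OF elim(2) this x0]
      have "\<bar>(f s x - f t x) - (f s x0 - f t x0)\<bar> \<le> e * norm (x - x0)" by (simp add: dist_norm)
      with elim(1) show "\<bar>f s x - f t x\<bar> \<le> e * (1 + norm (x - x0))" by (simp add: dist_norm algebra_simps)
    qed
  qed
  then obtain \<delta> where d: "\<delta> > 0" "\<And>s. s \<in> I \<Longrightarrow> s \<noteq> t \<Longrightarrow> dist s t < \<delta> \<Longrightarrow> \<forall>x\<in>U. \<bar>f s x - f t x\<bar> \<le> e * (1 + norm (x - x0))"
    by (auto simp: eventually_at)
  have "\<forall>x\<in>U. \<bar>f s x - f t x\<bar> \<le> e * (1 + norm (x - x0))" if "s \<in> I" "\<bar>s - t\<bar> < \<delta>" for s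
    using d(2)[of s] that e by (cases "s = t") (auto simp: dist_real_def)
  with d(1) show ?thesis by blast
qed

lemma C0_Lip_continuous:
  assumes f: "C0_Lip I U f" shows "continuous_on (I \<times> U) (\<lambda>(t, x). f t x)"
  unfolding continuous_on_iff
proof (clarify)
  fix t x e assume t: "t \<in> I" and x: "x \<in> U" and e: "(0::real) < e"
  obtain \<delta>1 where d1: "\<delta>1 > 0" "\<And>s y. s \<in> I \<Longrightarrow> \<bar>s - t\<bar> < \<delta>1 \<Longrightarrow> y \<in> U \<Longrightarrow> \<bar>f s y - f t y\<bar> \<le> (e / 4) * (1 + norm (y - x))"
    using C0_Lip_near[OF f t x, of "e / 4"] e by auto
  obtain L where "L-lipschitz_on U (f t)" using f t by (auto simp: C0_Lip_def is_Lip_def)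
  then have "continuous_on U (f t)" by (rule lipschitz_on_continuous_on)
  then obtain \<delta>2 where d2: "\<delta>2 > 0" "\<And>y. y \<in> U \<Longrightarrow> dist y x < \<delta>2 \<Longrightarrow> dist (f t y) (f t x) < e / 2"
    using continuous_on_iff[THEN iffD1, rule_format, of U "f t" x "e / 2"] x e by auto
  show "\<exists>d>0. \<forall>x'\<in>I \<times> U. dist x' (t, x) < d \<longrightarrow> dist (case x' of (t, x) \<Rightarrow> f t x) (f t x) < e"
  proof (intro exI[of _ "min \<delta>1 (min \<delta>2 1)"] conjI ballI impI)
    fix p assume p: "p \<in> I \<times> U" "dist p (t, x) < min \<delta>1 (min \<delta>2 1)"
    obtain s y where sy: "p = (s, y)" by (cases p)
    have "dist s t < min \<delta>1 (min \<delta>2 1)" "dist y x < min \<delta>1 (min \<delta>2 1)"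
      using p sy dist_fst_le[of p "(t, x)"] dist_snd_le[of p "(t, x)"] by auto
    then have "\<bar>f s y - f t y\<bar> \<le> (e / 4) * (1 + norm (y - x))" "\<bar>f t y - f t x\<bar> < e / 2" "norm (y - x) < 1"
      using d1(2)[of s y] d2(2)[of y] p sy by (auto simp: dist_norm)
    moreover have "(e / 4) * (1 + norm (y - x)) \<le> (e / 4) * 2" using calculation e by (intro mult_left_mono) auto
    then have "(e / 4) * (1 + norm (y - x)) \<le> e / 2" by simp
    ultimately have "\<bar>f s y - f t y\<bar> \<le> e / 2" "\<bar>f t y - f t x\<bar> < e / 2" by linarith+
    then have "\<bar>f s y - f t x\<bar> < e" by arith
    then show "dist (case p of (t, x) \<Rightarrow> f t x) (f t x) < e" by (simp add: sy dist_norm)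
  qed (use d1 d2 in auto)
qed

context elliptic_norm
begin

text \<open>
  Convergence away from \<open>U\<close> comes for free: a sign can only change there if a zero of some \<open>fn n\<close>
  passes by, which \<open>zeros\<close> excludes.
\<close>

lemma sd_pointwise_limit_pos:
  assumes fn: "\<And>n. sd (fn n)" and g: "sd g" and U: "open U" "\<And>x. g x = 0 \<Longrightarrow> x \<in> U"
    and lim: "\<And>x. x \<in> U \<Longrightarrow> (\<lambda>n. fn n x) \<longlonglongrightarrow> g x"
    and zeros: "\<And>e B. e > 0 \<Longrightarrow> \<forall>\<^sub>F n in sequentially. \<forall>x. fn n x = 0 \<and> norm x \<le> B \<longrightarrow> \<bar>g x\<bar> \<le> e"
    and x: "g x > 0"
  shows "(\<lambda>n. fn n x) \<longlonglongrightarrow> g x"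
proof (rule tendstoI)
  fix e :: real assume e: "e > 0"
  obtain z where z: "g z = 0" "\<phi> (x - z) = g x" using sd_nearest[OF g, of x] x by auto
  obtain \<rho> where \<rho>: "\<rho> > 0" "ball z \<rho> \<subseteq> U" using U z by (meson openE)
  \<comment> \<open>Here \<open>\<delta> < g x\<close> places \<open>z'\<close> strictly between
    \<open>z\<close> and \<open>x\<close>, \<open>\<delta> < c0 * \<rho>\<close> keeps it in
    \<open>U\<close>, where convergence is known, and \<open>\<delta> < e\<close> makes the final
    lower bound good enough.\<close>
  define \<delta> where "\<delta> = min (min (e / 2) (g x / 2)) (c0 * \<rho> / 2)"
  have d: "\<delta> > 0" "\<delta> < e" "\<delta> < g x" "\<delta> < c0 * \<rho>" using e x \<rho> c0 by (auto simp: \<delta>_def min_def)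
  define s where "s = \<delta> / g x"
  have s: "0 < s" "s < 1" "s * g x = \<delta>" using d x by (auto simp: s_def)
  define z' where "z' = z + s *\<^sub>R (x - z)"
  have gz': "g z' = \<delta>" using sd_line[OF g z(1), of x s] z s x by (simp add: z'_def)
  have "\<phi> (z' - z) = \<delta>" using s z by (simp add: z'_def scale)
  then have "c0 * norm (z' - z) < c0 * \<rho>" using lower[of "z' - z"] d by simp
  then have "z' \<in> ball z \<rho>" using c0 by (simp add: dist_norm norm_minus_commute)
  then have "z' \<in> U" using \<rho> by blast
  have xz': "\<phi> (x - z') = g x - \<delta>"
  proof -
    have e: "x - z' = (1 - s) *\<^sub>R (x - z)" by (simp add: z'_def algebra_simps)
    show ?thesis unfolding e scale using s z by (simp add: left_diff_distrib)
  qed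
  define B where "B = norm x + g x / c0"
  have in_ball: "norm w \<le> B \<and> g w \<ge> \<delta>" if "\<phi> (x - w) \<le> g x - \<delta>" for w
  proof
    have "norm (x - w) \<le> \<phi> (x - w) / c0" by (rule norm_le)
    also have "\<dots> \<le> g x / c0" using that d c0 by (intro divide_right_mono) auto
    finally show "norm w \<le> B" using norm_triangle_ineq4[of x "x - w"] by (simp add: B_def)
    show "g w \<ge> \<delta>" using sd_lip[OF g, of x w] that by simp
  qed
  have "\<forall>\<^sub>F n in sequentially. dist (fn n z) (g z) < e" using tendstoD[OF lim[OF U(2)[OF z(1)]] e] .
  moreover have "\<forall>\<^sub>F n in sequentially. fn n z' > 0"
    using order_tendstoD(1)[OF lim[OF \<open>z' \<in> U\<close>]] gz' d by simp
  moreover have "\<forall>\<^sub>F n in sequentially. \<forall>x. fn n x = 0 \<and> norm x \<le> B \<longrightarrow> \<bar>g x\<bar> \<le> \<delta> / 2"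
    using zeros[of "\<delta> / 2" B] d by simp
  ultimately show "\<forall>\<^sub>F n in sequentially. dist (fn n x) (g x) < e"
  proof eventually_elim
    case (elim n)
    \<comment> \<open>Points within \<phi>-distance \<open>g x - \<delta>\<close> of
      \<open>x\<close> satisfy \<open>g \<ge> \<delta>\<close> and so are no zeros of
      \<open>fn n\<close>. If \<open>fn n x\<close> were too small, such a zero would exist: the
      nearest zero when \<open>fn n x\<close> is nonnegative, otherwise a sign change on the segment
      to \<open>z'\<close>, where \<open>fn n\<close> is positive.\<close>
    have no_zero: False if "fn n w = 0" "\<phi> (x - w) \<le> g x - \<delta>" for w
      using in_ball[OF that(2)] elim(3) that(1) d by fastforce
    have "fn n x \<ge> g x - \<delta>"
    proof (rule ccontr)
      assume lt: "\<not> fn n x \<ge> g x - \<delta>"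
      show False
      proof (cases "fn n x \<ge> 0")
        case True
        obtain w where "fn n w = 0" "\<phi> (x - w) = \<bar>fn n x\<bar>" using sd_nearest[OF fn] by blast
        then show False using no_zero[of w] lt True by auto
      next
        case False
        let ?p = "\<lambda>u. x + u *\<^sub>R (z' - x)"
        have "continuous_on {0..1} (\<lambda>u. fn n (?p u))"
          by (intro continuous_on_compose2[OF sd_continuous[OF fn, of UNIV]] continuous_intros) auto
        then obtain u where u: "0 \<le> u" "u \<le> 1" "fn n (?p u) = 0"
          using IVT'[of "\<lambda>u. fn n (?p u)" 0 0 1] False elim(2) by auto
        have "x - ?p u = u *\<^sub>R (x - z')" by (simp add: algebra_simps)
        then have "\<phi> (x - ?p u) = u * (g x - \<delta>)" using u xz' by (simp add: scale)
        also have "\<dots> \<le> 1 * (g x - \<delta>)" using u d by (intro mult_right_mono) auto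
        finally show False using no_zero[OF u(3)] by simp
      qed
    qed
    moreover have "fn n x < g x + e" using sd_lip[OF fn, of n x z] elim(1) z by (simp add: dist_norm)
    ultimately show ?case using d by (simp add: dist_norm abs_less_iff)
  qed
qed

lemma sd_pointwise_limit:
  assumes fn: "\<And>n. sd (fn n)" and g: "sd g" and U: "open U" "\<And>x. g x = 0 \<Longrightarrow> x \<in> U"
    and lim: "\<And>x. x \<in> U \<Longrightarrow> (\<lambda>n. fn n x) \<longlonglongrightarrow> g x"
    and zeros: "\<And>e B. e > 0 \<Longrightarrow> \<forall>\<^sub>F n in sequentially. \<forall>x. fn n x = 0 \<and> norm x \<le> B \<longrightarrow> \<bar>g x\<bar> \<le> e"
  shows "(\<lambda>n. fn n x) \<longlonglongrightarrow> g x"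
proof -
  consider "g x = 0" | "g x > 0" | "g x < 0" by linarith
  then show ?thesis
  proof cases
    case 1 then show ?thesis using U lim by blast
  next
    case 2 then show ?thesis by (intro sd_pointwise_limit_pos[OF fn g U lim zeros])
  next
    case 3
    have "(\<lambda>n. - fn n x) \<longlonglongrightarrow> - g x"
      by (rule sd_pointwise_limit_pos[of "\<lambda>n x. - fn n x" "\<lambda>x. - g x" U])
        (use 3 fn g U zeros in \<open>auto intro: sd_minus tendsto_minus lim\<close>)
    then show ?thesis by (simp add: tendsto_minus_cancel_left)
  qed
qed

end

section \<open>Families of signed distances depending on time\<close>

locale sd_flow = elliptic_norm +
  fixes T :: real and U :: "plane set" and f :: "real \<Rightarrow> plane \<Rightarrow> real"
  assumes T: "T > 0" and U: "open U" "U \<noteq> {}"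
    and sd: "t \<in> {0..T} \<Longrightarrow> sd (f t)"
    and zeros: "t \<in> {0..T} \<Longrightarrow> f t x = 0 \<Longrightarrow> x \<in> U"
    and C0: "C0_Lip {0..T} U f"
    and bounded0: "bounded {x. f 0 x = 0}"
begin

definition "zero_set t = {x. f t x = 0}"

lemma zero_growth:
  assumes "t \<in> {0..T}" "zero_set t \<subseteq> cball 0 B"
  shows "\<bar>f t x\<bar> \<ge> c0 * (norm x - B)"
proof -
  obtain z where z: "f t z = 0" "\<phi> (x - z) = \<bar>f t x\<bar>" using sd_nearest[OF sd[OF assms(1)]] by blast
  then have "norm z \<le> B" using assms(2) by (auto simp: zero_set_def)
  then have "norm x - B \<le> norm (x - z)" using norm_triangle_ineq2[of x z] by simp
  then have "c0 * (norm x - B) \<le> c0 * norm (x - z)" using c0 by simp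
  then show ?thesis using lower[of "x - z"] z by simp
qed

text \<open>Away from a ball containing its zeros a signed distance grows at least with slope
  \<open>c0\<close>, while the two functions differ by a term of slope \<open>c0 / 2\<close>, so
  zeros cannot escape far. Stated in both directions, this makes boundedness of the zero set spread
  along the connected time interval.\<close>

lemma zero_set_near:
  assumes t: "t \<in> {0..T}" and x0: "x0 \<in> U"
  shows "\<exists>\<delta>>0. \<forall>s\<in>{0..T}. \<bar>s - t\<bar> < \<delta> \<longrightarrow>
    (\<forall>B. zero_set t \<subseteq> cball 0 B \<longrightarrow> zero_set s \<subseteq> cball 0 (2 * B + 1 + norm x0)) \<and>
    (\<forall>B. zero_set s \<subseteq> cball 0 B \<longrightarrow> zero_set t \<subseteq> cball 0 (2 * B + 1 + norm x0))"
proof -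
  obtain \<delta> where d: "\<delta> > 0" and near: "\<And>s x. s \<in> {0..T} \<Longrightarrow> \<bar>s - t\<bar> < \<delta> \<Longrightarrow> x \<in> U \<Longrightarrow>
      \<bar>f s x - f t x\<bar> \<le> c0 / 2 * (1 + norm (x - x0))"
    using C0_Lip_near[OF C0 t x0, of "c0 / 2"] c0 by auto
  have "zero_set s2 \<subseteq> cball 0 (2 * B + 1 + norm x0)"
    if "s1 \<in> {0..T}" "s2 \<in> {0..T}" "zero_set s1 \<subseteq> cball 0 B"
      and n: "\<And>x. x \<in> U \<Longrightarrow> \<bar>f s1 x - f s2 x\<bar> \<le> c0 / 2 * (1 + norm (x - x0))" for s1 s2 B
  proof
    fix x assume "x \<in> zero_set s2"
    then have x: "f s2 x = 0" "x \<in> U" using zeros[OF that(2)] by (auto simp: zero_set_def)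
    have "c0 * (norm x - B) \<le> c0 / 2 * (1 + norm (x - x0))"
      using zero_growth[OF that(1,3), of x] n[OF x(2)] x(1) by simp
    also have "\<dots> \<le> c0 / 2 * (1 + (norm x + norm x0))"
      using c0 norm_triangle_ineq4[of x x0] by (intro mult_left_mono) auto
    also have "\<dots> = c0 * ((1 + (norm x + norm x0)) / 2)" by simp
    finally have "norm x - B \<le> (1 + (norm x + norm x0)) / 2" using c0 by simp
    then show "x \<in> cball 0 (2 * B + 1 + norm x0)" by simp
  qed
  note * = this
  show ?thesis
  proof (intro exI[of _ \<delta>] conjI ballI impI allI d)
    fix s B assume s: "s \<in> {0..T}" "\<bar>s - t\<bar> < \<delta>"
    show "zero_set s \<subseteq> cball 0 (2 * B + 1 + norm x0)" if "zero_set t \<subseteq> cball 0 B"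
      by (rule *[OF t s(1) that]) (use near[OF s] in \<open>simp add: abs_minus_commute\<close>)
    show "zero_set t \<subseteq> cball 0 (2 * B + 1 + norm x0)" if "zero_set s \<subseteq> cball 0 B"
      by (rule *[OF s(1) t that]) (use near[OF s] in simp)
  qed
qed

lemma bounded_iff_cball: "bounded S \<longleftrightarrow> (\<exists>B. S \<subseteq> cball (0::plane) B)"
  by (auto simp: bounded_iff subset_eq)

lemma bounded_zero_set: assumes "t \<in> {0..T}" shows "bounded (zero_set t)"
proof -
  obtain x0 where x0: "x0 \<in> U" using U by blast
  show ?thesis
  proof (rule connected_induction_simple[where S="{0..T}" and a=0 and b=t and P="\<lambda>t. bounded (zero_set t)"])
    show "bounded (zero_set 0)" using bounded0 by (simp add: zero_set_def)
    fix a assume a: "a \<in> {0..T}"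
    obtain \<delta> where d: "\<delta> > 0" "\<And>s. s \<in> {0..T} \<Longrightarrow> \<bar>s - a\<bar> < \<delta> \<Longrightarrow> bounded (zero_set s) \<longleftrightarrow> bounded (zero_set a)"
      using zero_set_near[OF a x0] unfolding bounded_iff_cball by metis
    show "\<exists>V. openin (top_of_set {0..T}) V \<and> a \<in> V \<and>
        (\<forall>x\<in>V. \<forall>y\<in>V. bounded (zero_set x) \<longrightarrow> bounded (zero_set y))"
    proof (intro exI[of _ "{0..T} \<inter> ball a \<delta>"] conjI ballI impI)
      show "openin (top_of_set {0..T}) ({0..T} \<inter> ball a \<delta>)" by (rule openin_open_Int) simp
      show "a \<in> {0..T} \<inter> ball a \<delta>" using a d(1) by simp
      have *: "bounded (zero_set x) \<longleftrightarrow> bounded (zero_set a)" if "x \<in> {0..T} \<inter> ball a \<delta>" for x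
        using d(2)[of x] that by (simp add: dist_real_def abs_minus_commute)
      show "bounded (zero_set y)" if "x \<in> {0..T} \<inter> ball a \<delta>" "y \<in> {0..T} \<inter> ball a \<delta>" "bounded (zero_set x)" for x y
        using that(3) *[OF that(1)] *[OF that(2)] by blast
    qed
  qed (use assms T in auto)
qed

lemma zero_closed:
  assumes s: "\<And>n. s n \<in> {0..T}" "s \<longlonglongrightarrow> t" "t \<in> {0..T}" and e: "e > 0"
  shows "\<forall>\<^sub>F n in sequentially. \<forall>x. f (s n) x = 0 \<and> norm x \<le> B \<longrightarrow> \<bar>f t x\<bar> \<le> e"
proof -
  obtain x0 where x0: "x0 \<in> U" using U by blast
  define M where "M = 1 + \<bar>B\<bar> + norm x0"
  have M: "M > 0" by (simp add: M_def add_pos_nonneg)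
  obtain \<delta> where d: "\<delta> > 0" and near: "\<And>s x. s \<in> {0..T} \<Longrightarrow> \<bar>s - t\<bar> < \<delta> \<Longrightarrow> x \<in> U \<Longrightarrow>
      \<bar>f s x - f t x\<bar> \<le> e / M * (1 + norm (x - x0))"
    using C0_Lip_near[OF C0 s(3) x0, of "e / M"] e M by auto
  have "\<forall>\<^sub>F n in sequentially. dist (s n) t < \<delta>" using tendstoD[OF s(2) d] .
  then show ?thesis
  proof (eventually_elim, clarify)
    fix n x assume n: "dist (s n) t < \<delta>" "f (s n) x = 0" "norm x \<le> B"
    have "\<bar>f t x\<bar> \<le> e / M * (1 + norm (x - x0))"
      using near[OF s(1), of n x] n zeros[OF s(1) n(2)] by (simp add: dist_real_def)
    also have "\<dots> \<le> e / M * M"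
      using e M n norm_triangle_ineq4[of x x0] by (intro mult_left_mono) (auto simp: M_def)
    finally show "\<bar>f t x\<bar> \<le> e" using M by simp
  qed
qed

lemma tendsto_time:
  assumes s: "\<And>n. s n \<in> {0..T}" "s \<longlonglongrightarrow> t" "t \<in> {0..T}"
  shows "(\<lambda>n. f (s n) x) \<longlonglongrightarrow> f t x"
proof (rule sd_pointwise_limit[OF sd[OF s(1)] sd[OF s(3)] U(1) zeros[OF s(3)] _ zero_closed[OF s]])
  fix x assume "x \<in> U"
  then show "(\<lambda>n. f (s n) x) \<longlonglongrightarrow> f t x"
    using continuous_on_tendsto_compose[OF C0_Lip_continuous[OF C0] tendsto_Pair[OF s(2) tendsto_const], of x] s
    by auto
qed

lemma tendsto_joint:
  assumes s: "\<And>n. s n \<in> {0..T}" "s \<longlonglongrightarrow> t" "t \<in> {0..T}" and x: "x \<longlonglongrightarrow> y"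
  shows "(\<lambda>n. f (s n) (x n)) \<longlonglongrightarrow> f t y"
proof -
  have "(\<lambda>n. f (s n) (x n) - f (s n) y) \<longlonglongrightarrow> 0"
  proof (rule Lim_null_comparison)
    show "\<forall>\<^sub>F n in sequentially. norm (f (s n) (x n) - f (s n) y) \<le> norm (x n - y) / c0"
      using order_trans[OF sd_lip_abs[OF sd[OF s(1)]] upper] by simp
    have "(\<lambda>n. norm (x n - y) / c0) \<longlonglongrightarrow> norm (y - y) / c0" using c0 by (intro tendsto_intros x) simp
    then show "(\<lambda>n. norm (x n - y) / c0) \<longlonglongrightarrow> 0" by simp
  qed
  from tendsto_add[OF this tendsto_time[OF s, of y]] show ?thesis by simp
qed

lemma continuous_joint: "continuous_on ({0..T} \<times> UNIV) (\<lambda>(t, x). f t x)"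
  unfolding continuous_on_sequentially
proof (clarify)
  fix p t y assume "\<forall>n. (p n :: real \<times> plane) \<in> {0..T} \<times> UNIV" "p \<longlonglongrightarrow> (t, y)" "t \<in> {0..T}"
  then have "(\<lambda>n. f (fst (p n)) (snd (p n))) \<longlonglongrightarrow> f t y"
    using tendsto_fst[of p "(t, y)"] tendsto_snd[of p "(t, y)"] by (intro tendsto_joint) (auto simp: mem_Times_iff)
  then show "((\<lambda>(t, x). f t x) \<circ> p) \<longlonglongrightarrow> f t y" by (simp add: o_def case_prod_unfold)
qed

definition "all_zeros = (\<Union>t\<in>{0..T}. zero_set t)"

text \<open>First extract a convergent sequence of times; near its limit all zero sets lie in one
  ball by \<open>zero_set_near\<close>, so the points have a convergent subsequence too, and joint
  continuity makes the limit a zero.\<close>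

lemma compact_all_zeros: "compact all_zeros"
  unfolding compact_def
proof (intro allI impI)
  fix x :: "nat \<Rightarrow> plane" assume "\<forall>n. x n \<in> all_zeros"
  then have "\<forall>n. \<exists>t. t \<in> {0..T} \<and> f t (x n) = 0" unfolding all_zeros_def zero_set_def by blast
  then obtain s where s: "\<And>n. s n \<in> {0..T}" "\<And>n. f (s n) (x n) = 0" by metis
  have "seq_compact {0..T}" by (simp add: compact_imp_seq_compact)
  then obtain t r where t: "t \<in> {0..T}" "strict_mono (r::nat\<Rightarrow>nat)" "(s \<circ> r) \<longlonglongrightarrow> t"
    using s(1) by (elim seq_compactE[of _ s]) auto
  obtain x0 where x0: "x0 \<in> U" using U by blast
  obtain B where B: "zero_set t \<subseteq> cball 0 B" using bounded_zero_set[OF t(1)] by (auto simp: bounded_iff_cball)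
  obtain \<delta> where d: "\<delta> > 0" "\<And>s. s \<in> {0..T} \<Longrightarrow> \<bar>s - t\<bar> < \<delta> \<Longrightarrow> zero_set s \<subseteq> cball 0 (2 * B + 1 + norm x0)"
    using zero_set_near[OF t(1) x0] B by metis
  have "\<forall>\<^sub>F n in sequentially. dist ((s \<circ> r) n) t < \<delta>" using tendstoD[OF t(3) d(1)] .
  then obtain N where N: "\<And>n. n \<ge> N \<Longrightarrow> \<bar>s (r n) - t\<bar> < \<delta>" by (auto simp: eventually_sequentially dist_real_def)
  have "x (r (n + N)) \<in> cball 0 (2 * B + 1 + norm x0)" for n
    by (rule subsetD[OF d(2)[OF s(1) N[OF le_add2]]]) (use s(2) in \<open>auto simp: zero_set_def\<close>)
  then obtain y r' where y: "strict_mono (r'::nat\<Rightarrow>nat)" "((\<lambda>n. x (r (n + N))) \<circ> r') \<longlonglongrightarrow> y"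
    using compact_cball[of "0::plane" "2 * B + 1 + norm x0"] unfolding compact_def by metis
  define q where "q = (\<lambda>n. r (r' n + N))"
  have q: "strict_mono q" using t(2) y(1) by (auto simp: q_def strict_mono_def)
  have xq: "(\<lambda>n. x (q n)) \<longlonglongrightarrow> y" using y(2) by (simp add: q_def o_def)
  have "strict_mono (\<lambda>n. r' n + N)" using y(1) by (auto simp: strict_mono_def)
  from LIMSEQ_subseq_LIMSEQ[OF t(3) this] have sq: "(\<lambda>n. s (q n)) \<longlonglongrightarrow> t" by (simp add: q_def o_def)
  have "(\<lambda>n. f (s (q n)) (x (q n))) \<longlonglongrightarrow> f t y" by (rule tendsto_joint) (use s sq t xq in auto)
  then have "f t y = 0" using s(2) by (simp add: LIMSEQ_const_iff)
  then have "y \<in> all_zeros" using t(1) by (auto simp: all_zeros_def zero_set_def)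
  then show "\<exists>l\<in>all_zeros. \<exists>r. strict_mono r \<and> (x \<circ> r) \<longlonglongrightarrow> l" using q xq by (auto simp: o_def)
qed

text \<open>The boundaries at all times form one compact subset of \<open>U\<close>, hence have a
  common distance from its complement; coercivity turns a small value of \<open>f\<close> into
  closeness to a zero.\<close>

lemma tube: "\<exists>r>0. \<forall>t\<in>{0..T}. \<forall>x. \<bar>f t x\<bar> < r \<longrightarrow> x \<in> U"
proof -
  have "all_zeros \<subseteq> U" using zeros by (auto simp: all_zeros_def zero_set_def)
  then obtain e where e: "e > 0" "(\<Union>x\<in>all_zeros. ball x e) \<subseteq> U"
    using compact_subset_open_imp_ball_epsilon_subset[OF compact_all_zeros U(1)] by metis
  have "x \<in> U" if t: "t \<in> {0..T}" and x: "\<bar>f t x\<bar> < c0 * e" for t x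
  proof -
    obtain z where z: "f t z = 0" "\<phi> (x - z) = \<bar>f t x\<bar>" using sd_nearest[OF sd[OF t]] by blast
    then have "norm (x - z) < e" using x lower[of "x - z"] c0
      by (smt (verit) mult_less_cancel_left_pos)
    then have "x \<in> ball z e" by (simp add: dist_norm norm_minus_commute)
    moreover have "z \<in> all_zeros" using z t unfolding all_zeros_def zero_set_def by blast
    ultimately show ?thesis using e(2) by blast
  qed
  with e c0 show ?thesis by (intro exI[of _ "c0 * e"]) auto
qed

text \<open>A point that no boundary ever visits cannot change sides, by continuity in time. This
  handles the part of the plane far from all boundaries, where no equation is available.\<close>

lemma sign_constant:
  assumes "x \<notin> all_zeros" "t \<in> {0..T}" "s \<in> {0..T}" "f t x \<le> 0" shows "f s x \<le> 0"
proof (rule ccontr)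
  assume "\<not> f s x \<le> 0"
  have c: "continuous_on {0..T} (\<lambda>t. f t x)"
  proof -
    have "continuous_on {0..T} (\<lambda>t. (t, x))" by (intro continuous_intros)
    from continuous_on_compose2[OF continuous_joint this] show ?thesis by auto
  qed
  have "connected ((\<lambda>t. f t x) ` {0..T})" by (rule connected_continuous_image[OF c]) simp
  then have "0 \<in> (\<lambda>t. f t x) ` {0..T}"
    using connectedD_interval[of _ "f t x" "f s x" 0] assms \<open>\<not> f s x \<le> 0\<close> by force
  then show False using assms(1) by (auto simp: all_zeros_def zero_set_def)
qed

text \<open>\<open>sd_outer_ball\<close> needs differentiability, which holds only at almost every
  time. Good times approach \<open>t\<close>, the centres found there stay bounded, and a limit
  point serves at \<open>t\<close>. The value \<open>f t x = R\<close> is treated apart, with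
  \<open>z = x\<close>, so that the inequality remains strict at the approximating times.\<close>

lemma outer_ball:
  assumes R: "R > 0"
    and diff: "AE t in lborel. t \<in> {0..T} \<longrightarrow> (\<forall>x\<in>U. f t differentiable (at x))"
    and ball: "\<And>t y. t \<in> {0..T} \<Longrightarrow> f t y = 0 \<Longrightarrow> \<exists>z. f t z \<ge> R \<and> \<phi> (z - y) \<le> R"
    and t: "t \<in> {0..T}" and x: "f t x \<le> R"
  shows "\<exists>z. f t z \<ge> R \<and> \<phi> (z - x) \<le> R - f t x"
proof (cases "f t x = R")
  case False
  \<comment> \<open>Otherwise a whole interval around \<open>t\<close>, cut off at 0 and
    \<open>T\<close> but still of positive length, would consist of exceptional times.\<close>
  have "\<exists>s\<in>{0..T}. dist s t < 1 / real (Suc n) \<and> (\<forall>x\<in>U. f s differentiable (at x))" for n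
  proof (rule ccontr)
    assume c: "\<not> ?thesis"
    let ?a = "max 0 (t - 1 / real (Suc n))" and ?b = "min T (t + 1 / real (Suc n))"
    have "AE s in lborel. s \<notin> {?a<..<?b}"
      using diff
    proof eventually_elim
      case (elim s)
      show ?case
      proof
        assume "s \<in> {?a<..<?b}"
        then have "s \<in> {0..T}" "dist s t < 1 / real (Suc n)" by (auto simp: dist_real_def abs_less_iff simp del: of_nat_Suc)
        then show False using elim c by blast
      qed
    qed
    then have "{?a<..<?b} \<in> null_sets lborel" by (subst AE_iff_null_sets) auto
    then have "emeasure lborel {?a<..<?b} = 0" by auto
    moreover have "1 / real (Suc n) > 0" by simp
    then have "t - 1 / real (Suc n) < t + 1 / real (Suc n)" "t - 1 / real (Suc n) < T" "0 < t + 1 / real (Suc n)"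
      using t unfolding atLeastAtMost_iff by linarith+
    then have "?a < ?b" using T by simp
    moreover have "emeasure lborel {a<..<b} \<noteq> 0" if "a < b" for a b :: real using that by simp
    ultimately show False by blast
  qed
  then have "\<forall>n. \<exists>s. s \<in> {0..T} \<and> dist s t < 1 / real (Suc n) \<and> (\<forall>x\<in>U. f s differentiable (at x))"
    by blast
  from choice[OF this] obtain s where s: "\<And>n. s n \<in> {0..T}" "\<And>n. dist (s n) t < 1 / real (Suc n)"
    "\<And>n x. x \<in> U \<Longrightarrow> f (s n) differentiable (at x)" by blast
  have st: "s \<longlonglongrightarrow> t"
  proof (rule tendsto_dist_iff[THEN iffD2], rule Lim_null_comparison[OF _ LIMSEQ_Suc[OF lim_1_over_n]])
    show "\<forall>\<^sub>F n in sequentially. norm (dist (s n) t) \<le> 1 / real (Suc n)"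
      using s(2) by (intro always_eventually allI) (simp add: less_imp_le del: of_nat_Suc)
  qed
  have "(\<lambda>n. f (s n) x) \<longlonglongrightarrow> f t x" by (rule tendsto_time[OF s(1) st t])
  then have "\<forall>\<^sub>F n in sequentially. f (s n) x < R" by (rule order_tendstoD) (use False x in simp)
  then obtain N where N: "\<And>n. n \<ge> N \<Longrightarrow> f (s n) x < R" by (auto simp: eventually_sequentially)
  define s' where "s' = (\<lambda>n. s (n + N))"
  have s': "\<And>n. s' n \<in> {0..T}" "s' \<longlonglongrightarrow> t" using s(1) LIMSEQ_ignore_initial_segment[OF st] by (auto simp: s'_def)
  have "\<exists>z. f (s' n) z \<ge> R \<and> \<phi> (z - x) \<le> R - f (s' n) x" for n
    by (rule sd_outer_ball[OF sd[OF s'(1)] R]) (use s zeros[OF s'(1)] ball[OF s'(1)] N[of "n + N"] in \<open>auto simp: s'_def\<close>)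
  then obtain z where z: "\<And>n. f (s' n) (z n) \<ge> R" "\<And>n. \<phi> (z n - x) \<le> R - f (s' n) x" by metis
  have lim: "(\<lambda>n. f (s' n) x) \<longlonglongrightarrow> f t x" by (rule tendsto_time[OF s' t])
  then have "Bseq (\<lambda>n. f (s' n) x)" using convergent_imp_Bseq convergentI by blast
  then obtain K where K: "\<And>n. \<bar>f (s' n) x\<bar> \<le> K" by (auto simp: Bseq_def)
  have "z n \<in> cball x ((R + K) / c0)" for n
  proof -
    have "norm (z n - x) \<le> \<phi> (z n - x) / c0" by (rule norm_le)
    also have "\<dots> \<le> (R + K) / c0" using z(2)[of n] K[of n] c0 by (intro divide_right_mono) auto
    finally show ?thesis by (simp add: dist_norm norm_minus_commute)
  qed
  then obtain y r where y: "strict_mono (r::nat\<Rightarrow>nat)" "(z \<circ> r) \<longlonglongrightarrow> y"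
    using compact_cball[of x "(R + K) / c0"] unfolding compact_def by metis
  have s'r: "(\<lambda>n. s' (r n)) \<longlonglongrightarrow> t" using LIMSEQ_subseq_LIMSEQ[OF s'(2) y(1)] by (simp add: o_def)
  have "(\<lambda>n. f (s' (r n)) (z (r n))) \<longlonglongrightarrow> f t y"
    by (rule tendsto_joint) (use s' s'r t y in \<open>auto simp: o_def\<close>)
  then have "f t y \<ge> R" by (rule LIMSEQ_le_const) (use z in auto)
  moreover have "\<phi> (y - x) \<le> R - f t x"
  proof (rule LIMSEQ_le)
    have "isCont \<phi> (y - x)" using continuous by (simp add: continuous_on_eq_continuous_at)
    then show "(\<lambda>n. \<phi> (z (r n) - x)) \<longlonglongrightarrow> \<phi> (y - x)"
      using y(2) by (intro isCont_tendsto_compose[of _ \<phi>] tendsto_intros) (auto simp: o_def)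
    show "(\<lambda>n. R - f (s' (r n)) x) \<longlonglongrightarrow> R - f t x"
      using LIMSEQ_subseq_LIMSEQ[OF lim y(1)] by (intro tendsto_intros) (auto simp: o_def)
  qed (use z in auto)
  ultimately show ?thesis by blast
qed (auto intro: exI[of _ x])

end

section \<open>Energy estimates\<close>

text \<open>Dominated convergence in the form suited to difference quotients: only existence and
  sign of the pointwise limit are known. It serves both in time and in space.\<close>

lemma bounded_limit_integral_nonneg:
  fixes d :: "nat \<Rightarrow> 'a::euclidean_space \<Rightarrow> real"
  assumes meas: "\<And>n. d n \<in> borel_measurable borel" and S: "compact S"
    and bound: "\<And>n x. x \<in> S \<Longrightarrow> \<bar>d n x\<bar> \<le> B" and zero: "\<And>n x. x \<notin> S \<Longrightarrow> d n x = 0"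
    and lim: "AE x in lborel. \<exists>l\<ge>0. (\<lambda>n. d n x) \<longlonglongrightarrow> l"
  shows "\<exists>J\<ge>0. (\<lambda>n. \<integral>x. d n x \<partial>lborel) \<longlonglongrightarrow> J"
proof -
  define D where "D = (\<lambda>x. lim (\<lambda>n. d n x))"
  have D: "AE x in lborel. (\<lambda>n. d n x) \<longlonglongrightarrow> D x \<and> 0 \<le> D x"
    using lim by eventually_elim (auto simp: D_def limI)
  have [measurable]: "\<And>n. d n \<in> borel_measurable lborel" using meas by simp
  have [measurable]: "D \<in> borel_measurable lborel" unfolding D_def by (rule borel_measurable_lim_metric) simp
  have "(\<lambda>n. \<integral>x. d n x \<partial>lborel) \<longlonglongrightarrow> (\<integral>x. D x \<partial>lborel)"
  proof (rule integral_dominated_convergence[where w = "\<lambda>x. indicator S x *\<^sub>R B"])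
    show "integrable lborel (\<lambda>x. indicator S x *\<^sub>R B)"
      by (rule borel_integrable_compact[OF S]) simp
    show "AE x in lborel. norm (d n x) \<le> indicator S x *\<^sub>R B" for n
      using bound zero by (intro AE_I2) (auto simp: indicator_def)
  qed (use D in auto)
  moreover have "(\<integral>x. D x \<partial>lborel) \<ge> 0" by (rule integral_nonneg_AE) (use D in auto)
  ultimately show ?thesis by blast
qed

lemma LIMSEQ_recip_filterlim_at_0:
  assumes "\<rho> \<noteq> (0::real)" shows "filterlim (\<lambda>n. \<rho> / real (Suc n)) (at 0) sequentially"
proof -
  have "(\<lambda>n. \<rho> * (1 / real (Suc n))) \<longlonglongrightarrow> \<rho> * 0" by (intro tendsto_intros LIMSEQ_Suc[OF lim_1_over_n])
  then show ?thesis using assms by (auto simp: filterlim_at)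
qed

lemma DERIV_sequence:
  assumes "(f has_real_derivative D) (at x)" "\<rho> \<noteq> 0"
  shows "(\<lambda>n. (f (x + \<rho> / real (Suc n)) - f x) / (\<rho> / real (Suc n))) \<longlonglongrightarrow> D"
  using filterlim_compose[OF assms(1)[unfolded DERIV_def] LIMSEQ_recip_filterlim_at_0[OF assms(2)]] .

text \<open>Integrating the difference quotients of \<open>F\<close> over the interval gives,
  through an antiderivative \<open>P\<close>, difference quotients of \<open>P\<close> at
  \<open>b\<close> and at \<open>a\<close>, which converge to \<open>F b - F a\<close>. The
  Lipschitz bound allows dominated convergence, and the almost everywhere sign of the limit passes
  to the integral.\<close>

lemma lipschitz_nonincreasing:
  fixes F :: "real \<Rightarrow> real"
  assumes ab: "a < b"
    and lip: "\<And>s t. s \<in> {a..b} \<Longrightarrow> t \<in> {a..b} \<Longrightarrow> \<bar>F s - F t\<bar> \<le> L * \<bar>s - t\<bar>"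
    and lim: "AE t in lborel. t \<in> {a<..<b} \<longrightarrow>
       (\<exists>l\<le>0. (\<lambda>n. (F (min b (t + 1 / real (Suc n))) - F t) / (1 / real (Suc n))) \<longlonglongrightarrow> l)"
  shows "F b \<le> F a"
proof -
  \<comment> \<open>The constant extension keeps the Lipschitz constant and makes the forward
    quotients meaningful beyond \<open>b\<close>; it agrees with the truncation at \<open>b\<close>
    in the hypothesis \<open>lim\<close>.\<close>
  define G where "G = (\<lambda>t. F (max a (min b t)))"
  have lipG: "\<bar>G s - G t\<bar> \<le> L * \<bar>s - t\<bar>" for s t
  proof -
    have "L \<ge> 0" using lip[of b a] ab by (smt (verit) atLeastAtMost_iff zero_le_mult_iff)
    have "\<bar>G s - G t\<bar> \<le> L * \<bar>max a (min b s) - max a (min b t)\<bar>"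
      unfolding G_def by (rule lip) (use ab in auto)
    also have "\<dots> \<le> L * \<bar>s - t\<bar>" by (rule mult_left_mono[OF _ \<open>L \<ge> 0\<close>]) auto
    finally show ?thesis .
  qed
  have L: "L \<ge> 0" using lipG[of 1 0] by auto
  have G: "continuous_on UNIV G"
    by (rule lipschitz_on_continuous_on[of L], rule lipschitz_onI) (use lipG L in \<open>auto simp: dist_real_def\<close>)
  obtain P where P0: "\<And>x. x \<in> {a-1..b+2} \<Longrightarrow> (P has_vector_derivative G x) (at x within {a-1..b+2})"
    using antiderivative_continuous[OF continuous_on_subset[OF G subset_UNIV]] by metis
  have P: "(P has_real_derivative G x) (at x)" if "x \<in> {a-1<..<b+2}" for x
    using P0[of x] that at_within_Icc_at[of "a-1" x "b+2"] by (auto simp: has_real_derivative_iff_has_vector_derivative)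
  define q where "q = (\<lambda>n t. (G (t + 1 / real (Suc n)) - G t) / (1 / real (Suc n)))"
  define d where "d = (\<lambda>n t. - (q n t * indicator {a..b} t))"
  have h: "0 < 1 / real (Suc n)" "1 / real (Suc n) \<le> 1" for n by auto
  have Gm: "G \<in> borel_measurable borel" by (rule borel_measurable_continuous_onI[OF G])
  have int: "(\<integral>t. d n t \<partial>lborel) = (P (a + 1 / real (Suc n)) - P a) / (1 / real (Suc n)) - (P (b + 1 / real (Suc n)) - P b) / (1 / real (Suc n))" for n
  proof -
    let ?h = "1 / real (Suc n)"
    have "(\<integral>t. q n t * indicator {a..b} t \<partial>lborel) = (P (b + ?h) - P b) / ?h - (P (a + ?h) - P a) / ?h"
    proof (rule integral_FTC_Icc_real)
      fix t assume t: "a \<le> t" "t \<le> b"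
      have "a - 1 < t + ?h" "t + ?h < b + 2" using t h[of n] by linarith+
      then have "t + ?h \<in> {a-1<..<b+2}" "t \<in> {a-1<..<b+2}" using t by auto
      note P1 = P[OF this(1)] and P2 = P[OF this(2)]
      have "((\<lambda>t. P (t + ?h)) has_real_derivative G (t + ?h)) (at t)"
        using P1 by (simp add: DERIV_shift)
      then have "((\<lambda>t. (P (t + ?h) - P t) / ?h) has_real_derivative (G (t + ?h) - G t) / ?h) (at t)"
        by (intro DERIV_cdivide DERIV_diff P2)
      then show "((\<lambda>t. (P (t + ?h) - P t) / ?h) has_real_derivative q n t) (at t)" by (simp add: q_def)
      have "continuous_on UNIV (\<lambda>t. G (t + ?h))"
        by (rule continuous_on_compose2[OF G]) (auto intro!: continuous_intros)
      then have "continuous_on UNIV (q n)" unfolding q_def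
        by (intro continuous_on_divide continuous_on_diff G continuous_on_const) auto
      then show "isCont (q n) t" by (simp add: continuous_on_eq_continuous_at)
    qed (use ab in simp)
    then show ?thesis by (simp add: d_def)
  qed
  have "\<exists>J\<ge>0. (\<lambda>n. \<integral>t. d n t \<partial>lborel) \<longlonglongrightarrow> J"
  proof (rule bounded_limit_integral_nonneg[where S="{a..b}" and B=L])
    show "d n \<in> borel_measurable borel" for n
    proof -
      have [measurable]: "G \<in> borel_measurable borel" by (rule Gm)
      show ?thesis unfolding d_def q_def by measurable
    qed
    show "\<bar>d n t\<bar> \<le> L" if "t \<in> {a..b}" for n t
    proof -
      have "\<bar>q n t\<bar> = \<bar>G (t + 1 / real (Suc n)) - G t\<bar> / (1 / real (Suc n))"
        unfolding q_def using h(1)[of n] by (simp only: abs_divide abs_of_pos)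
      also have "\<dots> \<le> L"
      proof (subst pos_divide_le_eq[OF h(1)])
        show "\<bar>G (t + 1 / real (Suc n)) - G t\<bar> \<le> L * (1 / real (Suc n))"
          using lipG[of "t + 1 / real (Suc n)" t] h(1)[of n] by simp
      qed
      finally show ?thesis using that by (simp add: d_def)
    qed
    show "d n t = 0" if "t \<notin> {a..b}" for n t using that by (simp add: d_def)
    have ab0: "AE t in lborel. t \<noteq> a \<and> t \<noteq> b"
      using AE_lborel_singleton[of a] AE_lborel_singleton[of b] by eventually_elim auto
    show "AE t in lborel. \<exists>l\<ge>0. (\<lambda>n. d n t) \<longlonglongrightarrow> l"
      using lim ab0
    proof eventually_elim
      case (elim t)
      show ?case
      proof (cases "t \<in> {a<..<b}")
        case True
        then obtain l where l: "l \<le> 0" "(\<lambda>n. (F (min b (t + 1 / real (Suc n))) - F t) / (1 / real (Suc n))) \<longlonglongrightarrow> l"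
          using elim by blast
        have "max a (min b (t + 1 / real (Suc n))) = min b (t + 1 / real (Suc n))" "max a (min b t) = t" for n
        proof -
          have "a \<le> t + 1 / real (Suc n)" using True h(1)[of n] unfolding greaterThanLessThan_iff by linarith
          then show "max a (min b (t + 1 / real (Suc n))) = min b (t + 1 / real (Suc n))" "max a (min b t) = t"
            using True by (auto simp: max_def min_def)
        qed
        then have "(\<lambda>n. d n t) = (\<lambda>n. - ((F (min b (t + 1 / real (Suc n))) - F t) / (1 / real (Suc n))))"
          using True by (auto simp: d_def q_def G_def)
        then show ?thesis using l tendsto_minus[OF l(2)] by (intro exI[of _ "- l"]) auto
      next
        case False
        with elim have "t \<notin> {a..b}" by auto
        then show ?thesis by (intro exI[of _ 0]) (auto simp: d_def)
      qed
    qed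
  qed auto
  then obtain J where J: "J \<ge> 0" "(\<lambda>n. \<integral>t. d n t \<partial>lborel) \<longlonglongrightarrow> J" by blast
  have "(\<lambda>n. \<integral>t. d n t \<partial>lborel) \<longlonglongrightarrow> G a - G b"
    unfolding int by (intro tendsto_diff DERIV_sequence P) (use ab in auto)
  with J have "G a - G b \<ge> 0" using LIMSEQ_unique by metis
  then show ?thesis using ab by (simp add: G_def)
qed

lemma diverg_limit:
  fixes Y :: "plane \<Rightarrow> plane"
  assumes "Y differentiable (at x)" "\<rho> \<noteq> 0"
  shows "(\<lambda>n. \<Sum>b\<in>Basis. ((Y (x + (\<rho> / real (Suc n)) *\<^sub>R b) - Y x) \<bullet> b) / (\<rho> / real (Suc n))) \<longlonglongrightarrow> diverg Y x"
  unfolding diverg_def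
proof (rule tendsto_sum)
  fix b :: plane assume "b \<in> Basis"
  have D: "(Y has_derivative frechet_derivative Y (at x)) (at x)" using assms(1) frechet_derivative_works by blast
  have "((\<lambda>s. x + s *\<^sub>R b) has_derivative (\<lambda>s. s *\<^sub>R b)) (at (0::real))"
    by (auto intro!: derivative_eq_intros)
  from has_derivative_compose[OF this, of Y] D
  have "((\<lambda>s. Y (x + s *\<^sub>R b)) has_derivative (\<lambda>s. frechet_derivative Y (at x) (s *\<^sub>R b))) (at 0)" by simp
  then have "((\<lambda>s. Y (x + s *\<^sub>R b) \<bullet> b) has_derivative (\<lambda>s. frechet_derivative Y (at x) (s *\<^sub>R b) \<bullet> b)) (at 0)"
    by (rule has_derivative_inner_left)
  moreover have "frechet_derivative Y (at x) (s *\<^sub>R b) \<bullet> b = (frechet_derivative Y (at x) b \<bullet> b) * s" for s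
    using linear_scale[OF linear_frechet_derivative[OF assms(1)]] by simp
  ultimately have "((\<lambda>s. Y (x + s *\<^sub>R b) \<bullet> b) has_real_derivative frechet_derivative Y (at x) b \<bullet> b) (at 0)"
    by (simp add: has_field_derivative_def)
  from DERIV_sequence[OF this assms(2)]
  show "(\<lambda>n. ((Y (x + (\<rho> / real (Suc n)) *\<^sub>R b) - Y x) \<bullet> b) / (\<rho> / real (Suc n)))
      \<longlonglongrightarrow> frechet_derivative Y (at x) b \<bullet> b" by (simp add: inner_diff_left)
qed

lemma GDERIV_lipschitz:
  fixes f :: "plane \<Rightarrow> real"
  assumes "\<And>x. GDERIV f x :> g x" "\<And>x. norm (g x) \<le> B"
  shows "\<bar>f x - f y\<bar> \<le> B * norm (x - y)"
proof -
  have "norm (f x - f y) \<le> B * norm (x - y)"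
  proof (rule differentiable_bound[where S=UNIV and f'="\<lambda>x h. h \<bullet> g x"])
    show "(f has_derivative (\<lambda>h. h \<bullet> g x)) (at x within UNIV)" for x
      using assms(1) by (simp add: gderiv_def)
    show "onorm (\<lambda>h. h \<bullet> g x) \<le> B" for x
    proof (rule onorm_le)
      fix h show "norm (h \<bullet> g x) \<le> B * norm h"
        using Cauchy_Schwarz_ineq2[of h "g x"] mult_left_mono[OF assms(2)[of x] norm_ge_zero[of h]]
        by (simp add: mult.commute)
    qed
  qed auto
  then show ?thesis by simp
qed

text \<open>
  Integration by parts for \<open>f\<close> and \<open>div Y\<close>, in the form of the inequality \<open>\<integral> f div Y \<le> 0\<close>. Both sides
  are limits of difference quotients, so only Lipschitz bounds and translation invariance enter.
\<close>

lemma divergence_limit: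
  fixes f :: "plane \<Rightarrow> real" and Y g :: "plane \<Rightarrow> plane" and A :: "nat \<Rightarrow> plane \<Rightarrow> real"
  assumes f: "\<And>x. GDERIV f x :> g x" "\<And>x. norm (g x) \<le> B" "\<And>x. x \<notin> S \<Longrightarrow> f x = 0"
    and S: "compact S" "open V" "S \<subseteq> V"
    and Y: "L-lipschitz_on V Y" and mono: "\<And>x. x \<in> V \<Longrightarrow> g x \<bullet> Y x \<ge> 0"
    and meas: "\<And>n. A n \<in> borel_measurable borel"
    and bound: "\<And>n x. x \<in> S \<Longrightarrow> \<bar>A n x\<bar> \<le> M" and zero: "\<And>n x. x \<notin> S \<Longrightarrow> A n x = 0"
    and lim: "AE x in lborel. (f x \<noteq> 0 \<longrightarrow> Y differentiable (at x)) \<and> (\<exists>l. (\<lambda>n. A n x) \<longlonglongrightarrow> l \<and> l \<le> f x * diverg Y x)"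
  shows "\<exists>J\<le>0. (\<lambda>n. \<integral>x. A n x \<partial>lborel) \<longlonglongrightarrow> J"
proof -
  obtain \<rho> where \<rho>: "\<rho> > 0" "(\<Union>x\<in>S. cball x \<rho>) \<subseteq> V"
    using compact_subset_open_imp_cball_epsilon_subset[OF S] by metis
  \<comment> \<open>A closed \<rho>-neighbourhood of \<open>S\<close> inside \<open>V\<close>:
    translating a point of \<open>S\<close> by at most \<rho> along a coordinate axis does not leave
    it.\<close>
  define S' where "S' = {x + y |x y. x \<in> S \<and> y \<in> cball 0 \<rho>}"
  have S'c: "compact S'" unfolding S'_def by (rule compact_sums[OF S(1) compact_cball])
  have S'I: "x \<in> S'" if "z \<in> S" "norm (x - z) \<le> \<rho>" for x z
    unfolding S'_def using that by (intro CollectI exI[of _ z] exI[of _ "x - z"]) auto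
  have SS': "S \<subseteq> S'" using S'I \<rho>(1) by fastforce
  have S'V: "S' \<subseteq> V"
  proof
    fix x assume "x \<in> S'"
    then obtain z y where "x = z + y" "z \<in> S" "norm y \<le> \<rho>" by (auto simp: S'_def)
    then have "x \<in> cball z \<rho>" by (simp add: dist_norm)
    then show "x \<in> V" using \<rho>(2) \<open>z \<in> S\<close> by blast
  qed
  have Yc: "continuous_on S' Y"
    by (rule continuous_on_subset[OF lipschitz_on_continuous_on[OF Y] S'V])
  \<comment> \<open>The jumps created by this cutoff are harmless. The quotients of
    \<open>Y0\<close> are multiplied by \<open>f\<close>, which vanishes off \<open>S\<close>, and
    from \<open>S\<close> the translations stay in \<open>S'\<close>.\<close>
  define Y0 where "Y0 = (\<lambda>x. indicator S' x *\<^sub>R Y x)"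
  have Y0m: "Y0 \<in> borel_measurable borel"
    unfolding Y0_def by (rule borel_measurable_continuous_on_indicator[OF _ Yc]) (use S'c in \<open>simp add: compact_imp_closed borel_closed\<close>)
  have "bounded (Y ` S')" by (rule compact_imp_bounded[OF compact_continuous_image[OF Yc S'c]])
  then obtain K where K: "K > 0" "\<And>x. x \<in> S' \<Longrightarrow> norm (Y x) \<le> K" by (auto simp: bounded_pos)
  have K0: "norm (Y0 x) \<le> K" for x using K by (auto simp: Y0_def indicator_def)
  have flip: "\<bar>f x - f y\<bar> \<le> B * norm (x - y)" for x y by (rule GDERIV_lipschitz[OF f(1,2)])
  have B: "B \<ge> 0" using f(2)[of 0] norm_ge_zero order_trans by blast
  have L: "L \<ge> 0" by (rule lipschitz_on_nonneg[OF Y])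
  have fc: "continuous_on UNIV f"
    by (rule lipschitz_on_continuous_on[of B], rule lipschitz_onI) (use flip B in \<open>auto simp: dist_norm\<close>)
  have fm: "f \<in> borel_measurable borel" by (rule borel_measurable_continuous_onI[OF fc])
  have "bounded (f ` S)" by (intro compact_imp_bounded compact_continuous_image continuous_on_subset[OF fc] S) auto
  then obtain Mf where Mf: "Mf > 0" "\<And>x. x \<in> S \<Longrightarrow> \<bar>f x\<bar> \<le> Mf" by (auto simp: bounded_pos)
  define h where "h = (\<lambda>n. \<rho> / real (Suc n))"
  have h: "h n > 0" "h n \<le> \<rho>" for n using \<rho>(1) by (auto simp: h_def divide_le_eq)
  \<comment> \<open>Discrete integration by parts: \<open>Bn\<close> puts the forward difference on
    the field, \<open>Cn\<close> the backward difference on \<open>f\<close>. Translation invariance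
    makes their integrals equal.\<close>
  define Bn where "Bn = (\<lambda>n x. \<Sum>b\<in>Basis. f x * ((Y0 (x + h n *\<^sub>R b) - Y0 x) \<bullet> b) / h n)"
  define Cn where "Cn = (\<lambda>n x. \<Sum>b\<in>Basis. (f (x - h n *\<^sub>R b) - f x) * (Y0 x \<bullet> b) / h n)"
  have Bm: "Bn n \<in> borel_measurable borel" and Cm: "Cn n \<in> borel_measurable borel" for n
    using Y0m fm unfolding Bn_def Cn_def by measurable
  have move: "x + h n *\<^sub>R b \<in> S'" if "x \<in> S" "b \<in> Basis" for x b n
    using h[of n] that by (auto intro!: S'I[OF that(1)])
  have Bb: "\<bar>Bn n x\<bar> \<le> DIM(plane) * (Mf * L)" if "x \<in> S" for n x
  proof -
    have "\<bar>f x * ((Y0 (x + h n *\<^sub>R b) - Y0 x) \<bullet> b) / h n\<bar> \<le> Mf * L" if b: "b \<in> Basis" for b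
    proof -
      have "norm (Y0 (x + h n *\<^sub>R b) - Y0 x) \<le> L * h n"
        using lipschitz_onD[OF Y, of "x + h n *\<^sub>R b" x] move[OF \<open>x \<in> S\<close> b, of n] subsetD[OF SS' \<open>x \<in> S\<close>] S'V b h(1)[of n]
        by (auto simp: Y0_def dist_norm)
      then have "\<bar>(Y0 (x + h n *\<^sub>R b) - Y0 x) \<bullet> b\<bar> \<le> L * h n"
        using Basis_le_norm[OF b] order_trans by blast
      then have "\<bar>f x\<bar> * \<bar>(Y0 (x + h n *\<^sub>R b) - Y0 x) \<bullet> b\<bar> \<le> Mf * (L * h n)"
        using Mf \<open>x \<in> S\<close> by (intro mult_mono) auto
      then show ?thesis using h(1)[of n] by (simp add: abs_mult divide_le_eq mult.assoc)
    qed
    then show ?thesis unfolding Bn_def by (intro order_trans[OF sum_abs] sum_bounded_above) auto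
  qed
  have Bz: "Bn n x = 0" if "x \<notin> S" for n x using f(3)[OF that] by (simp add: Bn_def)
  have Cb: "\<bar>Cn n x\<bar> \<le> DIM(plane) * (B * K)" for n x
  proof -
    have "\<bar>(f (x - h n *\<^sub>R b) - f x) * (Y0 x \<bullet> b) / h n\<bar> \<le> B * K" if b: "b \<in> Basis" for b
    proof -
      have "\<bar>f (x - h n *\<^sub>R b) - f x\<bar> \<le> B * h n" using flip[of "x - h n *\<^sub>R b" x] h(1)[of n] b by simp
      moreover have "\<bar>Y0 x \<bullet> b\<bar> \<le> K" using Basis_le_norm[OF b, of "Y0 x"] K0[of x] by linarith
      ultimately have "\<bar>f (x - h n *\<^sub>R b) - f x\<bar> * \<bar>Y0 x \<bullet> b\<bar> \<le> (B * h n) * K"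
        using B h(1)[of n] by (intro mult_mono) auto
      then show ?thesis using h(1)[of n] by (simp add: abs_mult divide_le_eq mult_ac)
    qed
    then show ?thesis unfolding Cn_def by (intro order_trans[OF sum_abs] sum_bounded_above) auto
  qed
  have Cz: "Cn n x = 0" if "x \<notin> S'" for n x using that by (simp add: Cn_def Y0_def)
  have int: "integrable lborel u" if "u \<in> borel_measurable borel" "\<And>x. \<bar>u x\<bar> \<le> c" "\<And>x. x \<notin> S' \<Longrightarrow> u x = 0" for u :: "plane \<Rightarrow> real" and c
  proof (rule Bochner_Integration.integrable_bound)
    show "integrable lborel (\<lambda>x. indicator S' x *\<^sub>R c)" by (rule borel_integrable_compact[OF S'c]) simp
    show "AE x in lborel. norm (u x) \<le> norm (indicator S' x *\<^sub>R c)"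
    proof (rule AE_I2)
      fix x show "norm (u x) \<le> norm (indicator S' x *\<^sub>R c)"
        using that(2)[of x] that(3)[of x] by (cases "x \<in> S'") auto
    qed
  qed (use that in simp)
  have eq: "(\<integral>x. Bn n x \<partial>lborel) = (\<integral>x. Cn n x \<partial>lborel)" for n
  proof -
    have fb: "\<bar>f x\<bar> \<le> Mf" for x using Mf f(3)[of x] by (cases "x \<in> S") auto
    have Yb: "\<bar>Y0 x \<bullet> b\<bar> \<le> K" if "b \<in> Basis" for x b using Basis_le_norm[OF that, of "Y0 x"] K0[of x] by linarith
    have i1: "integrable lborel (\<lambda>x. f x * (Y0 (x + a) \<bullet> b))" if b: "b \<in> Basis" for a b
    proof (rule int[where c="Mf * K"])
      show "(\<lambda>x. f x * (Y0 (x + a) \<bullet> b)) \<in> borel_measurable borel" using Y0m fm by measurable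
      show "\<bar>f x * (Y0 (x + a) \<bullet> b)\<bar> \<le> Mf * K" for x
        unfolding abs_mult using fb Yb[OF b] Mf(1) by (intro mult_mono) auto
      show "f x * (Y0 (x + a) \<bullet> b) = 0" if "x \<notin> S'" for x using f(3) SS' that by auto
    qed
    have i2: "integrable lborel (\<lambda>x. f (x - a) * (Y0 x \<bullet> b))" if b: "b \<in> Basis" for a b
    proof (rule int[where c="Mf * K"])
      show "(\<lambda>x. f (x - a) * (Y0 x \<bullet> b)) \<in> borel_measurable borel" using Y0m fm by measurable
      show "\<bar>f (x - a) * (Y0 x \<bullet> b)\<bar> \<le> Mf * K" for x
        unfolding abs_mult using fb Yb[OF b] Mf(1) by (intro mult_mono) auto
      show "f (x - a) * (Y0 x \<bullet> b) = 0" if "x \<notin> S'" for x using that by (simp add: Y0_def)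
    qed
    have tr: "(\<integral>x. f x * (Y0 (x + a) \<bullet> b) \<partial>lborel) = (\<integral>x. f (x - a) * (Y0 x \<bullet> b) \<partial>lborel)" for a b
    proof -
      have "(\<lambda>x. f (x - a) * (Y0 x \<bullet> b)) \<in> borel_measurable borel" using Y0m fm by measurable
      from integral_translate_lborel[OF this, of a] show ?thesis by simp
    qed
    have "(\<integral>x. Bn n x \<partial>lborel) = (\<Sum>b\<in>Basis. ((\<integral>x. f x * (Y0 (x + h n *\<^sub>R b) \<bullet> b) \<partial>lborel) - (\<integral>x. f x * (Y0 (x + 0) \<bullet> b) \<partial>lborel)) / h n)"
      unfolding Bn_def inner_diff_left right_diff_distrib
      using i1 i1[of _ 0] by (subst Bochner_Integration.integral_sum) (auto intro!: sum.cong)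
    also have "\<dots> = (\<Sum>b\<in>Basis. ((\<integral>x. f (x - h n *\<^sub>R b) * (Y0 x \<bullet> b) \<partial>lborel) - (\<integral>x. f (x - 0) * (Y0 x \<bullet> b) \<partial>lborel)) / h n)"
      unfolding tr ..
    also have "\<dots> = (\<integral>x. Cn n x \<partial>lborel)"
      unfolding Cn_def left_diff_distrib
      using i2 i2[of _ 0] by (subst Bochner_Integration.integral_sum) (auto intro!: sum.cong)
    finally show ?thesis .
  qed
  have Blim: "(\<lambda>n. Bn n x) \<longlonglongrightarrow> f x * diverg Y x" if "f x \<noteq> 0 \<longrightarrow> Y differentiable (at x)" for x
  proof (cases "f x = 0")
    case False
    then have x: "x \<in> S" "Y differentiable (at x)" using that f(3) by auto
    have "Bn n x = f x * (\<Sum>b\<in>Basis. ((Y (x + h n *\<^sub>R b) - Y x) \<bullet> b) / h n)" for n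
      unfolding Bn_def sum_distrib_left using move[OF x(1)] x(1) SS' by (intro sum.cong) (auto simp: Y0_def)
    then show ?thesis using tendsto_mult_left[OF diverg_limit[OF x(2), of \<rho>]] \<rho>(1) by (simp add: h_def)
  qed (simp add: Bn_def)
  have Clim: "(\<lambda>n. Cn n x) \<longlonglongrightarrow> - (g x \<bullet> Y0 x)" for x
  proof -
    have "(\<lambda>n. (f (x - h n *\<^sub>R b) - f x) * (Y0 x \<bullet> b) / h n) \<longlonglongrightarrow> - (g x \<bullet> b) * (Y0 x \<bullet> b)" for b
    proof -
      have "filterlim h (at 0) sequentially" unfolding h_def by (rule LIMSEQ_recip_filterlim_at_0) (use \<rho> in simp)
      from filterlim_compose[OF GDERIV_line[OF f(1), of x "- b"] this]
      have "(\<lambda>n. (f (x + h n *\<^sub>R (- b)) - f x) / h n) \<longlonglongrightarrow> g x \<bullet> (- b)" .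
      from tendsto_mult_right[OF this, of "Y0 x \<bullet> b"] show ?thesis by simp
    qed
    then have "(\<lambda>n. Cn n x) \<longlonglongrightarrow> (\<Sum>b\<in>Basis. - (g x \<bullet> b) * (Y0 x \<bullet> b))"
      unfolding Cn_def by (intro tendsto_sum)
    then show ?thesis unfolding euclidean_inner[of "g x" "Y0 x"] by (simp add: sum_negf)
  qed
  have gY: "g x \<bullet> Y0 x \<ge> 0" for x using mono[of x] S'V by (auto simp: Y0_def indicator_def)
  \<comment> \<open>The pointwise limit is \<open>f x * diverg Y x + g x \<bullet> Y0 x\<close>
    minus the limit of \<open>A\<close>, and both the sign of the flux term and the bound on
    \<open>A\<close> make it nonnegative. In the integral \<open>Bn\<close> and \<open>Cn\<close>
    cancel, leaving minus the integral of \<open>A\<close>.\<close>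
  let ?d = "\<lambda>n x. Bn n x - Cn n x - A n x"
  have "\<exists>J\<ge>0. (\<lambda>n. \<integral>x. ?d n x \<partial>lborel) \<longlonglongrightarrow> J"
  proof (rule bounded_limit_integral_nonneg[OF _ S'c])
    show "?d n \<in> borel_measurable borel" for n using Bm Cm meas by measurable
    show "\<bar>?d n x\<bar> \<le> (DIM(plane) * (Mf * L)) + (DIM(plane) * (B * K)) + \<bar>M\<bar>" if "x \<in> S'" for n x
    proof -
      have "\<bar>Bn n x\<bar> \<le> DIM(plane) * (Mf * L)" using Bb Bz Mf L by (cases "x \<in> S") auto
      moreover have "\<bar>A n x\<bar> \<le> \<bar>M\<bar>" using bound[of x n] zero[of x n] by (cases "x \<in> S") auto
      ultimately show ?thesis using Cb[of n x] by linarith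
    qed
    show "?d n x = 0" if "x \<notin> S'" for n x
    proof -
      have "x \<notin> S" using that SS' by blast
      then show ?thesis using Bz Cz[OF that] zero by simp
    qed
    show "AE x in lborel. \<exists>l\<ge>0. (\<lambda>n. ?d n x) \<longlonglongrightarrow> l"
      using lim
    proof eventually_elim
      case (elim x)
      then obtain l where l: "(\<lambda>n. A n x) \<longlonglongrightarrow> l" "l \<le> f x * diverg Y x" by blast
      have "(\<lambda>n. ?d n x) \<longlonglongrightarrow> f x * diverg Y x - - (g x \<bullet> Y0 x) - l"
        using elim by (intro tendsto_diff Blim Clim l) auto
      moreover have "f x * diverg Y x - - (g x \<bullet> Y0 x) - l \<ge> 0" using gY[of x] l(2) by simp
      ultimately show ?case by blast
    qed
  qed
  then obtain J where J: "J \<ge> 0" "(\<lambda>n. \<integral>x. ?d n x \<partial>lborel) \<longlonglongrightarrow> J" by blast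
  have "(\<integral>x. ?d n x \<partial>lborel) = - (\<integral>x. A n x \<partial>lborel)" for n
  proof -
    have "integrable lborel (Bn n)"
    proof (rule int[OF Bm, where c="DIM(plane) * (Mf * L)"])
      show "\<bar>Bn n x\<bar> \<le> DIM(plane) * (Mf * L)" for x using Bb Bz Mf L by (cases "x \<in> S") auto
      show "Bn n x = 0" if "x \<notin> S'" for x using Bz SS' that by blast
    qed
    moreover have "integrable lborel (Cn n)" by (rule int[OF Cm Cb Cz])
    moreover have "integrable lborel (A n)"
    proof (rule int[OF meas, where c="\<bar>M\<bar>"])
      show "\<bar>A n x\<bar> \<le> \<bar>M\<bar>" for x using bound[of x n] zero[of x n] by (cases "x \<in> S") auto
    qed (use zero SS' in auto)
    ultimately show ?thesis by (simp add: eq)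
  qed
  with J show ?thesis using tendsto_minus[OF J(2)] by (intro exI[of _ "- J"]) auto
qed

text \<open>The differential inequality is required only where \<open>W\<close> is nonzero. The
  vector field \<open>g\<close> is the gradient of the test function \<open>W\<^sup>2\<close>, so
  the sign of \<open>g x \<bullet> Y x\<close> is what makes the divergence term dissipative after
  integration by parts.\<close>

definition parabolic_subsolution :: "plane set \<Rightarrow> (real \<Rightarrow> plane \<Rightarrow> real) \<Rightarrow> real \<Rightarrow> bool" where
  "parabolic_subsolution V W t \<longleftrightarrow> (\<exists>g Y B K. (\<forall>x. GDERIV (\<lambda>x. (W t x)\<^sup>2) x :> g x) \<and>
       (\<forall>x. norm (g x) \<le> B) \<and> K-lipschitz_on V Y \<and> (\<forall>x\<in>V. g x \<bullet> Y x \<ge> 0) \<and>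
       (AE x in lborel. W t x \<noteq> 0 \<longrightarrow> Y differentiable (at x) \<and>
          (\<exists>D. ((\<lambda>s. W s x) has_real_derivative D) (at t) \<and> D \<le> diverg Y x)))"

text \<open>
  \<open>W\<close> plays the role of the positive part of a subsolution of a parabolic equation with flux \<open>Y\<close>. The
  energy is \<open>\<integral> W\<^sup>3\<close> rather than \<open>\<integral> W\<^sup>2\<close> because the resulting test function \<open>W\<^sup>2\<close> is differentiable.
\<close>

lemma energy_zero:
  fixes W :: "real \<Rightarrow> plane \<Rightarrow> real"
  assumes ab: "a < b" and S: "compact S" "open V" "S \<subseteq> V"
    and W: "\<And>t x. t \<in> {a..b} \<Longrightarrow> W t x \<ge> 0" "\<And>t x. t \<in> {a..b} \<Longrightarrow> x \<notin> S \<Longrightarrow> W t x = 0"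
    and bound: "\<And>t x. t \<in> {a..b} \<Longrightarrow> W t x \<le> M"
    and cont: "\<And>t. t \<in> {a..b} \<Longrightarrow> continuous_on UNIV (W t)"
    and lip: "\<And>s t x. s \<in> {a..b} \<Longrightarrow> t \<in> {a..b} \<Longrightarrow> \<bar>W s x - W t x\<bar> \<le> L * \<bar>s - t\<bar>"
    and eqn: "AE t in lborel. t \<in> {a<..<b} \<longrightarrow> parabolic_subsolution V W t"
    and init: "\<And>x. W a x = 0"
  shows "W b x = 0"
proof -
  define F where "F = (\<lambda>t. \<integral>x. (W t x) ^ 3 \<partial>lborel)"
  have L: "L \<ge> 0" using lip[of a b undefined] ab by (smt (verit) atLeastAtMost_iff zero_le_mult_iff)
  have M: "M \<ge> 0" using W(1)[of a undefined] bound[of a undefined] ab by simp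
  have c3: "continuous_on UNIV (\<lambda>x. (W t x) ^ 3)" if "t \<in> {a..b}" for t by (intro continuous_intros cont that)
  have i3: "integrable lborel (\<lambda>x. (W t x) ^ 3)" if "t \<in> {a..b}" for t
    by (rule continuous_compact_support_integrable[OF c3[OF that] S(1)]) (use W(2)[OF that] in simp)
  have cube: "\<bar>u ^ 3 - v ^ 3\<bar> \<le> 3 * M\<^sup>2 * \<bar>u - v\<bar>" if "0 \<le> u" "u \<le> M" "0 \<le> v" "v \<le> M" for u v :: real
  proof -
    have "u\<^sup>2 + u * v + v\<^sup>2 \<le> M * M + M * M + M * M"
      unfolding power2_eq_square using that by (intro add_mono mult_mono) auto
    moreover have "u ^ 3 - v ^ 3 = (u\<^sup>2 + u * v + v\<^sup>2) * (u - v)"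
      by (simp add: power2_eq_square power3_eq_cube algebra_simps)
    moreover have "u\<^sup>2 + u * v + v\<^sup>2 \<ge> 0" using that by simp
    ultimately show ?thesis by (auto simp: abs_mult power2_eq_square intro!: mult_right_mono)
  qed
  have lip3: "\<bar>(W s x) ^ 3 - (W t x) ^ 3\<bar> \<le> 3 * M\<^sup>2 * L * \<bar>s - t\<bar>" if "s \<in> {a..b}" "t \<in> {a..b}" for s t x
  proof -
    have "\<bar>(W s x) ^ 3 - (W t x) ^ 3\<bar> \<le> 3 * M\<^sup>2 * \<bar>W s x - W t x\<bar>" by (intro cube W bound that)
    also have "\<dots> \<le> 3 * M\<^sup>2 * (L * \<bar>s - t\<bar>)" by (intro mult_left_mono lip that) simp
    finally show ?thesis by (simp add: mult.assoc)
  qed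
  define c where "c = (\<integral>x. indicator S x *\<^sub>R (1::real) \<partial>lborel)"
  have iS: "integrable lborel (\<lambda>x. indicator S x *\<^sub>R (1::real))" by (rule borel_integrable_compact[OF S(1)]) simp
  have Flip: "\<bar>F s - F t\<bar> \<le> (3 * M\<^sup>2 * L * c) * \<bar>s - t\<bar>" if "s \<in> {a..b}" "t \<in> {a..b}" for s t
  proof -
    have "F s - F t = (\<integral>x. (W s x) ^ 3 - (W t x) ^ 3 \<partial>lborel)"
      unfolding F_def by (subst Bochner_Integration.integral_diff) (use i3 that in auto)
    also have "\<bar>\<dots>\<bar> \<le> (\<integral>x. \<bar>(W s x) ^ 3 - (W t x) ^ 3\<bar> \<partial>lborel)" by (rule integral_abs_bound)
    also have "\<dots> \<le> (\<integral>x. (3 * M\<^sup>2 * L * \<bar>s - t\<bar>) * (indicator S x *\<^sub>R 1) \<partial>lborel)"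
    proof (rule integral_mono)
      show "integrable lborel (\<lambda>x. \<bar>(W s x) ^ 3 - (W t x) ^ 3\<bar>)" by (intro integrable_abs Bochner_Integration.integrable_diff i3 that)
      show "integrable lborel (\<lambda>x. (3 * M\<^sup>2 * L * \<bar>s - t\<bar>) * (indicator S x *\<^sub>R 1))" by (intro integrable_mult_right iS)
      show "\<bar>(W s x) ^ 3 - (W t x) ^ 3\<bar> \<le> (3 * M\<^sup>2 * L * \<bar>s - t\<bar>) * (indicator S x *\<^sub>R 1)" for x
        using lip3[OF that, of x] W(2)[OF that(1), of x] W(2)[OF that(2), of x] by (cases "x \<in> S") auto
    qed
    also have "\<dots> = (3 * M\<^sup>2 * L * c) * \<bar>s - t\<bar>"
      unfolding c_def by (subst integral_mult_right_zero) (simp add: mult_ac)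
    finally show ?thesis .
  qed
  have "F b \<le> F a"
  proof (rule lipschitz_nonincreasing[OF ab Flip])
    let ?q = "\<lambda>t n. (F (min b (t + 1 / real (Suc n))) - F t) / (1 / real (Suc n))"
    show "AE t in lborel. t \<in> {a<..<b} \<longrightarrow> (\<exists>l\<le>0. ?q t \<longlonglongrightarrow> l)"
      using eqn
    proof (eventually_elim, intro impI)
      fix t assume t: "t \<in> {a<..<b}" and "t \<in> {a<..<b} \<longrightarrow> parabolic_subsolution V W t"
      then obtain g Y B K where g: "\<And>x. GDERIV (\<lambda>x. (W t x)\<^sup>2) x :> g x" "\<And>x. norm (g x) \<le> B"
        and Y: "K-lipschitz_on V Y" "\<And>x. x \<in> V \<Longrightarrow> g x \<bullet> Y x \<ge> 0"
        and ae: "AE x in lborel. W t x \<noteq> 0 \<longrightarrow> Y differentiable (at x) \<and>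
          (\<exists>D. ((\<lambda>s. W s x) has_real_derivative D) (at t) \<and> D \<le> diverg Y x)"
        unfolding parabolic_subsolution_def by blast
      have tab: "t \<in> {a..b}" using t by auto
      define h where "h = (\<lambda>n. 1 / real (Suc n))"
      define \<tau> where "\<tau> = (\<lambda>n. min b (t + h n))"
      have h: "h n > 0" for n by (simp add: h_def)
      have \<tau>: "\<tau> n \<in> {a..b}" "\<bar>\<tau> n - t\<bar> \<le> h n" for n using t h[of n] by (auto simp: \<tau>_def min_def)
      \<comment> \<open>The factor 1/3 makes the limit \<open>(W t x)\<^sup>2\<close> times the time
        derivative of \<open>W\<close>, which is the test function times the equation.\<close>
      define A where "A = (\<lambda>n x. ((W (\<tau> n) x) ^ 3 - (W t x) ^ 3) / h n / 3)"
      have hlim: "h \<longlonglongrightarrow> 0" unfolding h_def by (rule LIMSEQ_Suc[OF lim_1_over_n])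
      have ev: "\<forall>\<^sub>F n in sequentially. \<tau> n = t + h n"
      proof -
        have "\<forall>\<^sub>F n in sequentially. h n < b - t" using order_tendstoD(2)[OF hlim, of "b - t"] t by simp
        then show ?thesis by eventually_elim (simp add: \<tau>_def)
      qed
      have "\<exists>J\<le>0. (\<lambda>n. \<integral>x. A n x \<partial>lborel) \<longlonglongrightarrow> J"
      proof (rule divergence_limit[OF g _ S Y])
        show "(W t x)\<^sup>2 = 0" if "x \<notin> S" for x using W(2)[OF tab that] by simp
        show "A n \<in> borel_measurable borel" for n
        proof (rule borel_measurable_continuous_onI)
          show "continuous_on UNIV (A n)" unfolding A_def using h[of n] by (intro continuous_intros cont \<tau> tab) auto
        qed
        show "\<bar>A n x\<bar> \<le> M\<^sup>2 * L" for n x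
        proof -
          have "\<bar>(W (\<tau> n) x) ^ 3 - (W t x) ^ 3\<bar> \<le> 3 * M\<^sup>2 * L * \<bar>\<tau> n - t\<bar>" by (rule lip3[OF \<tau>(1) tab])
          also have "\<dots> \<le> 3 * M\<^sup>2 * L * h n" using \<tau>(2)[of n] L by (intro mult_left_mono) auto
          finally show ?thesis using h[of n] by (simp add: A_def divide_le_eq mult_ac)
        qed
        show "A n x = 0" if "x \<notin> S" for n x using W(2)[OF tab that] W(2)[OF \<tau>(1) that] by (simp add: A_def)
        show "AE x in lborel. ((W t x)\<^sup>2 \<noteq> 0 \<longrightarrow> Y differentiable (at x)) \<and>
            (\<exists>l. (\<lambda>n. A n x) \<longlonglongrightarrow> l \<and> l \<le> (W t x)\<^sup>2 * diverg Y x)"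
          using ae
        proof eventually_elim
          case (elim x)
          show ?case
          proof (cases "W t x = 0")
            \<comment> \<open>Where \<open>W\<close> vanishes nothing is known about its time
              derivative, but the Lipschitz bound in time makes the cube of order h^3, so its
              difference quotient still tends to 0.\<close>
            case True
            have "(\<lambda>n. A n x) \<longlonglongrightarrow> 0"
            proof (rule Lim_null_comparison)
              show "\<forall>\<^sub>F n in sequentially. norm (A n x) \<le> L ^ 3 * (h n)\<^sup>2"
              proof (intro always_eventually allI)
                fix n
                have "W (\<tau> n) x \<le> L * h n"
                  using lip[OF \<tau>(1) tab, of n x] True mult_left_mono[OF \<tau>(2)[of n] L] by simp
                then have "(W (\<tau> n) x) ^ 3 \<le> (L * h n) ^ 3" using W(1)[OF \<tau>(1)] by (intro power_mono)
                moreover have "(W (\<tau> n) x) ^ 3 \<ge> 0" using W(1)[OF \<tau>(1)] by simp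
                ultimately have "(W (\<tau> n) x) ^ 3 / 3 \<le> (L * h n) ^ 3" by linarith
                moreover have "norm (A n x) = (W (\<tau> n) x) ^ 3 / 3 / h n"
                  using h[of n] True W(1)[OF \<tau>(1)] by (simp add: A_def)
                ultimately have "norm (A n x) \<le> (L * h n) ^ 3 / h n"
                  using h[of n] by (metis divide_right_mono less_imp_le)
                then show "norm (A n x) \<le> L ^ 3 * (h n)\<^sup>2" using h[of n]
                  by (simp add: power_mult_distrib power2_eq_square power3_eq_cube mult_ac)
              qed
              have "(\<lambda>n. L ^ 3 * (h n)\<^sup>2) \<longlonglongrightarrow> L ^ 3 * 0\<^sup>2" by (intro tendsto_intros hlim)
              then show "(\<lambda>n. L ^ 3 * (h n)\<^sup>2) \<longlonglongrightarrow> 0" by simp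
            qed
            then show ?thesis using True by auto
          next
            case False
            then obtain D where D: "((\<lambda>s. W s x) has_real_derivative D) (at t)" "D \<le> diverg Y x" using elim by blast
            have "((\<lambda>s. (W s x) ^ 3 / 3) has_real_derivative (W t x)\<^sup>2 * D) (at t)"
              by (rule DERIV_cong[OF DERIV_cdivide[OF DERIV_power[OF D(1), of 3]]]) simp
            from DERIV_sequence[OF this, of 1]
            have "(\<lambda>n. ((W (t + h n) x) ^ 3 / 3 - (W t x) ^ 3 / 3) / h n) \<longlonglongrightarrow> (W t x)\<^sup>2 * D" by (simp add: h_def)
            then have "(\<lambda>n. A n x) \<longlonglongrightarrow> (W t x)\<^sup>2 * D"
              by (rule Lim_transform_eventually) (use ev in \<open>eventually_elim, simp add: A_def diff_divide_distrib mult.commute\<close>)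
            then show ?thesis using D(2) elim False by (auto intro!: mult_left_mono)
          qed
        qed
      qed
      then obtain J where J: "J \<le> 0" "(\<lambda>n. \<integral>x. A n x \<partial>lborel) \<longlonglongrightarrow> J" by blast
      have "?q t n = 3 * (\<integral>x. A n x \<partial>lborel)" for n
      proof -
        have "F (\<tau> n) - F t = (\<integral>x. (W (\<tau> n) x) ^ 3 - (W t x) ^ 3 \<partial>lborel)"
          unfolding F_def by (subst Bochner_Integration.integral_diff) (use i3 \<tau> tab in auto)
        then show ?thesis unfolding A_def by (simp add: \<tau>_def h_def)
      qed
      then have "?q t \<longlonglongrightarrow> 3 * J"
        using tendsto_mult_left[OF J(2), of 3] by simp
      then show "\<exists>l\<le>0. ?q t \<longlonglongrightarrow> l"
        using J(1) by (intro exI[of _ "3 * J"]) auto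
    qed
  qed
  also have "F a = 0" by (simp add: F_def init)
  finally have "F b \<le> 0" .
  have bb: "b \<in> {a..b}" using ab by simp
  show ?thesis
  proof (rule ccontr)
    assume "W b x \<noteq> 0"
    then have "(W b x) ^ 3 > 0" using W(1)[OF bb, of x] by simp
    then have "F b > 0" unfolding F_def
      by (intro integral_continuous_pos[OF c3[OF bb] i3[OF bb]]) (use W(1)[OF bb] in auto)
    with \<open>F b \<le> 0\<close> show False by simp
  qed
qed

section \<open>Regular flows\<close>

text \<open>The almost everywhere statements are iterated, time outside and space inside, so that a
  good time can be fixed before any spatial argument. The assumption \<open>ball\<close> is the
  outer Wulff shape condition read at boundary points.\<close>

locale reg_flow = sd_flow +
  fixes G :: "real \<Rightarrow> plane \<Rightarrow> real" and R \<Lambda> C L :: real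
  assumes R: "R > 0" and \<Lambda>: "\<Lambda> > 0"
    and good: "AE t in lborel. t \<in> {0..T} \<longrightarrow>
      (\<forall>x\<in>U. f t differentiable (at x)) \<and> C-lipschitz_on U (grad (f t))"
    and ball: "t \<in> {0..T} \<Longrightarrow> f t y = 0 \<Longrightarrow> \<exists>z. f t z \<ge> R \<and> \<phi> (z - y) \<le> R"
    and lip: "L-lipschitz_on ({0..T} \<times> U) (\<lambda>(t, x). f t x - G t x)"
    and pde: "AE t in lborel. t \<in> {0..T} \<longrightarrow> (AE x in lborel. x \<in> U \<longrightarrow>
      (\<lambda>y. grad (polar \<phi>) (grad (f t) y)) differentiable (at x) \<and>
      (\<exists>D. ((\<lambda>s. f s x - G s x) has_real_derivative D) (at t within {0..T}) \<and>
         \<bar>D - diverg (\<lambda>y. grad (polar \<phi>) (grad (f t) y)) x\<bar> \<le> \<Lambda> * \<bar>f t x\<bar>))"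
begin

lemma outer_ball_flow:
  assumes "t \<in> {0..T}" "f t x \<le> R"
  shows "\<exists>z. f t z \<ge> R \<and> \<phi> (z - x) \<le> R - f t x"
proof (rule outer_ball[OF R _ ball assms])
  show "AE t in lborel. t \<in> {0..T} \<longrightarrow> (\<forall>x\<in>U. f t differentiable at x)"
    using good by eventually_elim auto
qed

context
  fixes t assumes t: "t \<in> {0..T}" and diff: "\<And>x. x \<in> U \<Longrightarrow> f t differentiable (at x)"
    and gl: "C-lipschitz_on U (grad (f t))"
begin

lemma polar_grad_ge: "x \<in> U \<Longrightarrow> polar \<phi> (grad (f t) x) \<ge> 1"
  by (rule sd_grad_polar_ge_open[OF sd[OF t] U(1) diff lipschitz_on_continuous_on[OF gl]])

lemma grad_nonzero: "x \<in> U \<Longrightarrow> grad (f t) x \<noteq> 0"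
  using polar_grad_ge[of x] polar_le_norm[of "grad (f t) x"] by auto

lemma norm_grad_le: assumes "x \<in> U" shows "norm (grad (f t) x) \<le> 1 / c0"
proof -
  let ?g = "grad (f t) x"
  have "?g \<bullet> ?g \<le> norm ?g / c0"
    using sd_grad_inner_le[OF sd[OF t] differentiable_GDERIV[OF diff[OF assms]], of ?g] upper[of ?g] by linarith
  then have "norm ?g * norm ?g \<le> norm ?g * (1 / c0)" by (simp add: dot_square_norm power2_eq_square)
  then show ?thesis by (rule mult_left_le_imp_le) (use grad_nonzero[OF assms] in simp)
qed

lemma normal_eq_dual: "x \<in> U \<Longrightarrow> grad (polar \<phi>) (grad (f t) x) = dual (grad (f t) x)"
  by (rule grad_polar[OF grad_nonzero])

text \<open>The eikonal bound permits \<open>dual_lipschitz\<close> with \<open>m = 1\<close>, which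
  turns the Lipschitz bound on the gradient into one on the anisotropic normal.\<close>

lemma normal_lipschitz: "(8 / c1 * C)-lipschitz_on U (\<lambda>y. grad (polar \<phi>) (grad (f t) y))"
proof (rule lipschitz_onI)
  fix x y assume xy: "x \<in> U" "y \<in> U"
  have "norm (dual (grad (f t) x) - dual (grad (f t) y)) \<le> 8 / (c1 * 1) * norm (grad (f t) x - grad (f t) y)"
    by (rule dual_lipschitz[OF _ polar_grad_ge[OF xy(1)]]) simp
  also have "\<dots> \<le> 8 / (c1 * 1) * (C * dist x y)"
    using lipschitz_onD[OF gl xy] c1 by (intro mult_left_mono) (auto simp: dist_norm)
  finally show "dist (grad (polar \<phi>) (grad (f t) x)) (grad (polar \<phi>) (grad (f t) y)) \<le> 8 / c1 * C * dist x y"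
    by (simp add: normal_eq_dual xy dist_norm)
qed (use c1 lipschitz_on_nonneg[OF gl] in simp)

end

lemma time_lipschitz:
  assumes "s \<in> {0..T}" "t \<in> {0..T}" "x \<in> U"
  shows "\<bar>(f s x - G s x) - (f t x - G t x)\<bar> \<le> L * \<bar>s - t\<bar>"
  using lipschitz_onD[OF lip, of "(s, x)" "(t, x)"] assms by (simp add: dist_Pair_Pair dist_real_def)

lemma L_nonneg: "L \<ge> 0"
  by (rule lipschitz_on_nonneg[OF lip])

lemma strip_bounded: "\<exists>B. \<forall>t\<in>{0..T}. \<forall>x. \<bar>f t x\<bar> \<le> 1 \<longrightarrow> x \<in> cball 0 B"
proof -
  obtain B where B: "\<And>x. x \<in> all_zeros \<Longrightarrow> norm x \<le> B"
    using compact_imp_bounded[OF compact_all_zeros] by (auto simp: bounded_iff)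
  have "norm x \<le> B + 1 / c0" if "t \<in> {0..T}" "\<bar>f t x\<bar> \<le> 1" for t x
  proof -
    have "zero_set t \<subseteq> all_zeros" using that(1) unfolding all_zeros_def by blast
    then have "zero_set t \<subseteq> cball 0 B" using B by auto
    from zero_growth[OF that(1) this, of x] that(2) have "c0 * (norm x - B) \<le> 1" by simp
    then show ?thesis using c0 by (simp add: field_simps)
  qed
  then show ?thesis by (intro exI[of _ "B + 1 / c0"]) auto
qed

end

lemma AE_lebesgue_on_lborel:
  fixes S :: "'a::euclidean_space set"
  assumes "S \<in> sets borel"
  shows "(AE x in lebesgue_on S. P x) \<longleftrightarrow> (AE x in lborel. x \<in> S \<longrightarrow> P x)"
proof -
  have "S \<in> sets lebesgue" using assms by simp
  then show ?thesis by (simp add: AE_restrict_space_iff AE_completion_iff)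
qed

lemma (in elliptic_norm) regular_flow_reg_flow:
  assumes rf: "regular_flow \<phi> G E0 T E" and cpt: "compact (frontier E0)"
  defines "f \<equiv> \<lambda>t x. real_of_ereal (sdist \<phi> (E t) x)"
  shows "(\<exists>U R \<Lambda> C L. reg_flow \<phi> c0 c1 T U f G R \<Lambda> C L) \<and> (\<forall>t\<in>{0..T}. \<forall>x. f t x \<le> 0 \<longleftrightarrow> x \<in> E t)"
proof -
  have T: "T > 0" and E0: "E 0 = E0" and cl: "\<And>t. t \<in> {0..T} \<Longrightarrow> closed (E t)"
    using rf by (auto simp: regular_flow_def)
  let ?pde = "\<lambda>\<Lambda> t x. (\<lambda>y. grad (polar \<phi>) (grad (f t) y)) differentiable (at x) \<and>
      (\<exists>D. ((\<lambda>s. f s x - G s x) has_real_derivative D) (at t within {0..T}) \<and>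
         \<bar>D - diverg (\<lambda>y. grad (polar \<phi>) (grad (f t) y)) x\<bar> \<le> \<Lambda> * \<bar>f t x\<bar>)"
  have f_app: "real_of_ereal (sdist \<phi> (E t) x) = f t x" for t x by (simp add: f_def)
  obtain R \<Lambda> U where R: "R > 0" "\<Lambda> > 0" and U: "open U" "U \<noteq> {}" "(\<Union>t\<in>{0..T}. frontier (E t)) \<subseteq> U"
    and RW': "\<forall>t\<in>{0..T}. RW_condition \<phi> R (E t)"
    and fin': "\<forall>t\<in>{0..T}. \<forall>x\<in>U. \<bar>sdist \<phi> (E t) x\<bar> \<noteq> \<infinity>"
    and C0: "C0_Lip {0..T} U f" and C11: "Linf_C11 {0..T} U f"
    and lip: "is_Lip ({0..T} \<times> U) (\<lambda>(t, x). f t x - G t x)"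
    and pde: "AE (t, x) in lebesgue_on ({0..T} \<times> U). ?pde \<Lambda> t x"
    using rf[unfolded regular_flow_def Let_def f_app] by (elim exE conjE) (rule that)
  note RW = RW'[rule_format] and fin = fin'[rule_format]
  obtain x0 where x0: "x0 \<in> U" using U by blast
  have ne: "E t \<noteq> {}" "E t \<noteq> UNIV" if "t \<in> {0..T}" for t
    using sdist_finite_imp[OF fin[OF that x0]] by auto
  have sd: "sd (f t)" and le: "f t x \<le> 0 \<longleftrightarrow> x \<in> E t" and eq: "f t x = 0 \<longleftrightarrow> x \<in> frontier (E t)"
    and compl: "sdist \<phi> (- E t) x = ereal (- f t x)" if "t \<in> {0..T}" for t x
    using sdist_sd[OF cl[OF that] ne[OF that]] sdist_le_0[OF cl[OF that] ne[OF that]]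
      sdist_eq_0[OF cl[OF that] ne[OF that]] sdist_compl[OF cl[OF that] ne[OF that]]
    by (simp_all add: f_def)
  obtain L where L: "L-lipschitz_on ({0..T} \<times> U) (\<lambda>(t, x). f t x - G t x)"
    using lip by (auto simp: is_Lip_def)
  obtain C where "AE t in lebesgue_on {0..T}. (\<forall>x\<in>U. f t differentiable (at x)) \<and>
        \<bar>f t x0\<bar> \<le> C \<and> (\<forall>x\<in>U. norm (grad (f t) x) \<le> C) \<and> C-lipschitz_on U (grad (f t))"
    using C11 x0 unfolding Linf_C11_def by blast
  then have good: "AE t in lborel. t \<in> {0..T} \<longrightarrow> (\<forall>x\<in>U. f t differentiable (at x)) \<and> C-lipschitz_on U (grad (f t))"
    by (subst (asm) AE_lebesgue_on_lborel) (auto elim!: eventually_mono)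
  have "reg_flow \<phi> c0 c1 T U f G R \<Lambda> C L"
  proof (unfold_locales)
    show "T > 0" "open U" "U \<noteq> {}" "R > 0" "\<Lambda> > 0" by fact+
    show "sd (f t)" if "t \<in> {0..T}" for t by (rule sd[OF that])
    show "x \<in> U" if "t \<in> {0..T}" "f t x = 0" for t x using that eq U(3) by blast
    show "C0_Lip {0..T} U f" by fact
    have "{x. f 0 x = 0} = frontier E0" using eq[of 0] T E0 by auto
    then show "bounded {x. f 0 x = 0}" using cpt compact_imp_bounded by simp
    show "AE t in lborel. t \<in> {0..T} \<longrightarrow> (\<forall>x\<in>U. f t differentiable (at x)) \<and> C-lipschitz_on U (grad (f t))" by fact
    \<comment> \<open>A boundary point lies in the closure of the complement, hence in a Wulff shape
      of radius \<open>R\<close> whose centre is at depth at least \<open>R\<close> there; the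
      signed distance of the complement is \<open>- f t\<close>.\<close>
    show "\<exists>z. R \<le> f t z \<and> \<phi> (z - y) \<le> R" if t: "t \<in> {0..T}" and y: "f t y = 0" for t y
    proof -
      have "y \<in> closure (- E t)" using eq[OF t] y by (simp add: frontier_closures)
      then have "y \<in> (\<Union>x\<in>{x. sdist \<phi> (- E t) x \<le> ereal (- R)}. wulff_ball \<phi> x R)"
        using RW[OF t] by (simp add: RW_condition_def outer_RW_def inner_RW_def)
      then obtain z w where z: "sdist \<phi> (- E t) z \<le> ereal (- R)" "y = z + R *\<^sub>R w" "\<phi> w \<le> 1"
        by (auto simp: wulff_ball_def wulff_def)
      have "\<phi> (z - y) = R * \<phi> w" using z(2) R by (simp add: scale even)
      also have "\<dots> \<le> R" using z(3) R by simp
      finally show ?thesis using z(1) compl[OF t] by (intro exI[of _ z]) simp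
    qed
    show "L-lipschitz_on ({0..T} \<times> U) (\<lambda>(t, x). f t x - G t x)" by fact
    \<comment> \<open>Fubini: an exceptional null set in space-time has null slices at almost every
      time.\<close>
    have "{0..T} \<times> U \<in> sets borel" by (intro borel_Times) (use U in auto)
    from pde[unfolded AE_lebesgue_on_lborel[OF this]]
    have "AE p in lborel \<Otimes>\<^sub>M lborel. p \<in> {0..T} \<times> U \<longrightarrow> (case p of (t, x) \<Rightarrow> ?pde \<Lambda> t x)" unfolding lborel_prod .
    from lborel_pair.AE_pair[OF this]
    show "AE t in lborel. t \<in> {0..T} \<longrightarrow> (AE x in lborel. x \<in> U \<longrightarrow> ?pde \<Lambda> t x)"
    proof eventually_elim
      case (elim t)
      show ?case
      proof
        assume t: "t \<in> {0..T}"
        show "AE x in lborel. x \<in> U \<longrightarrow> ?pde \<Lambda> t x"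
          using elim by eventually_elim (use t in simp)
      qed
    qed
  qed
  with le show ?thesis by blast
qed

lemma C1_Lip_time_derivative:
  assumes "C1_Lip {0..} UNIV G2"
  obtains H G2' where "H \<ge> 0"
    "\<And>t x. t \<ge> 0 \<Longrightarrow> ((\<lambda>s. G2 s x) has_real_derivative G2' t x) (at t within {0..})"
    "\<And>t x. t \<in> {0..T} \<Longrightarrow> x \<in> cball 0 B \<Longrightarrow> \<bar>G2' t x\<bar> \<le> H"
    "\<And>s t x. s \<in> {0..T} \<Longrightarrow> t \<in> {0..T} \<Longrightarrow> x \<in> cball 0 B \<Longrightarrow> \<bar>G2 s x - G2 t x\<bar> \<le> H * \<bar>s - t\<bar>"
proof -
  obtain G2' where c: "C0_Lip {0..} UNIV G2'"
    and d: "\<And>t. t \<ge> 0 \<Longrightarrow> tendsto_Lip UNIV (\<lambda>s x. (G2 s x - G2 t x) / (s - t)) (G2' t) (at t within {0..})"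
    using assms by (auto simp: C1_Lip_def)
  have D: "((\<lambda>s. G2 s x) has_real_derivative G2' t x) (at t within {0..})" if "t \<ge> 0" for t x
    using d[OF that] by (auto simp: tendsto_Lip_def has_field_derivative_iff)
  have "continuous_on ({0..T} \<times> cball 0 B) (\<lambda>(t, x). G2' t x)"
    by (rule continuous_on_subset[OF C0_Lip_continuous[OF c]]) auto
  then have "compact ((\<lambda>(t, x). G2' t x) ` ({0..T} \<times> cball 0 B))"
    by (rule compact_continuous_image) (intro compact_Times compact_Icc compact_cball)
  then have "bounded ((\<lambda>(t, x). G2' t x) ` ({0..T} \<times> cball 0 B))" by (rule compact_imp_bounded)
  then obtain H where H: "H > 0" "\<And>t x. t \<in> {0..T} \<Longrightarrow> x \<in> cball 0 B \<Longrightarrow> \<bar>G2' t x\<bar> \<le> H"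
    unfolding bounded_pos by fastforce
  have "\<bar>G2 s x - G2 t x\<bar> \<le> H * \<bar>s - t\<bar>" if "s \<in> {0..T}" "t \<in> {0..T}" "x \<in> cball 0 B" for s t x
  proof -
    have "norm (G2 s x - G2 t x) \<le> H * norm (s - t)"
    proof (rule field_differentiable_bound[of "{0..T}"])
      show "((\<lambda>s. G2 s x) has_field_derivative G2' u x) (at u within {0..T})" if "u \<in> {0..T}" for u
        by (rule DERIV_subset[OF D]) (use that in auto)
    qed (use that H in auto)
    then show ?thesis by simp
  qed
  then show ?thesis using that[of H G2'] H D by simp
qed

section \<open>Comparison of two flows\<close>

lemma DERIV_pos_square: "((\<lambda>u. (max 0 u)\<^sup>2) has_real_derivative 2 * max 0 u) (at (u::real))"
proof -
  consider "u < 0" | "u = 0" | "u > 0" by linarith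
  then show ?thesis
  proof cases
    case 1
    have "((\<lambda>u. 0) has_real_derivative 2 * max 0 u) (at u)" using 1 by (simp add: max_def)
    then show ?thesis
      by (rule has_field_derivative_transform_within_open[where S="{..<0}"]) (use 1 in auto)
  next
    case 2
    have "((\<lambda>h. ((max 0 (0 + h))\<^sup>2 - (max 0 0)\<^sup>2) / h) \<longlongrightarrow> (0::real)) (at 0)"
    proof (rule Lim_null_comparison)
      show "\<forall>\<^sub>F h in at 0. norm (((max 0 (0 + h))\<^sup>2 - (max 0 0)\<^sup>2) / h) \<le> \<bar>h::real\<bar>"
        by (rule always_eventually) (auto simp: max_def power2_eq_square)
      show "((\<lambda>h::real. \<bar>h\<bar>) \<longlongrightarrow> 0) (at 0)" by (rule tendsto_rabs_zero) simp
    qed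
    then show ?thesis using 2 by (simp add: DERIV_def)
  next
    case 3
    have "((\<lambda>u. u\<^sup>2) has_real_derivative 2 * max 0 u) (at u)"
      using 3 by (auto intro!: derivative_eq_intros)
    then show ?thesis
      by (rule has_field_derivative_transform_within_open[where S="{0<..}"]) (use 3 in auto)
  qed
qed

lemma DERIV_abs_le:
  assumes "(q has_real_derivative D) (at t)" "open I" "t \<in> I" "\<And>s. s \<in> I \<Longrightarrow> \<bar>q s - q t\<bar> \<le> K * \<bar>s - t\<bar>"
  shows "\<bar>D\<bar> \<le> K"
proof (rule tendsto_upperbound)
  show "((\<lambda>s. \<bar>(q s - q t) / (s - t)\<bar>) \<longlongrightarrow> \<bar>D\<bar>) (at t)"
    using assms(1) unfolding has_field_derivative_iff by (rule tendsto_rabs)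
  have "\<forall>\<^sub>F s in at t. s \<in> I \<and> s \<noteq> t"
    using eventually_at_in_open[OF assms(2,3)] by eventually_elim auto
  then show "\<forall>\<^sub>F s in at t. \<bar>(q s - q t) / (s - t)\<bar> \<le> K"
    by eventually_elim (use assms(4) in \<open>auto simp: abs_divide divide_le_eq\<close>)
qed simp

lemma diverg_diff:
  assumes "X differentiable (at x)" "Y differentiable (at x)"
  shows "diverg (\<lambda>y. X y - Y y) x = diverg X x - diverg Y x"
proof -
  have "((\<lambda>y. X y - Y y) has_derivative (\<lambda>h. frechet_derivative X (at x) h - frechet_derivative Y (at x) h)) (at x)"
    using assms frechet_derivative_works by (intro has_derivative_diff) auto
  then have "frechet_derivative (\<lambda>y. X y - Y y) (at x) = (\<lambda>h. frechet_derivative X (at x) h - frechet_derivative Y (at x) h)"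
    by (rule frechet_derivative_at[symmetric])
  then show ?thesis by (simp add: diverg_def inner_diff_left sum_subtractf)
qed

lemma GDERIV_transform_open:
  assumes "GDERIV f x :> g" "open S" "x \<in> S" "\<And>y. y \<in> S \<Longrightarrow> f y = h y"
  shows "GDERIV h x :> g"
  using has_derivative_transform_within_open[OF assms(1)[unfolded gderiv_def] assms(2,3)] assms(4)
  unfolding gderiv_def by blast

text \<open>
  The penalty vanishes up to \<open>\<bar>s\<bar> = r / 2\<close>, so that it is not felt on the boundary of \<open>E t\<close> as
  long as \<open>G1\<close> has not moved by more than \<open>r / 2\<close>.
\<close>

definition penalty :: "real \<Rightarrow> real \<Rightarrow> real" where
  "penalty r s = (max 0 (s - r / 2))\<^sup>2 + (max 0 (- s - r / 2))\<^sup>2"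

definition penalty' :: "real \<Rightarrow> real \<Rightarrow> real" where
  "penalty' r s = 2 * max 0 (s - r / 2) - 2 * max 0 (- s - r / 2)"

lemma DERIV_penalty: "(penalty r has_real_derivative penalty' r s) (at s)"
proof -
  have "((\<lambda>s. (max 0 (s - r / 2))\<^sup>2) has_real_derivative 2 * max 0 (s - r / 2) * 1) (at s)"
    by (rule DERIV_chain2[OF DERIV_pos_square]) (auto intro!: derivative_eq_intros)
  moreover have "((\<lambda>s. (max 0 (- s - r / 2))\<^sup>2) has_real_derivative 2 * max 0 (- s - r / 2) * - 1) (at s)"
    by (rule DERIV_chain2[OF DERIV_pos_square]) (auto intro!: derivative_eq_intros)
  ultimately have "((\<lambda>s. (max 0 (s - r / 2))\<^sup>2 + (max 0 (- s - r / 2))\<^sup>2) has_real_derivative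
      2 * max 0 (s - r / 2) * 1 + 2 * max 0 (- s - r / 2) * - 1) (at s)" by (rule DERIV_add)
  then show ?thesis by (simp add: penalty_def[abs_def] penalty'_def)
qed

lemma penalty_nonneg: "penalty r s \<ge> 0"
  by (simp add: penalty_def)

lemma penalty_ge: assumes "r > 0" "\<bar>s\<bar> \<ge> 3 / 4 * r" shows "penalty r s \<ge> r\<^sup>2 / 16"
proof -
  have "(r / 4)\<^sup>2 \<le> (max 0 (\<bar>s\<bar> - r / 2))\<^sup>2" using assms by (intro power_mono) auto
  also have "\<dots> \<le> penalty r s" by (cases "s \<ge> 0") (auto simp: penalty_def)
  finally show ?thesis by (simp add: power_divide)
qed

text \<open>Used with \<open>y = f t x\<close> and \<open>s\<close> its shift by the motion of
  \<open>G1\<close>. The quadratic bound allows the penalty to be absorbed by \<open>- f t x\<close>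
  inside the set.\<close>

lemma penalty_le: assumes "r > 0" "\<bar>s\<bar> \<le> \<bar>y\<bar> + r / 2" shows "penalty r s \<le> y\<^sup>2"
proof -
  have "penalty r s = (max 0 (\<bar>s\<bar> - r / 2))\<^sup>2" using assms(1) by (cases "s \<ge> 0") (auto simp: penalty_def max_def)
  also have "\<dots> \<le> \<bar>y\<bar>\<^sup>2" using assms(2) by (intro power_mono) auto
  finally show ?thesis by simp
qed

lemma abs_penalty'_le: "r > 0 \<Longrightarrow> \<bar>s\<bar> \<le> c \<Longrightarrow> r \<le> 2 * c \<Longrightarrow> \<bar>penalty' r s\<bar> \<le> 2 * c - r"
  by (auto simp: penalty'_def max_def abs_le_iff)

lemma penalty_lipschitz:
  assumes "r > 0" "\<bar>s\<bar> \<le> 2 * r" "\<bar>t\<bar> \<le> 2 * r" shows "\<bar>penalty r s - penalty r t\<bar> \<le> 3 * r * \<bar>s - t\<bar>"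
proof -
  have "norm (penalty r s - penalty r t) \<le> 3 * r * norm (s - t)"
  proof (rule field_differentiable_bound[of "{-2 * r..2 * r}"])
    show "(penalty r has_field_derivative penalty' r u) (at u within {-2 * r..2 * r})" for u
      by (rule DERIV_subset[OF DERIV_penalty]) simp
    show "norm (penalty' r u) \<le> 3 * r" if "u \<in> {-2 * r..2 * r}" for u
      using abs_penalty'_le[OF assms(1), of u "2 * r"] that assms(1) by auto
  qed (use assms in auto)
  then show ?thesis by simp
qed

section \<open>The estimate near the boundary over a short time\<close>

locale flow_pair = elliptic_norm \<phi> c0 c1 + A: reg_flow \<phi> c0 c1 T U f G R \<Lambda> C L +
    B: reg_flow \<phi> c0 c1 T' U' f' G R' \<Lambda>' C' L'
  for \<phi> c0 c1 T U f G R \<Lambda> C L T' U' f' R' \<Lambda>' C' L' +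
  fixes G1 :: "real \<Rightarrow> real" and G2 :: "real \<Rightarrow> plane \<Rightarrow> real"
  assumes G: "\<And>t x. t \<ge> 0 \<Longrightarrow> G t x = G1 t + G2 t x"
    and G1: "continuous_on {0..} G1" and G2: "C1_Lip {0..} UNIV G2"
    and init: "\<And>x. f 0 x \<le> 0 \<Longrightarrow> f' 0 x \<le> 0"
begin

text \<open>
  Inside \<open>E t\<close>, follow the ray from \<open>x\<close> on which \<open>f'\<close> increases at unit speed: it stays in \<open>E t\<close>
  for a length \<open>- f t x\<close>.
\<close>

lemma signed_le:
  assumes t: "t \<in> {0..T}" "t \<in> {0..T'}" and \<alpha>: "\<alpha> < R'"
    and le: "\<And>x. f t x \<le> 0 \<Longrightarrow> f' t x \<le> \<alpha>"
  shows "f' t x \<le> f t x + \<alpha>"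
proof (cases "f t x \<ge> 0")
  case True
  obtain z where z: "f t z = 0" "\<phi> (x - z) = \<bar>f t x\<bar>" using sd_nearest[OF A.sd[OF t(1)]] by blast
  then show ?thesis using le[of z] sd_lip[OF B.sd[OF t(2)], of x z] True by simp
next
  case False
  define s where "s = - f t x"
  have s: "s > 0" using False by (simp add: s_def)
  have fx: "f' t x \<le> \<alpha>" using le[of x] False by simp
  then obtain z where z: "f' t z \<ge> R'" "\<phi> (z - x) \<le> R' - f' t x"
    using B.outer_ball_flow[OF t(2), of x] \<alpha> by auto
  define D where "D = \<phi> (z - x)"
  \<comment> \<open>If the centre \<open>z\<close> were within distance \<open>s\<close> of
    \<open>x\<close>, it would lie in the first set, where \<open>f' t\<close> is at most \<alpha> <
    \<open>R'\<close>.\<close>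
  have "D > s"
  proof (rule ccontr)
    assume "\<not> D > s"
    then have "f t z \<le> 0" using sd_lip[OF A.sd[OF t(1)], of z x] by (simp add: D_def s_def)
    then show False using le[of z] z \<alpha> by simp
  qed
  define y where "y = x + (s / D) *\<^sub>R (z - x)"
  have "y - x = (s / D) *\<^sub>R (z - x)" by (simp add: y_def)
  then have "\<phi> (y - x) = s" using s \<open>D > s\<close> by (simp add: scale flip: D_def)
  then have "f t y \<le> 0" using sd_lip[OF A.sd[OF t(1)], of y x] by (simp add: s_def)
  then have "f' t y \<le> \<alpha>" by (rule le)
  have zy: "z - y = (1 - s / D) *\<^sub>R (z - x)" by (simp add: y_def algebra_simps)
  have "\<phi> (z - y) = D - s" unfolding zy using s \<open>D > s\<close> by (simp add: scale left_diff_distrib flip: D_def)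
  then have "f' t z - f' t y \<le> D - s" using sd_lip[OF B.sd[OF t(2)], of z y] by simp
  then show ?thesis using \<open>f' t y \<le> \<alpha>\<close> z by (simp add: D_def s_def)
qed

text \<open>The constant \<open>K\<close> is what the errors add up to where \<open>W\<close> is
  positive. There \<open>\<bar>f t x\<bar> \<le> r \<le> a t\<close> and
  \<open>\<bar>f' t x\<bar> \<le> a t + 2 * r \<le> 3 * a t\<close>, which accounts for
  \<open>\<Lambda>\<close> and \<open>3 * \<Lambda>'\<close>. The shifted distance \<open>dt\<close>
  has time derivative at most \<open>L + H\<close> in absolute value, and it enters multiplied by
  the derivative of the penalty, which is at most \<open>r \<le> a t\<close>.\<close>

lemma strip_estimate:
  fixes \<epsilon> r t0 t1 H r0 r0' b0 :: real and G2' :: "real \<Rightarrow> plane \<Rightarrow> real"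
  defines "K \<equiv> 3 * \<Lambda>' + \<Lambda> + L + H"
  defines "a \<equiv> \<lambda>t. \<epsilon> * exp (K * t)"
  assumes t01: "0 \<le> t0" "t0 < t1" "t1 \<le> T" "t1 \<le> T'" and \<epsilon>: "\<epsilon> > 0" and H: "H \<ge> 0"
    and D2: "\<And>t x. t \<ge> 0 \<Longrightarrow> ((\<lambda>s. G2 s x) has_real_derivative G2' t x) (at t within {0..})"
    and H1: "\<And>t x. t \<in> {0..T} \<Longrightarrow> x \<in> cball 0 b0 \<Longrightarrow> \<bar>G2' t x\<bar> \<le> H"
    and H2: "\<And>s t x. s \<in> {0..T} \<Longrightarrow> t \<in> {0..T} \<Longrightarrow> x \<in> cball 0 b0 \<Longrightarrow> \<bar>G2 s x - G2 t x\<bar> \<le> H * \<bar>s - t\<bar>"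
    and b0: "\<And>t x. t \<in> {0..T} \<Longrightarrow> \<bar>f t x\<bar> \<le> 1 \<Longrightarrow> x \<in> cball 0 b0"
    and tube: "\<And>t x. t \<in> {0..T} \<Longrightarrow> \<bar>f t x\<bar> < r0 \<Longrightarrow> x \<in> U"
    and tube': "\<And>t x. t \<in> {0..T'} \<Longrightarrow> \<bar>f' t x\<bar> < r0' \<Longrightarrow> x \<in> U'"
    and r: "0 < r" "r \<le> 1 / 2" "r \<le> \<epsilon>" "r < r0" and ar: "4 * a t0 < r0'"
    and near: "\<And>t x. t \<in> {t0..t1} \<Longrightarrow> \<bar>f t0 x\<bar> \<le> r \<Longrightarrow> \<bar>f t x - f t0 x\<bar> \<le> r\<^sup>2 / 64"
      "\<And>t x. t \<in> {t0..t1} \<Longrightarrow> \<bar>f t0 x\<bar> \<le> r \<Longrightarrow> \<bar>f' t x - f' t0 x\<bar> \<le> r\<^sup>2 / 64"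
      "\<And>t. t \<in> {t0..t1} \<Longrightarrow> \<bar>G1 t - G1 t0\<bar> \<le> r / 16"
    and P0: "\<And>x. f' t0 x \<le> f t0 x + a t0"
    and x: "\<bar>f t0 x\<bar> \<le> r" and t: "t \<in> {t0..t1}"
  shows "f' t x \<le> f t x + a t + penalty r (f t x - G1 t + G1 t0)"
proof -
  define dt where "dt = (\<lambda>t x. f t x - G1 t + G1 t0)"
  define v where "v = (\<lambda>t x. f' t x - f t x - a t - penalty r (dt t x))"
  \<comment> \<open>The strip is that of time \<open>t0\<close> and does not move with
    \<open>t\<close>. The cut at its edge creates no discontinuity, since \<open>v\<close> is
    negative near the edge.\<close>
  define W where "W = (\<lambda>t x. if \<bar>f t0 x\<bar> \<le> r then max 0 (v t x) else 0)"
  \<comment> \<open>One compact set carries \<open>W\<close> at all times of the step and lies in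
    the domains of both equations. Where \<open>v\<close> is nonnegative, \<open>f'\<close> is
    between \<open>- r\<close> and \<open>a t0 + 2 * r\<close>; one more \<open>r\<close> covers its
    motion since \<open>t0\<close>, and \<open>a t0 + 3 * r \<le> 4 * a t0\<close> explains the
    hypothesis \<open>ar\<close>.\<close>
  define S where "S = {x. \<bar>f t0 x\<bar> \<le> r \<and> \<bar>f' t0 x\<bar> \<le> a t0 + 3 * r}"
  define M where "M = a t0 + 3 * r"
  have K: "K \<ge> 0" using H A.\<Lambda> B.\<Lambda> A.L_nonneg by (simp add: K_def)
  have t0T: "t0 \<in> {0..T}" "t0 \<in> {0..T'}" and sub: "\<And>t. t \<in> {t0..t1} \<Longrightarrow> t \<in> {0..T} \<and> t \<in> {0..T'}"
    using t01 by auto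
  have a_ge: "\<epsilon> \<le> a t" if "t \<ge> 0" for t
    using \<epsilon> K that by (simp add: a_def)
  have a_mono: "a s \<le> a t" if "s \<le> t" for s t
    using \<epsilon> K that by (simp add: a_def mult_left_mono)
  have a0: "a t0 \<ge> \<epsilon>" by (rule a_ge[OF t01(1)])
  have r2: "r\<^sup>2 / 64 \<le> r / 128" "0 < r\<^sup>2" using r by (auto simp: power2_eq_square field_simps)
  \<comment> \<open>Near the edge of the strip the two drifts, at most r/128 and r/16, leave
    \<open>\<bar>dt t x\<bar>\<close> at least 3r/4. The penalty r^2/16 then exceeds the total
    motion r^2/32 of the two distances.\<close>
  have neg: "v t x < 0" if t: "t \<in> {t0..t1}" and x: "\<bar>f t0 x\<bar> \<le> r" "\<bar>f t0 x\<bar> \<ge> 7 / 8 * r" for t x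
  proof -
    have "\<bar>dt t x\<bar> \<ge> 3 / 4 * r"
      using near(1)[OF t x(1)] near(3)[OF t] r2 x r(1) unfolding dt_def by linarith
    then have "penalty r (dt t x) \<ge> r\<^sup>2 / 16" by (rule penalty_ge[OF r(1)])
    moreover have "f' t x - f t x - a t \<le> r\<^sup>2 / 32"
    proof -
      have "a t0 \<le> a t" using a_mono[of t0 t] t by simp
      then show ?thesis using near(1,2)[OF t x(1)] P0[of x] by linarith
    qed
    ultimately show ?thesis using r2(2) unfolding v_def by linarith
  qed
  have pos: "\<bar>f t0 x\<bar> < 7 / 8 * r \<and> \<bar>f t x\<bar> \<le> r \<and> \<bar>dt t x\<bar> \<le> r \<and> \<bar>f' t x\<bar> \<le> a t + 2 * r \<and> f' t x \<le> a t0 + 2 * r \<and> x \<in> S"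
    if t: "t \<in> {t0..t1}" and x: "\<bar>f t0 x\<bar> \<le> r" and v: "v t x \<ge> 0" for t x
  proof -
    have lt: "\<bar>f t0 x\<bar> < 7 / 8 * r" using neg[OF t x] v by linarith
    have ft: "\<bar>f t x\<bar> \<le> r" using lt near(1)[OF t x] r2 by linarith
    have d: "\<bar>dt t x\<bar> \<le> r" using lt near(1)[OF t x] near(3)[OF t] r2 unfolding dt_def by linarith
    have up: "f' t x \<le> a t0 + 2 * r" using near(2)[OF t x] P0[of x] x r2 r(1) by linarith
    have "0 < a t" using a_ge[of t] t t01 \<epsilon> by auto
    have "f' t x \<ge> f t x + a t" using v penalty_nonneg[of r "dt t x"] unfolding v_def by linarith
    then have lo: "f' t x \<ge> - r" using ft \<open>0 < a t\<close> by linarith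
    have "\<bar>f' t0 x\<bar> \<le> a t0 + 3 * r" using up lo near(2)[OF t x] r2 r(1) a0 \<epsilon> by linarith
    then show ?thesis using lt ft d up lo x a_mono[of t0 t] t a0 \<epsilon> r(1) by (auto simp: S_def abs_le_iff)
  qed
  have SU: "S \<subseteq> U" "S \<subseteq> U'"
  proof -
    show "S \<subseteq> U" using tube[OF t0T(1)] r(4) by (auto simp: S_def)
    have "a t0 + 3 * r < r0'" using ar a0 r(3) by linarith
    then show "S \<subseteq> U'" using tube'[OF t0T(2)] by (fastforce simp: S_def)
  qed
  have Sb: "S \<subseteq> cball 0 b0" using b0[OF t0T(1)] r(2) by (fastforce simp: S_def)
  have fc: "continuous_on UNIV (f t)" if "t \<in> {0..T}" for t by (rule sd_continuous[OF A.sd[OF that]])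
  have fc': "continuous_on UNIV (f' t)" if "t \<in> {0..T'}" for t by (rule sd_continuous[OF B.sd[OF that]])
  have Scpt: "compact S"
  proof -
    have "closed {x. \<bar>f t0 x\<bar> \<le> r}" "closed {x. \<bar>f' t0 x\<bar> \<le> a t0 + 3 * r}"
      by (intro closed_Collect_le continuous_intros fc fc' t0T)+
    moreover have "S = {x. \<bar>f t0 x\<bar> \<le> r} \<inter> {x. \<bar>f' t0 x\<bar> \<le> a t0 + 3 * r}" by (auto simp: S_def)
    ultimately have "closed S" by auto
    then show ?thesis using Sb bounded_subset[OF bounded_cball] by (simp add: compact_eq_bounded_closed)
  qed
  have Wpos: "\<bar>f t0 x\<bar> < 7 / 8 * r \<and> v t x > 0 \<and> W t x = v t x \<and> x \<in> S \<and> \<bar>f t0 x\<bar> \<le> r"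
    if "t \<in> {t0..t1}" "W t x \<noteq> 0" for t x
    using that pos[OF that(1), of x] by (auto simp: W_def max_def split: if_splits)
  have penc: "continuous_on UNIV (penalty r)"
    by (rule DERIV_continuous_on[of UNIV "penalty r" "penalty' r"]) (rule DERIV_penalty)
  have vc: "continuous_on UNIV (v t)" if t: "t \<in> {t0..t1}" for t
    unfolding v_def dt_def using sub[OF t]
    by (intro continuous_intros fc fc' continuous_on_compose2[OF penc]) auto
  have W_nonneg: "W t x \<ge> 0" for t x by (simp add: W_def)
  have W_off: "W t x = 0" if "t \<in> {t0..t1}" "x \<notin> S" for t x using Wpos[OF that(1), of x] that(2) by blast
  have W_le: "W t x \<le> M" if t: "t \<in> {t0..t1}" for t x
  proof (cases "W t x = 0")
    case True then show ?thesis using a0 \<epsilon> r(1) by (simp add: M_def)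
  next
    case False
    note W = Wpos[OF t False]
    then have "f' t x \<le> a t0 + 2 * r" "\<bar>f t x\<bar> \<le> r" using pos[OF t, of x] by auto
    moreover have "0 < a t" using a_ge[of t] t t01 \<epsilon> by auto
    ultimately show ?thesis using W penalty_nonneg[of r "dt t x"] unfolding v_def M_def by linarith
  qed
  have W_cont: "continuous_on UNIV (W t)" if t: "t \<in> {t0..t1}" for t
  proof -
    let ?A = "{x. \<bar>f t0 x\<bar> \<le> r}" and ?B = "{x. r \<le> \<bar>f t0 x\<bar>}"
    have "closed ?A" "closed ?B" by (intro closed_Collect_le continuous_intros fc t0T)+
    moreover have "continuous_on ?A (W t)"
    proof -
      have "continuous_on ?A (\<lambda>x. max 0 (v t x))"
        by (intro continuous_intros continuous_on_subset[OF vc[OF t]]) auto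
      then show ?thesis by (rule continuous_on_eq) (auto simp: W_def)
    qed
    moreover have "continuous_on ?B (W t)"
    proof (rule continuous_on_eq[OF continuous_on_const])
      fix x assume "x \<in> ?B"
      then show "0 = W t x" using Wpos[OF t, of x] r(1) by force
    qed
    ultimately have "continuous_on (?A \<union> ?B) (W t)" by (rule continuous_on_closed_Un)
    moreover have "?A \<union> ?B = UNIV" by auto
    ultimately show ?thesis by simp
  qed
  \<comment> \<open>In this form the continuous but possibly nondifferentiable \<open>G1\<close> has
    cancelled: \<open>f - G\<close> is Lipschitz in time and \<open>G2\<close> is differentiable in
    time.\<close>
  have dt_eq: "dt s y = (f s y - G s y) + G2 s y + G1 t0" if "s \<ge> 0" for s y
    using G[OF that, of y] by (simp add: dt_def)
  have v_eq: "v s y = (f' s y - G s y) - (f s y - G s y) - a s - penalty r ((f s y - G s y) + G2 s y + G1 t0)"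
    if "s \<ge> 0" for s y
    using dt_eq[OF that] by (simp add: v_def)
  have Da: "(a has_real_derivative K * a t) (at t)" for t
    unfolding a_def by (auto intro!: derivative_eq_intros)
  define Lw where "Lw = L' + L + K * a t1 + 3 * r * (L + H)"
  have Lw: "Lw \<ge> 0" using A.L_nonneg B.L_nonneg K a_ge[of t1] t01 \<epsilon> r H by (simp add: Lw_def)
  have W_lip: "\<bar>W s y - W t y\<bar> \<le> Lw * \<bar>s - t\<bar>" if s: "s \<in> {t0..t1}" and t: "t \<in> {t0..t1}" for s t y
  proof (cases "y \<in> S")
    case False then show ?thesis using W_off[OF s] W_off[OF t] Lw by simp
  next
    case True
    then have y: "y \<in> U" "y \<in> U'" "y \<in> cball 0 b0" "\<bar>f t0 y\<bar> \<le> r" using SU Sb by (auto simp: S_def)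
    have st: "s \<in> {0..T}" "t \<in> {0..T}" "s \<in> {0..T'}" "t \<in> {0..T'}" using sub s t by auto
    have 1: "\<bar>(f s y - G s y) - (f t y - G t y)\<bar> \<le> L * \<bar>s - t\<bar>" by (rule A.time_lipschitz[OF st(1,2) y(1)])
    have 2: "\<bar>(f' s y - G s y) - (f' t y - G t y)\<bar> \<le> L' * \<bar>s - t\<bar>" by (rule B.time_lipschitz[OF st(3,4) y(2)])
    have 3: "\<bar>a s - a t\<bar> \<le> K * a t1 * \<bar>s - t\<bar>"
    proof -
      have "norm (a s - a t) \<le> K * a t1 * norm (s - t)"
      proof (rule field_differentiable_bound[of "{t0..t1}"])
        show "(a has_field_derivative K * a u) (at u within {t0..t1})" for u
          by (rule DERIV_subset[OF Da]) simp
        show "norm (K * a u) \<le> K * a t1" if "u \<in> {t0..t1}" for u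
        proof -
          have "a u \<ge> 0" using a_ge[of u] that t01 \<epsilon> by auto
          then show ?thesis using K a_mono[of u t1] that by (simp add: abs_mult mult_left_mono)
        qed
      qed (use s t in auto)
      then show ?thesis by simp
    qed
    have bd: "\<bar>dt u y\<bar> \<le> 2 * r" if "u \<in> {t0..t1}" for u
      using near(1)[OF that y(4)] near(3)[OF that] y(4) r2 r(1) unfolding dt_def by linarith
    have "\<bar>dt s y - dt t y\<bar> \<le> (L + H) * \<bar>s - t\<bar>"
      using 1 H2[OF st(1,2) y(3)] dt_eq[of s y] dt_eq[of t y] st by (simp add: distrib_right abs_le_iff)
    then have "3 * r * \<bar>dt s y - dt t y\<bar> \<le> 3 * r * ((L + H) * \<bar>s - t\<bar>)" using r(1) by (intro mult_left_mono) auto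
    then have 4: "\<bar>penalty r (dt s y) - penalty r (dt t y)\<bar> \<le> 3 * r * (L + H) * \<bar>s - t\<bar>"
      using penalty_lipschitz[OF r(1) bd[OF s] bd[OF t]] by (simp add: mult.assoc)
    have "\<bar>W s y - W t y\<bar> \<le> \<bar>v s y - v t y\<bar>" using y(4) by (auto simp: W_def max_def)
    also have "\<dots> \<le> L' * \<bar>s - t\<bar> + L * \<bar>s - t\<bar> + K * a t1 * \<bar>s - t\<bar> + 3 * r * (L + H) * \<bar>s - t\<bar>"
      using 1 2 3 4 unfolding v_def by linarith
    also have "\<dots> = Lw * \<bar>s - t\<bar>" by (simp add: Lw_def distrib_right)
    finally show ?thesis .
  qed
  have W_init: "W t0 y = 0" for y
    using P0[of y] penalty_nonneg[of r "dt t0 y"] by (simp add: W_def v_def max_def)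
  have V: "open (U \<inter> U')" "S \<subseteq> U \<inter> U'" using A.U(1) B.U(1) SU by auto
  have eqn: "AE t in lborel. t \<in> {t0<..<t1} \<longrightarrow> parabolic_subsolution (U \<inter> U') W t"
    using A.good B.good A.pde B.pde
  proof eventually_elim
    case (elim t)
    show ?case
    proof
      assume t01': "t \<in> {t0<..<t1}"
      then have t: "t \<in> {t0..t1}" "t \<in> {0..T}" "t \<in> {0..T'}" using sub[of t] by auto
      have gA: "\<And>x. x \<in> U \<Longrightarrow> f t differentiable at x" "C-lipschitz_on U (grad (f t))" using elim(1) t by auto
      have gB: "\<And>x. x \<in> U' \<Longrightarrow> f' t differentiable at x" "C'-lipschitz_on U' (grad (f' t))" using elim(2) t by auto
      \<comment> \<open>\<open>?q\<close> is the gradient of \<open>f t\<close> plus the penalty. It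
        is a positive multiple of \<open>grad (f t)\<close> where \<open>W\<close> is nonzero,
        because the derivative of the penalty is at most \<open>r \<le> 1 / 2\<close> in absolute
        value there. Hence \<open>dual\<close> does not distinguish the two, and monotonicity
        applies to \<open>?p\<close> and \<open>?q\<close> although \<open>Y\<close> is built from
        the original normals.\<close>
      let ?p = "\<lambda>x. grad (f' t) x" and ?q = "\<lambda>x. (1 + penalty' r (dt t x)) *\<^sub>R grad (f t) x"
      let ?X = "\<lambda>y. grad (polar \<phi>) (grad (f t) y)" and ?X' = "\<lambda>y. grad (polar \<phi>) (grad (f' t) y)"
      define g where "g = (\<lambda>x. (2 * W t x) *\<^sub>R (?p x - ?q x))"
      define Y where "Y = (\<lambda>y. ?X' y - ?X y)"
      have pen': "\<bar>penalty' r (dt t x)\<bar> \<le> r" if "W t x \<noteq> 0" for x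
        using abs_penalty'_le[OF r(1), of "dt t x" r] pos[OF t(1), of x] Wpos[OF t(1) that] r(1) by auto
      have D_zero: "GDERIV (\<lambda>x. (W t x)\<^sup>2) x :> 0" if "open Q" "x \<in> Q" "\<And>y. y \<in> Q \<Longrightarrow> W t y = 0" for Q x
        by (rule GDERIV_transform_open[OF GDERIV_const that(1,2)]) (use that(3) in simp)
      have g: "GDERIV (\<lambda>x. (W t x)\<^sup>2) x :> g x" for x
      proof (cases "\<bar>f t0 x\<bar> < r")
        case False
        have "open {y. 7 / 8 * r < \<bar>f t0 y\<bar>}" by (intro open_Collect_less continuous_intros fc t0T)
        moreover have z: "W t y = 0" if "7 / 8 * r < \<bar>f t0 y\<bar>" for y using Wpos[OF t(1), of y] that by force
        ultimately have "GDERIV (\<lambda>x. (W t x)\<^sup>2) x :> 0" using False r(1) by (intro D_zero) auto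
        moreover have "W t x = 0" using False r(1) by (intro z) auto
        ultimately show ?thesis by (simp add: g_def)
      next
        case True
        show ?thesis
        proof (cases "v t x < 0")
          case neg: True
          have "open {y. v t y < 0}" by (intro open_Collect_less continuous_intros vc t)
          moreover have z: "W t y = 0" if "v t y < 0" for y using that by (simp add: W_def)
          ultimately have "GDERIV (\<lambda>x. (W t x)\<^sup>2) x :> 0" using neg by (intro D_zero) auto
          then show ?thesis using z[OF neg] by (simp add: g_def)
        next
          case False
          then have "x \<in> S" using pos[OF t(1), of x] True by simp
          then have xU: "x \<in> U" "x \<in> U'" using SU by auto
          note dA = differentiable_GDERIV[OF gA(1)[OF xU(1)]] and dB = differentiable_GDERIV[OF gB(1)[OF xU(2)]]
          have "GDERIV (\<lambda>x. dt t x) x :> grad (f t) x"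
            using GDERIV_diff[OF dA GDERIV_const[of "G1 t - G1 t0"]] by (simp add: dt_def algebra_simps)
          from GDERIV_DERIV_compose[OF this DERIV_penalty]
          have "GDERIV (\<lambda>x. penalty r (dt t x)) x :> penalty' r (dt t x) *\<^sub>R grad (f t) x" .
          from GDERIV_diff[OF GDERIV_diff[OF GDERIV_diff[OF dB dA] GDERIV_const[of "a t"]] this]
          have "GDERIV (v t) x :> ?p x - ?q x" by (simp add: v_def algebra_simps)
          from GDERIV_DERIV_compose[OF this DERIV_pos_square]
          have "GDERIV (\<lambda>x. (max 0 (v t x))\<^sup>2) x :> (2 * max 0 (v t x)) *\<^sub>R (?p x - ?q x)" .
          moreover have "open {y. \<bar>f t0 y\<bar> < r}" by (intro open_Collect_less continuous_intros fc t0T)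
          ultimately have "GDERIV (\<lambda>x. (W t x)\<^sup>2) x :> (2 * max 0 (v t x)) *\<^sub>R (?p x - ?q x)"
            by (rule GDERIV_transform_open) (use True in \<open>auto simp: W_def\<close>)
          then show ?thesis using True by (simp add: g_def W_def)
        qed
      qed
      have g_bound: "norm (g x) \<le> 2 * M * (1 / c0 + 2 * (1 / c0))" for x
      proof (cases "W t x = 0")
        case True
        have "M \<ge> 0" using a0 \<epsilon> r(1) by (simp add: M_def)
        then show ?thesis using True c0 by (simp add: g_def)
      next
        case False
        then have xU: "x \<in> U" "x \<in> U'" using Wpos[OF t(1) False] SU by auto
        have "norm (?q x) = \<bar>1 + penalty' r (dt t x)\<bar> * norm (grad (f t) x)" by simp
        also have "\<dots> \<le> 2 * (1 / c0)"
          using pen'[OF False] r(2) A.norm_grad_le[OF t(2) gA xU(1)] by (intro mult_mono) auto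
        finally have "norm (?p x - ?q x) \<le> 1 / c0 + 2 * (1 / c0)"
          using norm_triangle_ineq4[of "?p x" "?q x"] B.norm_grad_le[OF t(3) gB xU(2)] by linarith
        then have "(2 * W t x) * norm (?p x - ?q x) \<le> (2 * M) * (1 / c0 + 2 * (1 / c0))"
          using W_nonneg[of t x] W_le[OF t(1), of x] by (intro mult_mono) auto
        then show ?thesis using W_nonneg[of t x] by (simp add: g_def)
      qed
      have Y_lip: "(8 / c1 * C' + 8 / c1 * C)-lipschitz_on (U \<inter> U') Y"
        unfolding Y_def
        by (rule lipschitz_on_diff[OF lipschitz_on_subset[OF B.normal_lipschitz[OF t(3) gB]]
            lipschitz_on_subset[OF A.normal_lipschitz[OF t(2) gA]]]) auto
      have gY: "g x \<bullet> Y x \<ge> 0" if x: "x \<in> U \<inter> U'" for x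
      proof (cases "W t x = 0")
        case False
        have "1 + penalty' r (dt t x) > 0" using pen'[OF False] r(2) by auto
        then have "dual (?q x) = dual (grad (f t) x)"
          using A.grad_nonzero[OF t(2) gA] x by (intro dual_scale) auto
        then have "Y x = dual (?p x) - dual (?q x)"
          using A.normal_eq_dual[OF t(2) gA] B.normal_eq_dual[OF t(3) gB] x by (simp add: Y_def)
        then have "(?p x - ?q x) \<bullet> Y x \<ge> 0" using dual_monotone by simp
        then show ?thesis using W_nonneg[of t x] by (simp add: g_def)
      qed (simp add: g_def)
      have ae: "AE x in lborel. W t x \<noteq> 0 \<longrightarrow> Y differentiable (at x) \<and>
          (\<exists>D. ((\<lambda>s. W s x) has_real_derivative D) (at t) \<and> D \<le> diverg Y x)"
        using elim(3)[rule_format, OF t(2)] elim(4)[rule_format, OF t(3)]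
      proof eventually_elim
        case (elim x)
        show ?case
        proof
          assume W0: "W t x \<noteq> 0"
          note W = Wpos[OF t(1) W0]
          then have xU: "x \<in> U" "x \<in> U'" "x \<in> cball 0 b0" "\<bar>f t0 x\<bar> \<le> r" using SU Sb by auto
          have p: "\<bar>f t x\<bar> \<le> r" "\<bar>dt t x\<bar> \<le> r" "\<bar>f' t x\<bar> \<le> a t + 2 * r" using pos[OF t(1), of x] W by auto
          obtain D where D: "((\<lambda>s. f s x - G s x) has_real_derivative D) (at t within {0..T})"
              "\<bar>D - diverg ?X x\<bar> \<le> \<Lambda> * \<bar>f t x\<bar>" and dX: "?X differentiable (at x)"
            using elim(1) xU by blast
          obtain D' where D': "((\<lambda>s. f' s x - G s x) has_real_derivative D') (at t within {0..T'})"
              "\<bar>D' - diverg ?X' x\<bar> \<le> \<Lambda>' * \<bar>f' t x\<bar>" and dX': "?X' differentiable (at x)"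
            using elim(2) xU by blast
          have tin: "0 < t" "t < T" "t < T'" using t01' t01 by auto
          have E: "((\<lambda>s. f s x - G s x) has_real_derivative D) (at t)"
            using D(1) at_within_Icc_at[of 0 t T] tin by simp
          have E': "((\<lambda>s. f' s x - G s x) has_real_derivative D') (at t)"
            using D'(1) at_within_Icc_at[of 0 t T'] tin by simp
          have E2: "((\<lambda>s. G2 s x) has_real_derivative G2' t x) (at t)"
          proof -
            have "at t within {0..} = at t" using tin by (intro at_within_interior) (simp add: interior_Ici[of 0 "-1"])
            then show ?thesis using D2[of t x] tin by simp
          qed
          have Dt: "((\<lambda>s. (f s x - G s x) + G2 s x + G1 t0) has_real_derivative D + G2' t x) (at t)"
            using DERIV_add[OF DERIV_add[OF E E2] DERIV_const[of "G1 t0"]] by simp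
          let ?Dv = "D' - D - K * a t - penalty' r (dt t x) * (D + G2' t x)"
          have "((\<lambda>s. (f' s x - G s x) - (f s x - G s x) - a s - penalty r ((f s x - G s x) + G2 s x + G1 t0))
              has_real_derivative ?Dv) (at t)"
            using DERIV_diff[OF DERIV_diff[OF DERIV_diff[OF E' E] Da] DERIV_chain2[OF DERIV_penalty Dt]] dt_eq[of t x] tin
            by simp
          then have Dv: "((\<lambda>s. v s x) has_real_derivative ?Dv) (at t)"
            by (rule has_field_derivative_transform_within_open[where S="{0<..}"]) (use tin v_eq in auto)
          have "((\<lambda>s. v s x) \<longlongrightarrow> v t x) (nhds t)"
            using DERIV_isCont[OF Dv] tendsto_at_iff_tendsto_nhds[of "\<lambda>s. v s x" t] by (simp add: isCont_def)
          then have "\<forall>\<^sub>F s in nhds t. v s x > 0" by (rule order_tendstoD) (use W in simp)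
          then have ev: "\<forall>\<^sub>F s in nhds t. W s x = v s x"
            by eventually_elim (use xU in \<open>simp add: W_def\<close>)
          have DW: "((\<lambda>s. W s x) has_real_derivative ?Dv) (at t)"
            using Dv DERIV_cong_ev[OF refl ev refl] by simp
          have "\<bar>D\<bar> \<le> L"
            by (rule DERIV_abs_le[OF E, of "{0<..<T}"]) (use tin A.time_lipschitz[of _ t x] xU t in auto)
          moreover have "\<bar>G2' t x\<bar> \<le> H" by (rule H1) (use t xU in auto)
          ultimately have "\<bar>D + G2' t x\<bar> \<le> L + H" by linarith
          then have "\<bar>penalty' r (dt t x)\<bar> * \<bar>D + G2' t x\<bar> \<le> r * (L + H)"
            using pen'[OF W0] r(1) by (intro mult_mono) auto
          then have 1: "- (penalty' r (dt t x) * (D + G2' t x)) \<le> r * (L + H)" by (simp flip: abs_mult)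
          have ra: "r \<le> a t" using a_ge[of t] r(3) tin by linarith
          have 2: "r * (L + H) \<le> a t * (L + H)" using ra A.L_nonneg H by (intro mult_right_mono) auto
          have 3: "\<Lambda> * \<bar>f t x\<bar> \<le> \<Lambda> * a t" using p ra A.\<Lambda> by (intro mult_left_mono) auto
          have 4: "\<Lambda>' * \<bar>f' t x\<bar> \<le> \<Lambda>' * (3 * a t)" using p ra B.\<Lambda> by (intro mult_left_mono) auto
          have 5: "K * a t = a t * (L + H) + \<Lambda> * a t + \<Lambda>' * (3 * a t)" by (simp add: K_def algebra_simps)
          have "?Dv \<le> diverg ?X' x - diverg ?X x"
            using 1 2 3 4 5 D(2) D'(2) by linarith
          also have "\<dots> = diverg Y x" unfolding Y_def by (rule diverg_diff[OF dX' dX, symmetric])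
          finally have "?Dv \<le> diverg Y x" .
          moreover have "Y differentiable (at x)" unfolding Y_def using dX dX' by (rule differentiable_diff[rotated])
          ultimately show "Y differentiable (at x) \<and> (\<exists>D. ((\<lambda>s. W s x) has_real_derivative D) (at t) \<and> D \<le> diverg Y x)"
            using DW by blast
        qed
      qed
      show "parabolic_subsolution (U \<inter> U') W t"
        using g g_bound Y_lip gY ae unfolding parabolic_subsolution_def by blast
    qed
  qed
  have "W t x = 0"
  proof (cases "t = t0")
    case False
    then have lt: "t0 < t" and sub': "\<And>s. s \<in> {t0..t} \<Longrightarrow> s \<in> {t0..t1}" using t by auto
    show ?thesis
    \<comment> \<open>The energy argument gives vanishing at the right end of its interval only, so
      it is run from \<open>t0\<close> to the given \<open>t\<close>.\<close>
    proof (rule energy_zero[OF lt Scpt V, of W M Lw])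
      show "AE t' in lborel. t' \<in> {t0<..<t} \<longrightarrow> parabolic_subsolution (U \<inter> U') W t'"
        using eqn by eventually_elim (use t in auto)
    qed (use sub' W_nonneg W_off W_le W_cont W_lip W_init in blast)+
  qed (use W_init in simp)
  then have "v t x \<le> 0" using x by (simp add: W_def max_def split: if_splits)
  then show ?thesis by (simp add: v_def dt_def)
qed

end

section \<open>Continuation in time and the limit of vanishing \<epsilon>\<close>

lemma (in sd_flow) uniform_near:
  assumes Q: "compact Q" and t: "t \<in> {0..T}" and e: "e > 0"
  shows "\<exists>\<delta>>0. \<forall>s\<in>{0..T}. \<bar>s - t\<bar> < \<delta> \<longrightarrow> (\<forall>x\<in>Q. \<bar>f s x - f t x\<bar> \<le> e)"
proof -
  have "uniformly_continuous_on ({0..T} \<times> Q) (\<lambda>(t, x). f t x)"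
    by (rule compact_uniformly_continuous[OF continuous_on_subset[OF continuous_joint]])
      (auto intro!: compact_Times Q)
  then obtain \<delta> where \<delta>: "\<delta> > 0" "\<And>p q. p \<in> {0..T} \<times> Q \<Longrightarrow> q \<in> {0..T} \<times> Q \<Longrightarrow> dist q p < \<delta> \<Longrightarrow>
      dist (case q of (t, x) \<Rightarrow> f t x) (case p of (t, x) \<Rightarrow> f t x) < e"
    using e unfolding uniformly_continuous_on_def by metis
  have "\<bar>f s x - f t x\<bar> \<le> e" if "s \<in> {0..T}" "\<bar>s - t\<bar> < \<delta>" "x \<in> Q" for s x
    using \<delta>(2)[of "(t, x)" "(s, x)"] that t by (auto simp: dist_Pair_Pair dist_real_def)
  with \<delta>(1) show ?thesis by blast
qed

context flow_pair
begin

text \<open>Continuous induction: the property \<open>P\<close> holds at 0, passes to limits from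
  the left (\<open>closed\<close>) and can be continued to the right (\<open>step\<close>), so the
  infimum of a nonempty set of bad times would be contradictory. The allowance is removed at the end
  by sending \<epsilon> to 0.\<close>

lemma comparison:
  assumes t: "t \<in> {0..min T T'}" and x: "f t x \<le> 0"
  shows "f' t x \<le> 0"
proof -
  obtain r0 where r0: "r0 > 0" "\<And>t x. t \<in> {0..T} \<Longrightarrow> \<bar>f t x\<bar> < r0 \<Longrightarrow> x \<in> U" using A.tube by blast
  obtain r0' where r0': "r0' > 0" "\<And>t x. t \<in> {0..T'} \<Longrightarrow> \<bar>f' t x\<bar> < r0' \<Longrightarrow> x \<in> U'" using B.tube by blast
  obtain b0 where b0: "\<And>t x. t \<in> {0..T} \<Longrightarrow> \<bar>f t x\<bar> \<le> 1 \<Longrightarrow> x \<in> cball 0 b0" using A.strip_bounded by blast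
  obtain H G2' where H: "H \<ge> 0"
    and D2: "\<And>t x. t \<ge> 0 \<Longrightarrow> ((\<lambda>s. G2 s x) has_real_derivative G2' t x) (at t within {0..})"
    and H1: "\<And>t x. t \<in> {0..T} \<Longrightarrow> x \<in> cball 0 b0 \<Longrightarrow> \<bar>G2' t x\<bar> \<le> H"
    and H2: "\<And>s t x. s \<in> {0..T} \<Longrightarrow> t \<in> {0..T} \<Longrightarrow> x \<in> cball 0 b0 \<Longrightarrow> \<bar>G2 s x - G2 t x\<bar> \<le> H * \<bar>s - t\<bar>"
    using C1_Lip_time_derivative[OF G2, of T b0] by blast
  define K where "K = 3 * \<Lambda>' + \<Lambda> + L + H"
  have K: "K \<ge> 0" using H A.\<Lambda> B.\<Lambda> A.L_nonneg by (simp add: K_def)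
  define T0 where "T0 = min T T'"
  have T0: "T0 > 0" "T0 \<le> T" "T0 \<le> T'" using A.T B.T by (auto simp: T0_def)
  \<comment> \<open>The smallness condition is imposed at \<open>T0\<close>, where the allowance is
    largest: below \<open>R'\<close> for \<open>signed_le\<close>, and below \<open>r0' / 4\<close>
    so that four times the allowance stays in the tube of the second flow.\<close>
  have main: "f' t x \<le> f t x + \<epsilon> * exp (K * t)"
    if \<epsilon>: "\<epsilon> > 0" and small: "\<epsilon> * exp (K * T0) < min R' (r0' / 4)" and t: "t \<in> {0..T0}" for \<epsilon> t x
  proof -
    define a where "a = (\<lambda>t. \<epsilon> * exp (K * t))"
    define P where "P = (\<lambda>t. \<forall>x. f' t x \<le> f t x + a t)"
    have a_mono: "a s \<le> a t" if "s \<le> t" for s t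
      using \<epsilon> K that by (simp add: a_def mult_left_mono)
    have a_ge: "\<epsilon> \<le> a t" if "t \<ge> 0" for t using \<epsilon> K that by (simp add: a_def)
    have a_small: "a t < R'" "4 * a t < r0'" if "t \<le> T0" for t
      using a_mono[OF that] small by (auto simp: a_def)
    have P_I: "P t" if t: "t \<in> {0..T0}" and le: "\<And>x. f t x \<le> 0 \<Longrightarrow> f' t x \<le> a t" for t
      unfolding P_def using signed_le[OF _ _ a_small(1) le] t T0 by simp
    have P_0: "P 0"
    proof (rule P_I)
      fix x assume "f 0 x \<le> 0"
      then show "f' 0 x \<le> a 0" using init[of x] a_ge[of 0] \<epsilon> by simp
    qed (use T0 in simp)
    have step: "\<exists>t1>t0. t1 \<le> T0 \<and> (\<forall>t\<in>{t0..t1}. P t)" if t0: "0 \<le> t0" "t0 < T0" and P: "P t0" for t0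
    proof -
      \<comment> \<open>The width does not depend on \<open>t0\<close>, only the length of the time
        step does: \<open>r \<le> \<epsilon>\<close> lets the allowance dominate \<open>r\<close>,
        \<open>r < r0\<close> keeps the strip in \<open>U\<close>, and \<open>r \<le> 1 / 2\<close>
        keeps it in \<open>cball 0 b0\<close>.\<close>
      define r where "r = min (1 / 2) (min \<epsilon> (r0 / 2))"
      have r: "0 < r" "r \<le> 1 / 2" "r \<le> \<epsilon>" "r < r0" using \<epsilon> r0(1) by (auto simp: r_def)
      define \<eta> where "\<eta> = r\<^sup>2 / 64"
      have \<eta>: "0 < \<eta>" "\<eta> \<le> r / 128" using r by (auto simp: \<eta>_def power2_eq_square field_simps)
      \<comment> \<open>\<open>Q\<close> contains the strip and every boundary of either flow. On it
        the motion is uniformly small over a short time; outside it no boundary ever passes.\<close>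
      define Q where "Q = cball 0 b0 \<union> (A.all_zeros \<union> B.all_zeros)"
      have Q: "compact Q" unfolding Q_def by (intro compact_Un compact_cball A.compact_all_zeros B.compact_all_zeros)
      obtain \<delta>1 where \<delta>1: "\<delta>1 > 0" "\<And>s x. s \<in> {0..T} \<Longrightarrow> \<bar>s - t0\<bar> < \<delta>1 \<Longrightarrow> x \<in> Q \<Longrightarrow> \<bar>f s x - f t0 x\<bar> \<le> \<eta>"
        using A.uniform_near[OF Q _ \<eta>(1), of t0] t0 T0 by auto
      obtain \<delta>2 where \<delta>2: "\<delta>2 > 0" "\<And>s x. s \<in> {0..T'} \<Longrightarrow> \<bar>s - t0\<bar> < \<delta>2 \<Longrightarrow> x \<in> Q \<Longrightarrow> \<bar>f' s x - f' t0 x\<bar> \<le> \<eta>"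
        using B.uniform_near[OF Q _ \<eta>(1), of t0] t0 T0 by auto
      have "t0 \<in> {0..}" "r / 16 > 0" using t0 r by auto
      then obtain \<delta>3 where \<delta>3: "\<delta>3 > 0" "\<And>s. s \<in> {0..} \<Longrightarrow> dist s t0 < \<delta>3 \<Longrightarrow> dist (G1 s) (G1 t0) < r / 16"
        using G1 unfolding continuous_on_iff by blast
      define t1 where "t1 = min T0 (t0 + min \<delta>1 (min \<delta>2 \<delta>3) / 2)"
      have t1: "t0 < t1" "t1 \<le> T0" using t0 \<delta>1(1) \<delta>2(1) \<delta>3(1) by (auto simp: t1_def)
      have close: "\<bar>t - t0\<bar> < \<delta>1" "\<bar>t - t0\<bar> < \<delta>2" "\<bar>t - t0\<bar> < \<delta>3" if "t \<in> {t0..t1}" for t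
        using that \<delta>1(1) \<delta>2(1) \<delta>3(1) by (auto simp: t1_def min_def split: if_splits)
      have tt: "t \<in> {0..T}" "t \<in> {0..T'}" "t \<in> {0..T0}" if "t \<in> {t0..t1}" for t
        using that t0 t1 T0 by auto
      have near1: "\<bar>f t x - f t0 x\<bar> \<le> \<eta>" if "t \<in> {t0..t1}" "x \<in> Q" for t x
        by (rule \<delta>1(2)[OF tt(1)[OF that(1)] close(1)[OF that(1)] that(2)])
      have near2: "\<bar>f' t x - f' t0 x\<bar> \<le> \<eta>" if "t \<in> {t0..t1}" "x \<in> Q" for t x
        by (rule \<delta>2(2)[OF tt(2)[OF that(1)] close(2)[OF that(1)] that(2)])
      have near3: "\<bar>G1 t - G1 t0\<bar> \<le> r / 16" if "t \<in> {t0..t1}" for t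
        using \<delta>3(2)[of t] close(3)[OF that] tt(1)[OF that] by (auto simp: dist_real_def)
      have strip: "x \<in> Q" if "\<bar>f t0 x\<bar> \<le> r" for x
        using b0[of t0 x] that r(2) t0 T0 by (auto simp: Q_def)
      have "P t" if t: "t \<in> {t0..t1}" for t
      proof (rule P_I[OF tt(3)[OF t]])
        fix x assume fx: "f t x \<le> 0"
        have at: "a t0 \<le> a t" using a_mono[of t0 t] t by simp
        show "f' t x \<le> a t"
        proof (cases "\<bar>f t0 x\<bar> \<le> r")
          case True
          have est: "f' t x \<le> f t x + a t + penalty r (f t x - G1 t + G1 t0)"
            unfolding a_def K_def
          proof (rule strip_estimate[OF t0(1) t1(1) _ _ \<epsilon> H D2 H1 H2 b0 r0(2) r0'(2) r _ _ _ near3 _ True t])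
            show "t1 \<le> T" "t1 \<le> T'" using t1 T0 by auto
            show "4 * (\<epsilon> * exp ((3 * \<Lambda>' + \<Lambda> + L + H) * t0)) < r0'"
              using a_small(2)[of t0] t0 by (simp add: a_def K_def)
            show "f' t0 x \<le> f t0 x + \<epsilon> * exp ((3 * \<Lambda>' + \<Lambda> + L + H) * t0)" for x
              using P by (simp add: P_def a_def K_def)
          qed (use near1 near2 strip in \<open>auto simp: \<eta>_def\<close>)
          have n: "\<bar>f t x - f t0 x\<bar> \<le> \<eta>" by (rule near1[OF t strip[OF True]])
          have "\<bar>f t x - G1 t + G1 t0\<bar> \<le> \<bar>f t x\<bar> + r / 2" using near3[OF t] r(1) by linarith
          then have "penalty r (f t x - G1 t + G1 t0) \<le> (f t x)\<^sup>2" by (rule penalty_le[OF r(1)])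
          \<comment> \<open>Since \<open>f t x\<close> lies between -1 and 0, the penalty is paid
            for by the term \<open>f t x\<close> in \<open>est\<close>, and exactly
            \<open>a t\<close> remains.\<close>
          also have "(f t x)\<^sup>2 \<le> 1 * - f t x"
          proof -
            have "\<bar>f t x\<bar> \<le> 1" using n True r(2) \<eta>(2) by linarith
            then have "- f t x * - f t x \<le> 1 * - f t x" using fx by (intro mult_right_mono) auto
            then show ?thesis by (simp add: power2_eq_square)
          qed
          finally show ?thesis using est by linarith
        next
          case False
          show ?thesis
          proof (cases "x \<in> Q")
            \<comment> \<open>Off the strip but inside the set at time \<open>t\<close>, the point
              was deeper than \<open>r\<close> at time \<open>t0\<close>. This margin exceeds the
              motion \<eta> of \<open>f'\<close>.\<close>
            case True
            have "f t0 x < - r" using near1[OF t True] fx False \<eta>(2) r(1) by linarith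
            moreover have "f' t0 x \<le> f t0 x + a t0" using P by (simp add: P_def)
            ultimately show ?thesis using near2[OF t True] \<eta>(2) r(1) at by linarith
          next
            \<comment> \<open>The sign of \<open>f\<close> is carried back to time 0, where the
              inclusion of the initial sets applies, and the sign of \<open>f'\<close> is then
              carried forward to \<open>t\<close>.\<close>
            case False
            then have "x \<notin> A.all_zeros" "x \<notin> B.all_zeros" by (auto simp: Q_def)
            moreover have "0 \<in> {0..T}" "0 \<in> {0..T'}" using A.T B.T by auto
            ultimately have "f' t x \<le> 0"
              using A.sign_constant[of x t 0] B.sign_constant[of x 0 t] init[of x] fx tt[OF t] by blast
            then show ?thesis using a_ge[of t] \<epsilon> tt(1)[OF t] by auto
          qed
        qed
      qed
      with t1 show ?thesis by blast
    qed
    have closed: "P s" if s: "s \<in> {0..T0}" "s > 0" and below: "\<And>u. 0 \<le> u \<Longrightarrow> u < s \<Longrightarrow> P u" for s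
      unfolding P_def
    proof
      fix x
      define u where "u = (\<lambda>n. s - s * (1 / real (Suc n)))"
      have "u \<longlonglongrightarrow> s - s * 0" unfolding u_def by (intro tendsto_intros LIMSEQ_Suc[OF lim_1_over_n])
      then have lim: "u \<longlonglongrightarrow> s" by simp
      have mem: "0 \<le> u n" "u n < s" for n using s(2) by (auto simp: u_def field_simps)
      have uT: "u n \<in> {0..T}" "u n \<in> {0..T'}" for n using mem[of n] s T0 by auto
      have sT: "s \<in> {0..T}" "s \<in> {0..T'}" using s T0 by auto
      have a_lim: "(\<lambda>n. a (u n)) \<longlonglongrightarrow> a s" unfolding a_def by (intro tendsto_intros lim)
      show "f' s x \<le> f s x + a s"
      proof (rule LIMSEQ_le[OF B.tendsto_time[OF uT(2) lim sT(2)] tendsto_add[OF A.tendsto_time[OF uT(1) lim sT(1)] a_lim]])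
        show "\<exists>N. \<forall>n\<ge>N. f' (u n) x \<le> f (u n) x + a (u n)" using below[OF mem] by (auto simp: P_def)
      qed
    qed
    have "P t"
    proof (rule ccontr)
      assume nP: "\<not> P t"
      define N where "N = {t \<in> {0..T0}. \<not> P t}"
      define i where "i = Inf N"
      have N: "t \<in> N" "bdd_below N" using nP t by (auto simp: N_def intro!: bdd_belowI[of _ 0])
      have i: "0 \<le> i" "i \<le> t" unfolding i_def using N by (auto simp: N_def intro!: cInf_greatest cInf_lower)
      have below: "P u" if "0 \<le> u" "u < i" for u
        using cInf_lower[of u N] N(2) that i t by (auto simp: N_def i_def)
      have Pi: "P i"
      proof (cases "i = 0")
        case False
        show ?thesis by (rule closed[OF _ _ below]) (use False i t in auto)
      qed (use P_0 in simp)
      show False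
      proof (cases "i = T0")
        case True
        then show False using Pi nP i t by simp
      next
        case False
        then obtain t1 where t1: "i < t1" "\<And>u. u \<in> {i..t1} \<Longrightarrow> P u" using step[of i] i t Pi by force
        have "t1 \<le> Inf N"
        proof (rule cInf_greatest)
          fix u assume u: "u \<in> N"
          then have "i \<le> u" unfolding i_def using N by (intro cInf_lower)
          then show "t1 \<le> u" using t1(2)[of u] u by (force simp: N_def)
        qed (use N in auto)
        then show False using t1 by (simp add: i_def)
      qed
    qed
    then show ?thesis by (simp add: P_def a_def)
  qed
  define m where "m = min R' (r0' / 4) / exp (K * T0)"
  have m: "m > 0" using B.R r0'(1) by (simp add: m_def)
  show ?thesis
  proof (rule field_le_epsilon)
    fix e :: real assume e: "e > 0"
    \<comment> \<open>The first bound meets the smallness condition of \<open>main\<close>; the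
      second makes the allowance at time \<open>t\<close> at most \<open>e\<close>.\<close>
    define \<epsilon> where "\<epsilon> = min (m / 2) (e / exp (K * t))"
    have \<epsilon>: "\<epsilon> > 0" "\<epsilon> < m" using m e by (auto simp: \<epsilon>_def)
    have "\<epsilon> * exp (K * T0) < m * exp (K * T0)" using \<epsilon> by simp
    also have "\<dots> = min R' (r0' / 4)" by (simp add: m_def)
    finally have "f' t x \<le> f t x + \<epsilon> * exp (K * t)" using t by (intro main \<epsilon>) (auto simp: T0_def)
    also have "\<dots> \<le> 0 + (e / exp (K * t)) * exp (K * t)"
      by (intro add_mono x mult_right_mono) (auto simp: \<epsilon>_def)
    finally show "f' t x \<le> 0 + e" by simp
  qed
qed

end

theorem theorem2:
  fixes \<phi> :: "plane \<Rightarrow> real"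
    and G G2 :: "real \<Rightarrow> plane \<Rightarrow> real"
    and G1 :: "real \<Rightarrow> real"
  assumes G: "\<And>t x. t \<ge> 0 \<Longrightarrow> G t x = G1 t + G2 t x"
    and G1: "continuous_on {0..} G1"
    and G2: "C1_Lip {0..} UNIV G2"
    and G1_or_G2: "(\<forall>t\<ge>0. G1 t = 0) \<or> (\<forall>t\<ge>0. \<forall>x. G2 t x = 0)"
    and smooth: "smooth_anisotropy \<phi>"
    and elliptic: "elliptic_anisotropy \<phi>"
  shows
    "(\<forall>E0 T1 T2 E1 E2.
        compact (frontier E0) \<and> (\<exists>R>0. RW_condition \<phi> R E0) \<and>
        regular_flow \<phi> G E0 T1 E1 \<and> regular_flow \<phi> G E0 T2 E2 \<longrightarrow>
        (\<forall>t\<in>{0..min T1 T2}. E1 t = E2 t)) \<and>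
     (\<forall>E0 E0' T T' E E'.
        E0 \<subseteq> E0' \<and>
        compact (frontier E0) \<and> (\<exists>R>0. RW_condition \<phi> R E0) \<and>
        compact (frontier E0') \<and> (\<exists>R>0. RW_condition \<phi> R E0') \<and>
        regular_flow \<phi> G E0 T E \<and> regular_flow \<phi> G E0' T' E' \<longrightarrow>
        (\<forall>t\<in>{0..min T T'}. E t \<subseteq> E' t))"
proof -
  obtain c0 c1 where "elliptic_norm \<phi> c0 c1" using elliptic_normI[OF elliptic] by blast
  then interpret elliptic_norm \<phi> c0 c1 .
  have comparison: "E t \<subseteq> E' t"
    if sub: "E0 \<subseteq> E0'" and cpt: "compact (frontier E0)" "compact (frontier E0')"
      and E: "regular_flow \<phi> G E0 T E" and E': "regular_flow \<phi> G E0' T' E'" and t: "t \<in> {0..min T T'}"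
    for E0 E0' T T' E E' t
  proof
    fix x assume x: "x \<in> E t"
    define f where "f = (\<lambda>t x. real_of_ereal (sdist \<phi> (E t) x))"
    define f' where "f' = (\<lambda>t x. real_of_ereal (sdist \<phi> (E' t) x))"
    obtain U R \<Lambda> C L where A: "reg_flow \<phi> c0 c1 T U f G R \<Lambda> C L"
      and f: "\<And>t x. t \<in> {0..T} \<Longrightarrow> f t x \<le> 0 \<longleftrightarrow> x \<in> E t"
      using regular_flow_reg_flow[OF E cpt(1)] unfolding f_def by blast
    obtain U' R' \<Lambda>' C' L' where B: "reg_flow \<phi> c0 c1 T' U' f' G R' \<Lambda>' C' L'"
      and f': "\<And>t x. t \<in> {0..T'} \<Longrightarrow> f' t x \<le> 0 \<longleftrightarrow> x \<in> E' t"
      using regular_flow_reg_flow[OF E' cpt(2)] unfolding f'_def by blast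
    have "f' 0 y \<le> 0" if "f 0 y \<le> 0" for y
      using that f[of 0 y] f'[of 0 y] E E' sub by (auto simp: regular_flow_def)
    with A B interpret flow_pair \<phi> c0 c1 T U f G R \<Lambda> C L T' U' f' R' \<Lambda>' C' L' G1 G2
      by (intro flow_pair.intro flow_pair_axioms.intro elliptic_norm_axioms G G1 G2)
    show "x \<in> E' t" using comparison[OF t, of x] f[of t x] f'[of t x] t x by simp
  qed
  show ?thesis
  proof (intro conjI allI impI ballI)
    fix E0 T1 T2 E1 E2 t
    assume a: "compact (frontier E0) \<and> (\<exists>R>0. RW_condition \<phi> R E0) \<and>
        regular_flow \<phi> G E0 T1 E1 \<and> regular_flow \<phi> G E0 T2 E2" and t: "t \<in> {0..min T1 T2}"
    then show "E1 t = E2 t"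
      using comparison[of E0 E0 T1 E1 T2 E2 t] comparison[of E0 E0 T2 E2 T1 E1 t]
      by (auto simp: min.commute)
  next
    fix E0 E0' T T' E E' t
    assume "E0 \<subseteq> E0' \<and>
        compact (frontier E0) \<and> (\<exists>R>0. RW_condition \<phi> R E0) \<and>
        compact (frontier E0') \<and> (\<exists>R>0. RW_condition \<phi> R E0') \<and>
        regular_flow \<phi> G E0 T E \<and> regular_flow \<phi> G E0' T' E'" "t \<in> {0..min T T'}"
    then show "E t \<subseteq> E' t" using comparison by blast
  qed
qed

end
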